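(* The mapping $\mathcal{A}\colon f \mapsto F_f$ establishes an isomorphism between the spaces $\mathcal{E}(\mathcal{H})$ and $E(\varPhi)$.
   Context: Notation: $n\in\mathbb{N}$ is fixed, $\mathbb{R}_+^n=[0,\infty)^n$, $\|\cdot\|$ is the Euclidean norm, $\langle u,v\rangle=u_1v_1+\cdots+u_nv_n$; for multi-indices $\alpha\in\mathbb{Z}_+^n$: $|\alpha|=\alpha_1+\cdots+\alpha_n$, $\alpha!=\alpha_1!\cdots\alpha_n!$, $x^\alpha=x_1^{\alpha_1}\cdots x_n^{\alpha_n}$, $D^\alpha=\partial^{|\alpha|}/\partial x_1^{\alpha_1}\cdots\partial x_n^{\alpha_n}$. $H(\mathbb{C}^n)$ is the space of entire functions on $\mathbb{C}^n$. For $g\colon\mathbb{R}^n\to[-\infty,+\infty]$, $g^*(x)=\sup_{y\in\mathbb{R}^n}(\langle x,y\rangle-g(y))$. $\mathcal{H}=\{h_\nu\}_{\nu=1}^\infty$ is a fixed family of convex functions $h_\nu\colon\mathbb{R}^n\to\mathbb{R}$ such that for each $\nu\in\mathbb{N}$: 1) $h_\nu(x)=h_\nu(|x_1|,\ldots,|x_n|)$ for $x\in\mathbb{R}^n$; 2) the restriction of $h_\nu$ to $[0,\infty)^n$ is nondecreasing in each variable; 3) $\lim_{x\to\infty} h_\nu(x)/\|x\|=+\infty$; 4) for each $M>0$ there exists a constant $A_{\nu,M}>0$ such that $h_\nu(x)\le\sum_{1\le j\le n:\,x_j\ne0}x_j\ln\frac{x_j}{M}+A_{\nu,M}$ for $x\in[0,\infty)^n$;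 5) there is a constant $\gamma_\nu$ with $h_\nu(x)-h_{\nu+1}(x)\ge\ln2\cdot\sum_{j=1}^n x_j-\gamma_\nu$ for $x\in[0,\infty)^n$; 6) there is a constant $l_\nu$ with $h_{\nu+1}(x+y)\le h_\nu(x)+h_\nu(y)+l_\nu$ for $x,y\in[0,\infty)^n$. For $\nu\in\mathbb{N}$, $m\in\mathbb{Z}_+$, let $$\mathcal{E}_m(h_\nu)=\Big\{f\in C^\infty(\mathbb{R}^n):\ \rho_{m,\nu}(f)=\sup_{x\in\mathbb{R}^n,\ \alpha\in\mathbb{Z}_+^n}\frac{(1+\|x\|)^m|(D^\alpha f)(x)|}{\alpha!\,e^{-h_\nu(\alpha)}}<\infty\Big\},$$ $\mathcal{E}(h_\nu)=\bigcap_{m\ge0}\mathcal{E}_m(h_\nu)$ with the topology defined by the norms $\rho_{m,\nu}$ ($m\in\mathbb{Z}_+$), and $\mathcal{E}(\mathcal{H})=\bigcup_{\nu\ge1}\mathcal{E}(h_\nu)$ with the inductive limit topology of the spaces $\mathcal{E}(h_\nu)$. Each $f\in\mathcal{E}(\mathcal{H})$ has a unique extension to an entire function $F_f$ on $\mathbb{C}^n$, namely $F_f(z)=\sum_{|\alpha|\ge0}\frac{(D^\alpha f)(0)}{\alpha!}z^\alpha$; $\mathcal{A}$ is the map $f\mapsto F_f$. For $\nu\in\mathbb{N}$ let $\varphi_\nu(x)=h_\nu^*(\ln(1+|x_1|),\ldots,\ln(1+|x_n|))$, $x\in\mathbb{R}^n$, and $\varPhi=\{\varphi_\nu\}_{\nu=1}^\infty$.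 For $m\in\mathbb{Z}_+$ let $$E_m(\varphi_\nu)=\Big\{f\in H(\mathbb{C}^n):\ p_{\nu,m}(f)=\sup_{z\in\mathbb{C}^n}\frac{|f(z)|(1+\|z\|)^m}{e^{\varphi_\nu(\operatorname{Im}z)}}<\infty\Big\},$$ $E(\varphi_\nu)=\bigcap_{m\ge0}E_m(\varphi_\nu)$ with the projective limit topology of the spaces $E_m(\varphi_\nu)$ (i.e. defined by the norms $p_{\nu,m}$), and $E(\varPhi)=\bigcup_{\nu\ge1}E(\varphi_\nu)$ with the inductive limit topology of the spaces $E(\varphi_\nu)$. "Isomorphism" means isomorphism of topological vector spaces; inductive limits are taken in the locally convex sense. *)

theory Defs
  imports "HOL-Analysis.Analysis"
begin

section \<open>Multi-indices, partial derivatives, smooth and entire functions\<close>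

definition orthant :: "(real ^ 'n) set" where
  "orthant = {x. \<forall>i. 0 \<le> x $ i}"

definition mi_real :: "nat ^ 'n \<Rightarrow> real ^ 'n" where
  "mi_real \<alpha> = (\<chi> i. real (\<alpha> $ i))"

definition mi_fact :: "nat ^ 'n::finite \<Rightarrow> real" where
  "mi_fact \<alpha> = (\<Prod>i\<in>UNIV. fact (\<alpha> $ i))"

definition mi_power :: "complex ^ 'n::finite \<Rightarrow> nat ^ 'n \<Rightarrow> complex" where
  "mi_power z \<alpha> = (\<Prod>i\<in>UNIV. (z $ i) ^ (\<alpha> $ i))"

definition partial_deriv :: "'n \<Rightarrow> (real ^ 'n::finite \<Rightarrow> complex) \<Rightarrow> real ^ 'n \<Rightarrow> complex" where
  "partial_deriv i f x = vector_derivative (\<lambda>t. f (x + t *\<^sub>R axis i 1)) (at 0)"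

fun Ck :: "nat \<Rightarrow> (real ^ 'n::finite \<Rightarrow> complex) \<Rightarrow> bool" where
  "Ck 0 f \<longleftrightarrow> continuous_on UNIV f"
| "Ck (Suc k) f \<longleftrightarrow> continuous_on UNIV f \<and>
     (\<forall>i. (\<forall>x. (\<lambda>t. f (x + t *\<^sub>R axis i 1)) differentiable (at 0)) \<and> Ck k (partial_deriv i f))"

definition Cinfinity :: "(real ^ 'n::finite \<Rightarrow> complex) set" where
  "Cinfinity = {f. \<forall>k. Ck k f}"

text \<open>The index type carries no order, so an arbitrary enumeration of the coordinates fixes the
  order in which the partial derivatives are taken. On smooth functions it is irrelevant.\<close>

definition coords :: "'n::finite list" where
  "coords = (SOME is. distinct is \<and> set is = UNIV)"

lemma distinct_coords: "distinct (coords :: 'n::finite list)"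
  and set_coords: "set (coords :: 'n::finite list) = UNIV"
proof -
  have "\<exists>is :: 'n list. distinct is \<and> set is = UNIV"
    using finite_distinct_list[of "UNIV :: 'n set"] by auto
  from someI_ex[OF this] show "distinct (coords :: 'n list)" "set (coords :: 'n list) = UNIV"
    unfolding coords_def by auto
qed

definition mderiv :: "nat ^ 'n::finite \<Rightarrow> (real ^ 'n \<Rightarrow> complex) \<Rightarrow> real ^ 'n \<Rightarrow> complex" where
  "mderiv \<alpha> f = foldr (\<lambda>i. partial_deriv i ^^ (\<alpha> $ i)) coords f"

text \<open>Complex differentiability at every point: the real Frechet derivative exists and is
  complex-linear.\<close>

definition entire :: "(complex ^ 'n::finite \<Rightarrow> complex) set" where
  "entire = {f. \<forall>z. \<exists>D. (f has_derivative D) (at z) \<and> (\<forall>c v. D (c *s v) = c * D v)}"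


section \<open>Locally convex topologies on spaces of complex-valued functions\<close>

definition fun_convex :: "('a \<Rightarrow> complex) set \<Rightarrow> bool" where
  "fun_convex C \<longleftrightarrow> (\<forall>f\<in>C. \<forall>g\<in>C. \<forall>t::real. 0 \<le> t \<and> t \<le> 1 \<longrightarrow>
     (\<lambda>x. of_real (1 - t) * f x + of_real t * g x) \<in> C)"

definition fun_subspace :: "('a \<Rightarrow> complex) set \<Rightarrow> bool" where
  "fun_subspace V \<longleftrightarrow> (\<lambda>x. 0) \<in> V \<and> (\<forall>f\<in>V. \<forall>g\<in>V. (\<lambda>x. f x + g x) \<in> V) \<and>
     (\<forall>c. \<forall>f\<in>V. (\<lambda>x. c * f x) \<in> V)"

definition locally_convex_topology :: "('a \<Rightarrow> complex) set \<Rightarrow> ('a \<Rightarrow> complex) topology \<Rightarrow> bool" where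
  "locally_convex_topology V T \<longleftrightarrow>
     fun_subspace V \<and> topspace T = V \<and>
     continuous_map (prod_topology T T) T (\<lambda>(f, g) x. f x + g x) \<and>
     continuous_map (prod_topology euclidean T) T (\<lambda>(c, f) x. c * f x) \<and>
     (\<forall>U. openin T U \<and> (\<lambda>x. 0) \<in> U \<longrightarrow>
        (\<exists>W C. openin T W \<and> (\<lambda>x. 0) \<in> W \<and> W \<subseteq> C \<and> C \<subseteq> U \<and> fun_convex C))"

text \<open>The topology on \<open>V\<close> defined by a family of seminorms: the open balls form a subbase.\<close>

definition seminorm_topology ::
    "('a \<Rightarrow> complex) set \<Rightarrow> ('m \<Rightarrow> ('a \<Rightarrow> complex) \<Rightarrow> ereal) \<Rightarrow> ('a \<Rightarrow> complex) topology" where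
  "seminorm_topology V p = topology_generated_by
     {{g \<in> V. p m (\<lambda>x. g x - f x) < ereal r} | f m r. f \<in> V \<and> 0 < r}"

text \<open>The finest locally convex topology on \<open>V\<close> for which all inclusions of the spaces with
  topologies \<open>S \<nu>\<close> are continuous, obtained as the supremum of all such topologies. The lemmas
  below show that the supremum is itself such a topology.\<close>

definition inductive_limit_topology ::
    "('a \<Rightarrow> complex) set \<Rightarrow> 'i set \<Rightarrow> ('i \<Rightarrow> ('a \<Rightarrow> complex) topology) \<Rightarrow> ('a \<Rightarrow> complex) topology" where
  "inductive_limit_topology V I S = topology_generated_by
     {U. \<exists>T. locally_convex_topology V T \<and> (\<forall>\<nu>\<in>I. continuous_map (S \<nu>) T (\<lambda>f. f)) \<and> openin T U}"

lemma inductive_limit_topology_finest: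
  assumes "locally_convex_topology V T" "\<And>\<nu>. \<nu> \<in> I \<Longrightarrow> continuous_map (S \<nu>) T (\<lambda>f. f)" "openin T U"
  shows "openin (inductive_limit_topology V I S) U"
  unfolding inductive_limit_topology_def using assms
  by (intro topology_generated_by_Basis) blast

lemma continuous_map_indiscrete:
  assumes "\<And>U. openin T U \<longleftrightarrow> U = {} \<or> U = topspace T" "\<And>x. x \<in> topspace X \<Longrightarrow> f x \<in> topspace T"
  shows "continuous_map X T f"
proof -
  have "{x \<in> topspace X. f x \<in> topspace T} = topspace X"
    using assms(2) by auto
  then show ?thesis
    using assms by (auto simp: continuous_map_def)
qed

lemma locally_convex_indiscrete:
  assumes V: "fun_subspace V"
  obtains T where "locally_convex_topology V T" "\<And>U. openin T U \<longleftrightarrow> U = {} \<or> U = V"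
proof -
  define T where "T = topology (\<lambda>U. U = {} \<or> U = V)"
  have "istopology (\<lambda>U. U = {} \<or> U = V)"
    by (auto simp: istopology_def)
  then have o: "openin T U \<longleftrightarrow> U = {} \<or> U = V" for U
    unfolding T_def by (simp add: topology_inverse')
  have ts: "topspace T = V"
    unfolding topspace_def by (auto simp: o)
  have add: "(\<lambda>x. f x + g x) \<in> V" if "f \<in> V" "g \<in> V" for f g
    using V that by (simp add: fun_subspace_def)
  have scale: "(\<lambda>x. c * f x) \<in> V" if "f \<in> V" for f c
    using V that by (simp add: fun_subspace_def)
  have "fun_convex V"
    unfolding fun_convex_def by (intro ballI allI impI add scale)
  moreover have "continuous_map (prod_topology T T) T (\<lambda>(f, g) x. f x + g x)"
    by (rule continuous_map_indiscrete) (use add in \<open>auto simp: ts o\<close>)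
  moreover have "continuous_map (prod_topology euclidean T) T (\<lambda>(c, f) x. c * f x)"
    by (rule continuous_map_indiscrete) (use scale in \<open>auto simp: ts o\<close>)
  moreover have "\<exists>W C. openin T W \<and> (\<lambda>x. 0) \<in> W \<and> W \<subseteq> C \<and> C \<subseteq> U \<and> fun_convex C"
    if "openin T U \<and> (\<lambda>x. 0) \<in> U" for U
  proof (intro exI conjI)
    have "U = V"
      using that o by blast
    then show "openin T V" "(\<lambda>x. 0) \<in> V" "V \<subseteq> U" "V \<subseteq> V" "fun_convex V"
      using that \<open>fun_convex V\<close> by simp_all
  qed
  ultimately have "locally_convex_topology V T"
    unfolding locally_convex_topology_def using V ts by (intro conjI allI impI)
  from that[OF this o] show ?thesis .
qed

lemma topspace_inductive_limit_topology:
  assumes V: "fun_subspace V" and S: "\<And>\<nu>. \<nu> \<in> I \<Longrightarrow> topspace (S \<nu>) \<subseteq> V"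
  shows "topspace (inductive_limit_topology V I S) = V"
proof -
  obtain T where T: "locally_convex_topology V T" "\<And>U. openin T U \<longleftrightarrow> U = {} \<or> U = V"
    using locally_convex_indiscrete[OF V] by metis
  have ts: "topspace T = V"
    using T(1) by (simp add: locally_convex_topology_def)
  have "continuous_map (S \<nu>) T (\<lambda>f. f)" if "\<nu> \<in> I" for \<nu>
    using S[OF that] by (intro continuous_map_indiscrete) (auto simp: ts T(2))
  then have "openin (inductive_limit_topology V I S) V"
    using inductive_limit_topology_finest[OF T(1), of I S V] by (simp add: T(2))
  moreover have "topspace (inductive_limit_topology V I S) \<subseteq> V"
    unfolding inductive_limit_topology_def topology_generated_by_topspace
    by (auto simp: locally_convex_topology_def dest!: openin_subset)
  ultimately show ?thesis
    by (simp add: openin_subset subset_antisym)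
qed

lemma continuous_map_into_inductive_limit:
  assumes "fun_subspace V" "\<And>\<nu>. \<nu> \<in> I \<Longrightarrow> topspace (S \<nu>) \<subseteq> V"
    and f: "\<And>x. x \<in> topspace X \<Longrightarrow> f x \<in> V"
    and cont: "\<And>T. locally_convex_topology V T \<Longrightarrow> (\<And>\<nu>. \<nu> \<in> I \<Longrightarrow> continuous_map (S \<nu>) T (\<lambda>f. f)) \<Longrightarrow>
           continuous_map X T f"
  shows "continuous_map X (inductive_limit_topology V I S) f"
  unfolding inductive_limit_topology_def
proof (rule continuous_on_generated_topo)
  fix U assume "U \<in> {U. \<exists>T. locally_convex_topology V T \<and>
    (\<forall>\<nu>\<in>I. continuous_map (S \<nu>) T (\<lambda>f. f)) \<and> openin T U}"
  then obtain T where T: "locally_convex_topology V T"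
      "\<And>\<nu>. \<nu> \<in> I \<Longrightarrow> continuous_map (S \<nu>) T (\<lambda>f. f)" "openin T U"
    by blast
  from cont[OF T(1,2)] T(3) show "openin X (f -` U \<inter> topspace X)"
    by (simp add: continuous_map_alt)
next
  show "f ` topspace X \<subseteq> \<Union> {U. \<exists>T. locally_convex_topology V T \<and>
    (\<forall>\<nu>\<in>I. continuous_map (S \<nu>) T (\<lambda>f. f)) \<and> openin T U}"
    using topspace_inductive_limit_topology[of V I S, OF assms(1,2)] f
    unfolding inductive_limit_topology_def topology_generated_by_topspace
    by (simp add: image_subset_iff)
qed

lemma continuous_map_inclusion_inductive_limit:
  assumes "fun_subspace V" "\<And>\<nu>. \<nu> \<in> I \<Longrightarrow> topspace (S \<nu>) \<subseteq> V" and "\<nu> \<in> I"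
  shows "continuous_map (S \<nu>) (inductive_limit_topology V I S) (\<lambda>f. f)"
proof (rule continuous_map_into_inductive_limit[OF assms(1,2)])
  show "f \<in> V" if "f \<in> topspace (S \<nu>)" for f
    using assms(2)[OF \<open>\<nu> \<in> I\<close>] that by (rule subsetD)
  show "continuous_map (S \<nu>) T (\<lambda>f. f)"
    if "\<And>\<nu>. \<nu> \<in> I \<Longrightarrow> continuous_map (S \<nu>) T (\<lambda>f. f)" for T
    using that \<open>\<nu> \<in> I\<close> .
qed

lemma locally_convex_inductive_limit_topology:
  assumes V: "fun_subspace V" and S: "\<And>\<nu>. \<nu> \<in> I \<Longrightarrow> topspace (S \<nu>) \<subseteq> V"
  shows "locally_convex_topology V (inductive_limit_topology V I S)"
proof -
  define L where "L = inductive_limit_topology V I S"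
  have ts: "topspace L = V"
    unfolding L_def by (rule topspace_inductive_limit_topology[OF V S])
  have id: "continuous_map L T (\<lambda>f. f)"
    if T: "locally_convex_topology V T" "\<And>\<nu>. \<nu> \<in> I \<Longrightarrow> continuous_map (S \<nu>) T (\<lambda>f. f)" for T
  proof -
    have "topspace T = V"
      using T(1) by (simp add: locally_convex_topology_def)
    moreover have "openin L {f \<in> V. f \<in> U}" if U: "openin T U" for U
    proof -
      have "{f \<in> V. f \<in> U} = U"
        using openin_subset[OF U] \<open>topspace T = V\<close> by auto
      then show ?thesis
        unfolding L_def using inductive_limit_topology_finest[of V T I S, OF T U] by simp
    qed
    ultimately show ?thesis
      by (auto simp: continuous_map_def ts)
  qed
  have "continuous_map (prod_topology L L) L (\<lambda>(f, g) x. f x + g x)"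
    unfolding L_def
  proof (rule continuous_map_into_inductive_limit[OF V S], simp_all flip: L_def)
    fix p assume "p \<in> topspace L \<times> topspace L"
    then show "(case p of (f, g) \<Rightarrow> \<lambda>x. f x + g x) \<in> V"
      using V by (auto simp: ts fun_subspace_def)
  next
    fix T assume T: "locally_convex_topology V T" "\<And>\<nu>. \<nu> \<in> I \<Longrightarrow> continuous_map (S \<nu>) T (\<lambda>f. f)"
    have "continuous_map (prod_topology L L) (prod_topology T T) (\<lambda>(f, g). (f, g))"
      using id[OF T] by (subst continuous_map_prod_top) simp
    moreover have "continuous_map (prod_topology T T) T (\<lambda>(f, g) x. f x + g x)"
      using T(1) by (simp add: locally_convex_topology_def)
    ultimately have "continuous_map (prod_topology L L) T ((\<lambda>(f, g) x. f x + g x) \<circ> (\<lambda>(u, v). (u, v)))"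
      by (rule continuous_map_compose)
    then show "continuous_map (prod_topology L L) T (\<lambda>(f, g) x. f x + g x)"
      by (simp add: o_def case_prod_unfold)
  qed
  moreover have "continuous_map (prod_topology euclidean L) L (\<lambda>(c, f) x. c * f x)"
    unfolding L_def
  proof (rule continuous_map_into_inductive_limit[OF V S], simp_all flip: L_def)
    fix p :: "complex \<times> ('a \<Rightarrow> complex)" assume "p \<in> UNIV \<times> topspace L"
    then show "(case p of (c, f) \<Rightarrow> \<lambda>x. c * f x) \<in> V"
      using V by (auto simp: ts fun_subspace_def)
  next
    fix T assume T: "locally_convex_topology V T" "\<And>\<nu>. \<nu> \<in> I \<Longrightarrow> continuous_map (S \<nu>) T (\<lambda>f. f)"
    have "continuous_map (prod_topology euclidean L) (prod_topology euclidean T)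
        (\<lambda>(c :: complex, f). (c, f))"
      using id[OF T] by (subst continuous_map_prod_top) (simp add: continuous_map_id[unfolded id_def])
    moreover have "continuous_map (prod_topology euclidean T) T (\<lambda>(c, f) x. c * f x)"
      using T(1) by (simp add: locally_convex_topology_def)
    ultimately have "continuous_map (prod_topology euclidean L) T ((\<lambda>(c, f) x. c * f x) \<circ> (\<lambda>(u, v). (u, v)))"
      by (rule continuous_map_compose)
    then show "continuous_map (prod_topology euclidean L) T (\<lambda>(c, f) x. c * f x)"
      by (simp add: o_def case_prod_unfold)
  qed
  moreover have "\<exists>W C. openin L W \<and> (\<lambda>x. 0) \<in> W \<and> W \<subseteq> C \<and> C \<subseteq> U \<and> fun_convex C"
    if U: "openin L U" "(\<lambda>x. 0) \<in> U" for U
  proof -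
    define B where "B = {U. \<exists>T. locally_convex_topology V T \<and>
      (\<forall>\<nu>\<in>I. continuous_map (S \<nu>) T (\<lambda>f. f)) \<and> openin T U}"
    have "generate_topology_on B U"
      using U(1) unfolding L_def inductive_limit_topology_def B_def
      by (rule openin_topology_generated_by)
    then show ?thesis
      using U(2)
    proof (induction rule: generate_topology_on.induct)
      case Empty
      then show ?case by simp
    next
      case (Int a b)
      then obtain W C W' C' where
        "openin L W" "(\<lambda>x. 0) \<in> W" "W \<subseteq> C" "C \<subseteq> a" "fun_convex C"
        "openin L W'" "(\<lambda>x. 0) \<in> W'" "W' \<subseteq> C'" "C' \<subseteq> b" "fun_convex C'"
        by blast
      then have "openin L (W \<inter> W')" "(\<lambda>x. 0) \<in> W \<inter> W'" "W \<inter> W' \<subseteq> C \<inter> C'" "C \<inter> C' \<subseteq> a \<inter> b"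
        "fun_convex (C \<inter> C')"
        by (auto simp: fun_convex_def)
      then show ?case by blast
    next
      case (UN K)
      then obtain k where "k \<in> K" "(\<lambda>x. 0) \<in> k" by blast
      with UN.IH[OF this] show ?case
        by (meson Union_upper order_trans)
    next
      case (Basis s)
      then obtain T where T: "locally_convex_topology V T"
          "\<And>\<nu>. \<nu> \<in> I \<Longrightarrow> continuous_map (S \<nu>) T (\<lambda>f. f)" "openin T s"
        unfolding B_def by blast
      then obtain W C where "openin T W" "(\<lambda>x. 0) \<in> W" "W \<subseteq> C" "C \<subseteq> s" "fun_convex C"
        using Basis.prems unfolding locally_convex_topology_def by meson
      moreover have "openin L W"
        unfolding L_def using inductive_limit_topology_finest[of V T I S W] T \<open>openin T W\<close> by blast
      ultimately show ?case by blast
    qed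
  qed
  ultimately have "locally_convex_topology V L"
    unfolding locally_convex_topology_def using V ts by blast
  then show ?thesis
    by (simp add: L_def)
qed

definition tvs_isomorphism ::
    "('a \<Rightarrow> complex) set \<Rightarrow> ('a \<Rightarrow> complex) topology \<Rightarrow>
     ('b \<Rightarrow> complex) set \<Rightarrow> ('b \<Rightarrow> complex) topology \<Rightarrow>
     (('a \<Rightarrow> complex) \<Rightarrow> ('b \<Rightarrow> complex)) \<Rightarrow> bool" where
  "tvs_isomorphism V S W T A \<longleftrightarrow>
     (\<forall>f\<in>V. \<forall>g\<in>V. A (\<lambda>x. f x + g x) = (\<lambda>x. A f x + A g x)) \<and>
     (\<forall>c. \<forall>f\<in>V. A (\<lambda>x. c * f x) = (\<lambda>x. c * A f x)) \<and>
     bij_betw A V W \<and> homeomorphic_map S T A"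


section \<open>The spaces of smooth functions\<close>

definition rho :: "(real ^ 'n::finite \<Rightarrow> real) \<Rightarrow> nat \<Rightarrow> (real ^ 'n \<Rightarrow> complex) \<Rightarrow> ereal" where
  "rho h m f = (SUP (x, \<alpha>) \<in> UNIV.
     ereal ((1 + norm x) ^ m * cmod (mderiv \<alpha> f x) / (mi_fact \<alpha> * exp (- h (mi_real \<alpha>)))))"

definition cE_space_m :: "nat \<Rightarrow> (real ^ 'n::finite \<Rightarrow> real) \<Rightarrow> (real ^ 'n \<Rightarrow> complex) set" where
  "cE_space_m m h = {f \<in> Cinfinity. rho h m f < \<infinity>}"

definition cE_space :: "(real ^ 'n::finite \<Rightarrow> real) \<Rightarrow> (real ^ 'n \<Rightarrow> complex) set" where
  "cE_space h = (\<Inter>m. cE_space_m m h)"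

definition cE_top :: "(real ^ 'n::finite \<Rightarrow> real) \<Rightarrow> (real ^ 'n \<Rightarrow> complex) topology" where
  "cE_top h = seminorm_topology (cE_space h) (rho h)"

text \<open>Families of weights are indexed by \<open>\<nu> \<ge> 1\<close>; the value at \<open>0\<close> is never used.\<close>

definition cE_lim :: "(nat \<Rightarrow> real ^ 'n::finite \<Rightarrow> real) \<Rightarrow> (real ^ 'n \<Rightarrow> complex) set" where
  "cE_lim h = (\<Union>\<nu>\<in>{1..}. cE_space (h \<nu>))"

definition cE_lim_top :: "(nat \<Rightarrow> real ^ 'n::finite \<Rightarrow> real) \<Rightarrow> (real ^ 'n \<Rightarrow> complex) topology" where
  "cE_lim_top h = inductive_limit_topology (cE_lim h) {1..} (\<lambda>\<nu>. cE_top (h \<nu>))"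


section \<open>The spaces of entire functions\<close>

definition conjugate :: "(real ^ 'n::finite \<Rightarrow> ereal) \<Rightarrow> real ^ 'n \<Rightarrow> ereal" where
  "conjugate g x = (SUP y. ereal (x \<bullet> y) - g y)"

text \<open>The conjugate of a real-valued convex function \<open>h\<close> with \<open>h x / norm x \<longrightarrow> \<infinity>\<close> is finite
  everywhere, so the conversion to \<open>real\<close> is harmless for such weights.\<close>

definition phi :: "(real ^ 'n::finite \<Rightarrow> real) \<Rightarrow> real ^ 'n \<Rightarrow> real" where
  "phi h x = real_of_ereal (conjugate (\<lambda>y. ereal (h y)) (\<chi> i. ln (1 + \<bar>x $ i\<bar>)))"

definition im_vec :: "complex ^ 'n \<Rightarrow> real ^ 'n" where
  "im_vec z = (\<chi> i. Im (z $ i))"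

definition pnorm :: "(real ^ 'n::finite \<Rightarrow> real) \<Rightarrow> nat \<Rightarrow> (complex ^ 'n \<Rightarrow> complex) \<Rightarrow> ereal" where
  "pnorm \<phi> m f = (SUP z. ereal (cmod (f z) * (1 + norm z) ^ m / exp (\<phi> (im_vec z))))"

definition E_space_m :: "nat \<Rightarrow> (real ^ 'n::finite \<Rightarrow> real) \<Rightarrow> (complex ^ 'n \<Rightarrow> complex) set" where
  "E_space_m m \<phi> = {f \<in> entire. pnorm \<phi> m f < \<infinity>}"

definition E_space :: "(real ^ 'n::finite \<Rightarrow> real) \<Rightarrow> (complex ^ 'n \<Rightarrow> complex) set" where
  "E_space \<phi> = (\<Inter>m. E_space_m m \<phi>)"

definition E_top :: "(real ^ 'n::finite \<Rightarrow> real) \<Rightarrow> (complex ^ 'n \<Rightarrow> complex) topology" where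
  "E_top \<phi> = seminorm_topology (E_space \<phi>) (pnorm \<phi>)"

definition E_lim :: "(nat \<Rightarrow> real ^ 'n::finite \<Rightarrow> real) \<Rightarrow> (complex ^ 'n \<Rightarrow> complex) set" where
  "E_lim \<Phi> = (\<Union>\<nu>\<in>{1..}. E_space (\<Phi> \<nu>))"

definition E_lim_top :: "(nat \<Rightarrow> real ^ 'n::finite \<Rightarrow> real) \<Rightarrow> (complex ^ 'n \<Rightarrow> complex) topology" where
  "E_lim_top \<Phi> = inductive_limit_topology (E_lim \<Phi>) {1..} (\<lambda>\<nu>. E_top (\<Phi> \<nu>))"


section \<open>The extension map\<close>

definition extension_map :: "(real ^ 'n::finite \<Rightarrow> complex) \<Rightarrow> complex ^ 'n \<Rightarrow> complex" where
  "extension_map f z = (\<Sum>\<^sub>\<infinity>\<alpha>\<in>UNIV. mderiv \<alpha> f 0 / of_real (mi_fact \<alpha>) * mi_power z \<alpha>)"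

end

theory Submission
  imports Defs "HOL-Complex_Analysis.Complex_Analysis"
begin

text \<open>If \<open>f\<close> lies in the space of \<open>h\<close>, then \<open>F (x + i y)\<close> is the sum of \<open>D\<^sup>\<alpha> f(x) (i y)\<^sup>\<alpha> / \<alpha>!\<close>,
  whose terms are at most \<open>exp (- h(\<alpha>)) \<bar>y\<bar>\<^sup>\<alpha>\<close> up to the decay in \<open>x\<close>; condition 5 trades one step in
  the index for a factor \<open>2 ^ (- \<bar>\<alpha>\<bar>)\<close>, so the sum is bounded by \<open>exp (\<phi>(y))\<close>. Conversely, Cauchy's estimate
  on the polydisc of radius \<open>R\<close> bounds \<open>D\<^sup>\<alpha> F(x) / \<alpha>!\<close> by \<open>exp (\<phi>(R)) / R\<^sup>\<alpha>\<close>, and convexity of \<open>h\<close> gives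
  an \<open>R\<close>, read off a subgradient at \<open>\<alpha>\<close>, for which this is at most a constant times \<open>exp (- h(\<alpha>))\<close>.
  Condition 6 absorbs polynomial factors in \<open>y\<close> and \<open>R\<close> into \<open>\<phi>\<close> at the cost of another step. Hence the map and
  its inverse, the restriction to the real space, are continuous between the steps of the inductive limits.\<close>

text \<open>Each direction loses two steps of the scale and keeps the seminorm index
  \<open>m\<close>. Both make the same two trades in opposite order: the extension first spends
  \<open>shift\<close> to make the series summable and then \<open>subadd\<close> on the powers of
  y, while the restriction first removes the powers of the radius by \<open>subadd\<close> and then
  picks the radius with \<open>shift\<close>. The factor 2 in \<open>shift\<close> fits because
  \<open>phi\<close> takes ln(1 + t) in place of ln t, and 1 + t is at most 2 t for t at least 1.
  Superlinear growth makes exp(-h(\<alpha>)) decay faster than any geometric sequence in \<alpha>;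
  this is why the Taylor series of f converges everywhere and represents f, so that f is the
  restriction of an entire function. The obstacle is to lift the Cauchy and Taylor theory of one
  variable to several variables. For this, entire functions are treated as continuous functions that
  are holomorphic in each variable, and iterated derivatives are always taken in the fixed order of
  \<open>coords\<close>, so that each coordinate is handled on its own and no interchange of partial
  derivatives arises.\<close>

no_notation fps_nth (infixl \<open>$\<close> 75)


section \<open>Maps between inductive limits\<close>

definition fun_linear_on :: "('a \<Rightarrow> complex) set \<Rightarrow> (('a \<Rightarrow> complex) \<Rightarrow> 'b \<Rightarrow> complex) \<Rightarrow> bool" where
  "fun_linear_on V A \<longleftrightarrow>
     (\<forall>f\<in>V. \<forall>g\<in>V. A (\<lambda>x. f x + g x) = (\<lambda>x. A f x + A g x)) \<and>
     (\<forall>c. \<forall>f\<in>V. A (\<lambda>x. c * f x) = (\<lambda>x. c * A f x))"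

lemma fun_linear_on_add:
  "fun_linear_on V A \<Longrightarrow> f \<in> V \<Longrightarrow> g \<in> V \<Longrightarrow> A (\<lambda>x. f x + g x) = (\<lambda>x. A f x + A g x)"
  by (simp add: fun_linear_on_def)

lemma fun_linear_on_scale:
  "fun_linear_on V A \<Longrightarrow> f \<in> V \<Longrightarrow> A (\<lambda>x. c * f x) = (\<lambda>x. c * A f x)"
  by (simp add: fun_linear_on_def)

lemma fun_subspace_0: "fun_subspace V \<Longrightarrow> (\<lambda>x. 0) \<in> V"
  by (simp add: fun_subspace_def)

lemma fun_subspace_add: "fun_subspace V \<Longrightarrow> f \<in> V \<Longrightarrow> g \<in> V \<Longrightarrow> (\<lambda>x. f x + g x) \<in> V"
  by (simp add: fun_subspace_def)

lemma fun_subspace_scale: "fun_subspace V \<Longrightarrow> f \<in> V \<Longrightarrow> (\<lambda>x. c * f x) \<in> V"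
  by (simp add: fun_subspace_def)

lemma fun_subspace_diff:
  assumes "fun_subspace V" "f \<in> V" "g \<in> V"
  shows "(\<lambda>x. f x - g x) \<in> V"
  using fun_subspace_add[OF assms(1,2) fun_subspace_scale[OF assms(1,3), of "-1"]] by simp

lemma fun_linear_on_0:
  assumes "fun_linear_on V A" "fun_subspace V"
  shows "A (\<lambda>x. 0) = (\<lambda>x. 0)"
  using fun_linear_on_scale[OF assms(1) fun_subspace_0[OF assms(2)], of 0] by simp

lemma fun_linear_on_diff:
  assumes A: "fun_linear_on V A" and V: "fun_subspace V" and "f \<in> V" "g \<in> V"
  shows "A (\<lambda>x. f x - g x) = (\<lambda>x. A f x - A g x)"
  using fun_linear_on_add[OF A \<open>f \<in> V\<close> fun_subspace_scale[OF V \<open>g \<in> V\<close>, of "-1"]]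
    fun_linear_on_scale[OF A \<open>g \<in> V\<close>, of "-1"] by simp

lemma fun_linear_on_subset: "fun_linear_on V A \<Longrightarrow> U \<subseteq> V \<Longrightarrow> fun_linear_on U A"
  unfolding fun_linear_on_def by blast

lemma fun_subspace_incseq_Union:
  assumes V: "\<And>\<nu>::nat. 1 \<le> \<nu> \<Longrightarrow> fun_subspace (V \<nu>)"
    and incl: "\<And>\<nu>. 1 \<le> \<nu> \<Longrightarrow> V \<nu> \<subseteq> V (\<nu> + 1)"
  shows "fun_subspace (\<Union>\<nu>\<in>{1..}. V \<nu>)"
proof -
  have mono: "V \<nu> \<subseteq> V \<mu>" if "1 \<le> \<nu>" "\<nu> \<le> \<mu>" for \<nu> \<mu>
    using that(2)
  proof (induction \<mu> rule: dec_induct)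
    case (step \<mu>)
    then show ?case
      using incl[of \<mu>] that(1) by simp
  qed simp
  have "(\<lambda>x. f x + g x) \<in> (\<Union>\<nu>\<in>{1..}. V \<nu>)"
    if "f \<in> V \<nu>" "g \<in> V \<mu>" "1 \<le> \<nu>" "1 \<le> \<mu>" for f g \<nu> \<mu>
  proof -
    have "f \<in> V (max \<nu> \<mu>)" "g \<in> V (max \<nu> \<mu>)"
      using mono[of \<nu> "max \<nu> \<mu>"] mono[of \<mu> "max \<nu> \<mu>"] that by auto
    then have "(\<lambda>x. f x + g x) \<in> V (max \<nu> \<mu>)"
      using V that by (intro fun_subspace_add) auto
    then show ?thesis
      using that by (intro UN_I[of "max \<nu> \<mu>"]) auto
  qed
  then show ?thesis
    unfolding fun_subspace_def[of "\<Union>\<nu>\<in>{1..}. V \<nu>"]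
    using fun_subspace_0[OF V] fun_subspace_scale[OF V] by fastforce
qed

text \<open>Continuity out of an inductive limit is tested with locally convex topologies on the
  source; this supplies the right one. The vector operations are continuous because composing them
  with the linear map \<open>A\<close> turns them into the operations of \<open>T\<close>, and
  preimages of convex sets under \<open>A\<close> are convex.\<close>

lemma locally_convex_pullback:
  assumes V: "fun_subspace V" and A: "fun_linear_on V A" "A ` V \<subseteq> W"
    and T: "locally_convex_topology W T"
  shows "locally_convex_topology V (pullback_topology V A T)"
proof -
  define P where "P = pullback_topology V A T"
  have tsT: "topspace T = W"
    using T by (simp add: locally_convex_topology_def)
  have tsP: "topspace P = V"
    unfolding P_def topspace_pullback_topology tsT using A(2) by blast
  have AP: "continuous_map P T A"
    unfolding P_def using continuous_map_pullback[OF continuous_map_id, of V A T] by (simp add: o_def id_def)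
  have "continuous_map (prod_topology P P) P (\<lambda>(f, g) x. f x + g x)"
    unfolding P_def
  proof (rule continuous_map_pullback'; fold P_def)
    have "continuous_map (prod_topology P P) (prod_topology T T) (\<lambda>(f, g). (A f, A g))"
      using AP by (subst continuous_map_prod_top) simp
    moreover have "continuous_map (prod_topology T T) T (\<lambda>(f, g) x. f x + g x)"
      using T by (simp add: locally_convex_topology_def)
    ultimately have "continuous_map (prod_topology P P) T
        ((\<lambda>(f, g) x. f x + g x) \<circ> (\<lambda>(f, g). (A f, A g)))"
      by (rule continuous_map_compose)
    then show "continuous_map (prod_topology P P) T (A \<circ> (\<lambda>(f, g) x. f x + g x))"
      by (rule continuous_map_eq) (auto simp: tsP fun_linear_on_add[OF A(1)])
    show "topspace (prod_topology P P) \<subseteq> (\<lambda>(f, g) x. f x + g x) -` V"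
      using fun_subspace_add[OF V] by (auto simp: tsP)
  qed
  moreover have "continuous_map (prod_topology euclidean P) P (\<lambda>(c, f) x. c * f x)"
    unfolding P_def
  proof (rule continuous_map_pullback'; fold P_def)
    have "continuous_map (prod_topology euclidean P) (prod_topology euclidean T)
        (\<lambda>(c :: complex, f). (c, A f))"
      using AP by (subst continuous_map_prod_top) (simp add: continuous_map_id[unfolded id_def])
    moreover have "continuous_map (prod_topology euclidean T) T (\<lambda>(c, f) x. c * f x)"
      using T by (simp add: locally_convex_topology_def)
    ultimately have "continuous_map (prod_topology euclidean P) T
        ((\<lambda>(c, f) x. c * f x) \<circ> (\<lambda>(c, f). (c, A f)))"
      by (rule continuous_map_compose)
    then show "continuous_map (prod_topology euclidean P) T (A \<circ> (\<lambda>(c, f) x. c * f x))"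
      by (rule continuous_map_eq) (auto simp: tsP fun_linear_on_scale[OF A(1)])
    show "topspace (prod_topology euclidean P) \<subseteq> (\<lambda>(c :: complex, f) x. c * f x) -` V"
      using fun_subspace_scale[OF V] by (auto simp: tsP)
  qed
  moreover have "\<exists>U' C. openin P U' \<and> (\<lambda>x. 0) \<in> U' \<and> U' \<subseteq> C \<and> C \<subseteq> U \<and> fun_convex C"
    if U: "openin P U \<and> (\<lambda>x. 0) \<in> U" for U
  proof -
    obtain U1 where U1: "openin T U1" "U = A -` U1 \<inter> V"
      using U unfolding P_def openin_pullback_topology by blast
    then have "(\<lambda>x. 0) \<in> U1"
      using U fun_linear_on_0[OF A(1) V] by auto
    then obtain U2 C where U2: "openin T U2" "(\<lambda>x. 0) \<in> U2" "U2 \<subseteq> C" "C \<subseteq> U1" "fun_convex C"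
      using T U1(1) unfolding locally_convex_topology_def by meson
    have "openin P (A -` U2 \<inter> V)"
      unfolding P_def openin_pullback_topology using U2(1) by blast
    moreover have "(\<lambda>x. 0) \<in> A -` U2 \<inter> V"
      using U2(2) fun_linear_on_0[OF A(1) V] fun_subspace_0[OF V] by auto
    moreover have "fun_convex (A -` C \<inter> V)"
      using U2(5) unfolding fun_convex_def
      by (auto simp: fun_linear_on_add[OF A(1)] fun_linear_on_scale[OF A(1)]
          fun_subspace_scale[OF V] intro: fun_subspace_add[OF V])
    ultimately show ?thesis
      using U2(3,4) U1(2) by (intro exI[of _ "A -` U2 \<inter> V"] exI[of _ "A -` C \<inter> V"]) auto
  qed
  ultimately have "locally_convex_topology V P"
    unfolding locally_convex_topology_def using V tsP by blast
  then show ?thesis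
    by (simp add: P_def)
qed

text \<open>The universal property of the limit. The target limit pulled back along \<open>A\<close>
  is locally convex, and each step of the source includes continuously into it because
  \<open>A\<close> maps that step continuously into some step of the target. So it is one of the
  topologies whose supremum is the source limit, and its open sets, the preimages under
  \<open>A\<close>, are open there.\<close>

lemma continuous_map_inductive_limits:
  assumes V: "fun_subspace V" and W: "fun_subspace W"
    and S: "\<And>\<nu>. \<nu> \<in> I \<Longrightarrow> topspace (S \<nu>) \<subseteq> V" and T: "\<And>\<nu>. \<nu> \<in> J \<Longrightarrow> topspace (T \<nu>) \<subseteq> W"
    and A: "fun_linear_on V A" "A ` V \<subseteq> W"
    and cont: "\<And>\<nu>. \<nu> \<in> I \<Longrightarrow> \<exists>\<mu>\<in>J. continuous_map (S \<nu>) (T \<mu>) A"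
  shows "continuous_map (inductive_limit_topology V I S) (inductive_limit_topology W J T) A"
proof -
  define L where "L = inductive_limit_topology V I S"
  define M where "M = inductive_limit_topology W J T"
  define P where "P = pullback_topology V A M"
  have tsL: "topspace L = V"
    unfolding L_def by (rule topspace_inductive_limit_topology[OF V S])
  have tsM: "topspace M = W"
    unfolding M_def by (rule topspace_inductive_limit_topology[OF W T])
  have lcP: "locally_convex_topology V P"
    unfolding P_def M_def
    by (rule locally_convex_pullback[OF V A locally_convex_inductive_limit_topology[OF W T]])
  have SP: "continuous_map (S \<nu>) P (\<lambda>f. f)" if \<nu>: "\<nu> \<in> I" for \<nu>
    unfolding P_def
  proof (rule continuous_map_pullback')
    obtain \<mu> where \<mu>: "\<mu> \<in> J" "continuous_map (S \<nu>) (T \<mu>) A"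
      using cont[OF \<nu>] by blast
    have "continuous_map (T \<mu>) M (\<lambda>f. f)"
      unfolding M_def by (rule continuous_map_inclusion_inductive_limit[OF W T \<mu>(1)])
    from continuous_map_compose[OF \<mu>(2) this]
    show "continuous_map (S \<nu>) M (A \<circ> (\<lambda>f. f))"
      by (simp add: o_def)
    show "topspace (S \<nu>) \<subseteq> (\<lambda>f. f) -` V"
      using S[OF \<nu>] by auto
  qed
  have "openin L {x \<in> V. A x \<in> U}" if "openin M U" for U
    unfolding L_def
  proof (rule inductive_limit_topology_finest[OF lcP SP])
    show "openin P {x \<in> V. A x \<in> U}"
      unfolding P_def openin_pullback_topology using that by blast
  qed
  then have "continuous_map L M A"
    using A(2) by (auto simp: continuous_map_def tsL tsM)
  then show ?thesis
    by (simp add: L_def M_def)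
qed

text \<open>Collects what the argument with open balls uses: vanishing at 0, the triangle
  inequality, and finiteness on \<open>V\<close>, which lets the extended real values be treated as
  real numbers.\<close>

definition seminorms_on :: "('a \<Rightarrow> complex) set \<Rightarrow> ('m \<Rightarrow> ('a \<Rightarrow> complex) \<Rightarrow> ereal) \<Rightarrow> bool" where
  "seminorms_on V p \<longleftrightarrow> fun_subspace V \<and>
     (\<forall>m. p m (\<lambda>x. 0) = 0 \<and> (\<forall>f\<in>V. 0 \<le> p m f \<and> p m f < \<infinity> \<and>
        (\<forall>g\<in>V. p m (\<lambda>x. f x + g x) \<le> p m f + p m g)))"

lemma seminorms_on_subspace: "seminorms_on V p \<Longrightarrow> fun_subspace V"
  by (simp add: seminorms_on_def)

lemma topspace_seminorm_topology:
  assumes "seminorms_on V p"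
  shows "topspace (seminorm_topology V p) = V"
proof
  show "topspace (seminorm_topology V p) \<subseteq> V"
    unfolding seminorm_topology_def topology_generated_by_topspace by auto
  show "V \<subseteq> topspace (seminorm_topology V p)"
  proof
    fix f assume f: "f \<in> V"
    \<comment> \<open>\<open>undefined\<close> stands for an arbitrary index; the index type is
      inhabited.\<close>
    have "f \<in> {g \<in> V. p undefined (\<lambda>x. g x - f x) < ereal 1}"
      using assms f by (simp add: seminorms_on_def)
    then show "f \<in> topspace (seminorm_topology V p)"
      unfolding seminorm_topology_def topology_generated_by_topspace using f zero_less_one
      by blast
  qed
qed

lemma continuous_map_seminorm_topology:
  assumes p: "seminorms_on V p" and q: "seminorms_on W q"
    and A: "fun_linear_on V A" "A ` V \<subseteq> W"
    and bound: "\<And>m. \<exists>k C. 0 < C \<and> (\<forall>f\<in>V. q m (A f) \<le> ereal C * p k f)"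
  shows "continuous_map (seminorm_topology V p) (seminorm_topology W q) A"
proof -
  have V: "fun_subspace V" and W: "fun_subspace W"
    using p q by (simp_all add: seminorms_on_def)
  have ball: "openin (seminorm_topology V p) {g \<in> V. p m (\<lambda>x. g x - f x) < ereal r}"
    if "f \<in> V" "0 < r" for f m r
    unfolding seminorm_topology_def using that by (intro topology_generated_by_Basis) blast
  show ?thesis
    unfolding seminorm_topology_def[of W]
  proof (rule continuous_on_generated_topo)
    fix U assume "U \<in> {{g \<in> W. q m (\<lambda>x. g x - f x) < ereal r} |f m r. f \<in> W \<and> 0 < r}"
    then obtain g0 m r where g0: "g0 \<in> W" "0 < r" "U = {g \<in> W. q m (\<lambda>x. g x - g0 x) < ereal r}"
      by blast
    show "openin (seminorm_topology V p) (A -` U \<inter> topspace (seminorm_topology V p))"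
      unfolding topspace_seminorm_topology[OF p]
    proof (subst openin_subopen, intro ballI)
      fix f assume "f \<in> A -` U \<inter> V"
      then have f: "f \<in> V" "A f \<in> W" "q m (\<lambda>x. A f x - g0 x) < ereal r"
        using g0 by auto
      have fg0: "(\<lambda>x. A f x - g0 x) \<in> W"
        by (rule fun_subspace_diff[OF W f(2) g0(1)])
      then have "0 \<le> q m (\<lambda>x. A f x - g0 x)"
        using q by (simp add: seminorms_on_def)
      then obtain a where a: "q m (\<lambda>x. A f x - g0 x) = ereal a" "a < r"
        using f(3) by (cases "q m (\<lambda>x. A f x - g0 x)") auto
      obtain k C where C: "0 < C" "\<And>f. f \<in> V \<Longrightarrow> q m (A f) \<le> ereal C * p k f"
        using bound[of m] by blast
      \<comment> \<open>\<open>a\<close> is the distance from \<open>A f\<close> to the centre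
        \<open>g0\<close>, so \<open>r - a\<close> is the room left in the target ball; dividing by
        \<open>C\<close> transports it to the source.\<close>
      define B where "B = {g \<in> V. p k (\<lambda>x. g x - f x) < ereal ((r - a) / C)}"
      have "B \<subseteq> A -` U \<inter> V"
      proof
        fix g assume "g \<in> B"
        then have g: "g \<in> V" "p k (\<lambda>x. g x - f x) < ereal ((r - a) / C)"
          by (simp_all add: B_def)
        have gf: "(\<lambda>x. g x - f x) \<in> V"
          by (rule fun_subspace_diff[OF V g(1) f(1)])
        then have "0 \<le> p k (\<lambda>x. g x - f x)"
          using p by (simp add: seminorms_on_def)
        then obtain b where b: "p k (\<lambda>x. g x - f x) = ereal b" "b < (r - a) / C"
          using g(2) by (cases "p k (\<lambda>x. g x - f x)") auto
        have "A (\<lambda>x. g x - f x) \<in> W"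
          using A(2) gf by blast
        then have "q m (\<lambda>x. A (\<lambda>x. g x - f x) x + (A f x - g0 x)) \<le>
            q m (A (\<lambda>x. g x - f x)) + q m (\<lambda>x. A f x - g0 x)"
          using q fg0 by (simp add: seminorms_on_def)
        also have "\<dots> \<le> ereal C * p k (\<lambda>x. g x - f x) + q m (\<lambda>x. A f x - g0 x)"
          by (intro add_right_mono C(2) gf)
        also have "\<dots> < ereal r"
          using b(2) C(1) by (simp add: a b(1) field_simps)
        finally have "q m (\<lambda>x. A g x - g0 x) < ereal r"
          by (simp add: fun_linear_on_diff[OF A(1) V g(1) f(1)])
        then show "g \<in> A -` U \<inter> V"
          using g(1) A(2) by (auto simp: g0(3))
      qed
      moreover have "f \<in> B"
        using p f(1) a(2) C(1) by (simp add: B_def seminorms_on_def)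
      moreover have "openin (seminorm_topology V p) B"
        unfolding B_def using a(2) C(1) by (intro ball f(1)) simp
      ultimately show "\<exists>T. openin (seminorm_topology V p) T \<and> f \<in> T \<and> T \<subseteq> A -` U \<inter> V"
        by blast
    qed
  next
    show "A ` topspace (seminorm_topology V p) \<subseteq>
        \<Union> {{g \<in> W. q m (\<lambda>x. g x - f x) < ereal r} |f m r. f \<in> W \<and> 0 < r}"
      using A(2) unfolding topspace_seminorm_topology[OF p]
      unfolding topspace_seminorm_topology[OF q, unfolded seminorm_topology_def topology_generated_by_topspace] .
  qed
qed

text \<open>Reduces the isomorphism to estimates between norms. In the bounds the target step \<mu>
  is fixed before the seminorm index \<open>m\<close>, as continuity from step to step requires; the
  inclusions of consecutive steps make the unions vector spaces.\<close>

lemma tvs_isomorphism_inductive_limits: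
  fixes V :: "nat \<Rightarrow> ('a \<Rightarrow> complex) set" and W :: "nat \<Rightarrow> ('b \<Rightarrow> complex) set"
    and p :: "nat \<Rightarrow> 'm \<Rightarrow> ('a \<Rightarrow> complex) \<Rightarrow> ereal" and q :: "nat \<Rightarrow> 'k \<Rightarrow> ('b \<Rightarrow> complex) \<Rightarrow> ereal"
  assumes p: "\<And>\<nu>. 1 \<le> \<nu> \<Longrightarrow> seminorms_on (V \<nu>) (p \<nu>)" and q: "\<And>\<nu>. 1 \<le> \<nu> \<Longrightarrow> seminorms_on (W \<nu>) (q \<nu>)"
    and V: "\<And>\<nu>. 1 \<le> \<nu> \<Longrightarrow> V \<nu> \<subseteq> V (\<nu> + 1)" and W: "\<And>\<nu>. 1 \<le> \<nu> \<Longrightarrow> W \<nu> \<subseteq> W (\<nu> + 1)"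
    and A: "fun_linear_on (\<Union>\<nu>\<in>{1..}. V \<nu>) A" and B: "fun_linear_on (\<Union>\<nu>\<in>{1..}. W \<nu>) B"
    and BA: "\<And>\<nu> f. 1 \<le> \<nu> \<Longrightarrow> f \<in> V \<nu> \<Longrightarrow> B (A f) = f"
    and AB: "\<And>\<nu> f. 1 \<le> \<nu> \<Longrightarrow> f \<in> W \<nu> \<Longrightarrow> A (B f) = f"
    and A_bound: "\<And>\<nu>. 1 \<le> \<nu> \<Longrightarrow> \<exists>\<mu>\<ge>1. A ` V \<nu> \<subseteq> W \<mu> \<and>
        (\<forall>m. \<exists>k C. 0 < C \<and> (\<forall>f\<in>V \<nu>. q \<mu> m (A f) \<le> ereal C * p \<nu> k f))"
    and B_bound: "\<And>\<nu>. 1 \<le> \<nu> \<Longrightarrow> \<exists>\<mu>\<ge>1. B ` W \<nu> \<subseteq> V \<mu> \<and>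
        (\<forall>m. \<exists>k C. 0 < C \<and> (\<forall>f\<in>W \<nu>. p \<mu> m (B f) \<le> ereal C * q \<nu> k f))"
  shows "tvs_isomorphism
    (\<Union>\<nu>\<in>{1..}. V \<nu>) (inductive_limit_topology (\<Union>\<nu>\<in>{1..}. V \<nu>) {1..} (\<lambda>\<nu>. seminorm_topology (V \<nu>) (p \<nu>)))
    (\<Union>\<nu>\<in>{1..}. W \<nu>) (inductive_limit_topology (\<Union>\<nu>\<in>{1..}. W \<nu>) {1..} (\<lambda>\<nu>. seminorm_topology (W \<nu>) (q \<nu>))) A"
proof -
  let ?V = "\<Union>\<nu>\<in>{1..}. V \<nu>" and ?W = "\<Union>\<nu>\<in>{1..}. W \<nu>"
  have sV: "fun_subspace ?V"
    by (rule fun_subspace_incseq_Union[of V, OF seminorms_on_subspace[OF p] V])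
  have sW: "fun_subspace ?W"
    by (rule fun_subspace_incseq_Union[of W, OF seminorms_on_subspace[OF q] W])
  have tV: "topspace (seminorm_topology (V \<nu>) (p \<nu>)) \<subseteq> ?V"
    and tW: "topspace (seminorm_topology (W \<nu>) (q \<nu>)) \<subseteq> ?W" if "\<nu> \<in> {1..}" for \<nu>
    using topspace_seminorm_topology[OF p[of \<nu>]] topspace_seminorm_topology[OF q[of \<nu>]] that by auto
  have AV: "A ` ?V \<subseteq> ?W" and BW: "B ` ?W \<subseteq> ?V"
    using A_bound B_bound by fastforce+
  have "continuous_map (inductive_limit_topology ?V {1..} (\<lambda>\<nu>. seminorm_topology (V \<nu>) (p \<nu>)))
      (inductive_limit_topology ?W {1..} (\<lambda>\<nu>. seminorm_topology (W \<nu>) (q \<nu>))) A"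
  proof (rule continuous_map_inductive_limits[OF sV sW tV tW A AV])
    fix \<nu> :: nat assume \<nu>: "\<nu> \<in> {1..}"
    then obtain \<mu> where \<mu>: "\<mu> \<ge> 1" "A ` V \<nu> \<subseteq> W \<mu>"
        "\<And>m. \<exists>k C. 0 < C \<and> (\<forall>f\<in>V \<nu>. q \<mu> m (A f) \<le> ereal C * p \<nu> k f)"
      using A_bound[of \<nu>] by auto
    have "continuous_map (seminorm_topology (V \<nu>) (p \<nu>)) (seminorm_topology (W \<mu>) (q \<mu>)) A"
      using \<nu> \<mu> by (intro continuous_map_seminorm_topology p q fun_linear_on_subset[OF A]) auto
    then show "\<exists>\<mu>\<in>{1..}. continuous_map (seminorm_topology (V \<nu>) (p \<nu>)) (seminorm_topology (W \<mu>) (q \<mu>)) A"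
      using \<mu>(1) by auto
  qed
  moreover have "continuous_map (inductive_limit_topology ?W {1..} (\<lambda>\<nu>. seminorm_topology (W \<nu>) (q \<nu>)))
      (inductive_limit_topology ?V {1..} (\<lambda>\<nu>. seminorm_topology (V \<nu>) (p \<nu>))) B"
  proof (rule continuous_map_inductive_limits[OF sW sV tW tV B BW])
    fix \<nu> :: nat assume \<nu>: "\<nu> \<in> {1..}"
    then obtain \<mu> where \<mu>: "\<mu> \<ge> 1" "B ` W \<nu> \<subseteq> V \<mu>"
        "\<And>m. \<exists>k C. 0 < C \<and> (\<forall>f\<in>W \<nu>. p \<mu> m (B f) \<le> ereal C * q \<nu> k f)"
      using B_bound[of \<nu>] by auto
    have "continuous_map (seminorm_topology (W \<nu>) (q \<nu>)) (seminorm_topology (V \<mu>) (p \<mu>)) B"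
      using \<nu> \<mu> by (intro continuous_map_seminorm_topology p q fun_linear_on_subset[OF B]) auto
    then show "\<exists>\<mu>\<in>{1..}. continuous_map (seminorm_topology (W \<nu>) (q \<nu>)) (seminorm_topology (V \<mu>) (p \<mu>)) B"
      using \<mu>(1) by auto
  qed
  moreover have BA': "\<forall>f\<in>?V. B (A f) = f" and AB': "\<forall>f\<in>?W. A (B f) = f"
    using AB BA by auto
  moreover have "topspace (inductive_limit_topology ?V {1..} (\<lambda>\<nu>. seminorm_topology (V \<nu>) (p \<nu>))) = ?V"
    by (rule topspace_inductive_limit_topology[OF sV]) (rule tV)
  moreover have "topspace (inductive_limit_topology ?W {1..} (\<lambda>\<nu>. seminorm_topology (W \<nu>) (q \<nu>))) = ?W"
    by (rule topspace_inductive_limit_topology[OF sW]) (rule tW)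
  ultimately have "homeomorphic_maps
      (inductive_limit_topology ?V {1..} (\<lambda>\<nu>. seminorm_topology (V \<nu>) (p \<nu>)))
      (inductive_limit_topology ?W {1..} (\<lambda>\<nu>. seminorm_topology (W \<nu>) (q \<nu>))) A B"
    unfolding homeomorphic_maps_def by (simp only: simp_thms)
  then have "homeomorphic_map
      (inductive_limit_topology ?V {1..} (\<lambda>\<nu>. seminorm_topology (V \<nu>) (p \<nu>)))
      (inductive_limit_topology ?W {1..} (\<lambda>\<nu>. seminorm_topology (W \<nu>) (q \<nu>))) A"
    by (rule homeomorphic_maps_map[THEN iffD1, THEN conjunct1])
  moreover have "bij_betw A ?V ?W"
    by (rule bij_betw_byWitness[OF BA' AB' AV BW])
  ultimately show ?thesis
    using A unfolding tvs_isomorphism_def fun_linear_on_def by (intro conjI; elim conjE)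
qed


section \<open>Weights and their conjugates\<close>

text \<open>\<open>phi h y\<close> is the conjugate of \<open>h\<close> evaluated at this
  vector.\<close>

definition log_vec :: "real ^ 'n \<Rightarrow> real ^ 'n" where
  "log_vec y = (\<chi> i. ln (1 + \<bar>y $ i\<bar>))"

lemma log_vec_orthant: "log_vec y \<in> orthant"
  by (simp add: log_vec_def orthant_def)

lemma mi_real_orthant: "mi_real \<alpha> \<in> orthant"
  by (simp add: mi_real_def orthant_def)

text \<open>Gathers hypotheses on one weight at a time; relations between consecutive weights enter
  the lemmas separately, as \<open>shift\<close> and \<open>subadd\<close>.\<close>

locale weight =
  fixes h :: "real ^ 'n::finite \<Rightarrow> real"
  assumes convex: "convex_on UNIV h"
    and even: "h x = h (\<chi> i. \<bar>x $ i\<bar>)"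
    and mono: "x \<in> orthant \<Longrightarrow> mono_on {0..} (\<lambda>t. h (\<chi> j. if j = i then t else x $ j))"
    and superlinear: "filterlim (\<lambda>x. h x / norm x) at_top at_infinity"
begin

text \<open>Monotonicity in each variable is used one coordinate at a time: \<open>S\<close> is the
  set of coordinates already raised from \<open>x\<close> to \<open>y\<close>, and all intermediate
  points stay in the orthant.\<close>

lemma mono_orthant:
  assumes "x \<in> orthant" "\<And>i. x $ i \<le> y $ i"
  shows "h x \<le> h y"
proof -
  have "h x \<le> h (\<chi> j. if j \<in> S then y $ j else x $ j)" for S
  proof (induction S rule: infinite_finite_induct)
    case (insert i S)
    define v where "v = (\<chi> j. if j \<in> S then y $ j else x $ j)"
    have x0: "0 \<le> x $ j" for j
      using assms(1) by (simp add: orthant_def)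
    have y0: "0 \<le> y $ j" for j
      using x0[of j] assms(2)[of j] by linarith
    have "v \<in> orthant"
      using x0 y0 by (simp add: v_def orthant_def)
    note mono[OF this, of i]
    then have "h (\<chi> j. if j = i then x $ i else v $ j) \<le> h (\<chi> j. if j = i then y $ i else v $ j)"
      using assms(2) x0 y0 by (auto dest!: mono_onD[of _ _ "x $ i" "y $ i"])
    moreover have "(\<chi> j. if j = i then x $ i else v $ j) = v"
      using insert by (auto simp: v_def vec_eq_iff)
    moreover have "(\<chi> j. if j = i then y $ i else v $ j) = (\<chi> j. if j \<in> insert i S then y $ j else x $ j)"
      by (auto simp: v_def vec_eq_iff)
    ultimately show ?case
      using insert.IH by (simp add: v_def)
  qed simp_all
  from this[of UNIV] show ?thesis
    by simp
qed

lemma min_at_0: "h 0 \<le> h x"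
  by (subst (2) even) (rule mono_orthant, simp_all add: orthant_def)

text \<open>Far out, superlinear growth makes \<open>h x\<close> exceed
  \<open>norm u * norm x\<close>; on the remaining ball the linear term is bounded and
  \<open>h\<close> is at least its minimum \<open>h 0\<close>. Thus the conjugate of
  \<open>h\<close> is finite everywhere.\<close>

lemma inner_minus_bounded: "\<exists>C. \<forall>x. u \<bullet> x - h x \<le> C"
proof -
  have "\<forall>\<^sub>F x in at_infinity. norm u \<le> h x / norm x"
    using superlinear by (simp add: filterlim_at_top)
  then obtain b where b: "\<And>x. b \<le> norm x \<Longrightarrow> norm u \<le> h x / norm x"
    by (auto simp: eventually_at_infinity)
  \<comment> \<open>The radius is raised to at least 1 so that division by \<open>norm x\<close> is
    legitimate.\<close>
  have "u \<bullet> x - h x \<le> max 0 (norm u * max b 1 - h 0)" for x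
  proof (cases "max b 1 \<le> norm x")
    case True
    then have "norm u * norm x \<le> h x"
      using b[of x] pos_le_divide_eq[of "norm x" "norm u" "h x"] by linarith
    then show ?thesis
      using norm_cauchy_schwarz[of u x] by linarith
  next
    case False
    then have "norm u * norm x \<le> norm u * max b 1"
      by (intro mult_left_mono) auto
    then show ?thesis
      using norm_cauchy_schwarz[of u x] min_at_0[of x] by linarith
  qed
  then show ?thesis by blast
qed

lemma conjugate_finite: "\<exists>c. conjugate (\<lambda>y. ereal (h y)) u = ereal c"
proof -
  obtain C where "\<And>x. u \<bullet> x - h x \<le> C"
    using inner_minus_bounded[of u] by blast
  then have "conjugate (\<lambda>y. ereal (h y)) u \<le> ereal C"
    unfolding conjugate_def by (intro SUP_least) simp
  moreover have "ereal (u \<bullet> 0) - ereal (h 0) \<le> conjugate (\<lambda>y. ereal (h y)) u"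
    unfolding conjugate_def by (rule SUP_upper) simp
  ultimately show ?thesis
    by (cases "conjugate (\<lambda>y. ereal (h y)) u") auto
qed

lemma ereal_phi: "ereal (phi h y) = conjugate (\<lambda>y. ereal (h y)) (log_vec y)"
  using conjugate_finite[of "log_vec y"] by (auto simp: phi_def log_vec_def)

lemma phi_ge: "log_vec y \<bullet> x - h x \<le> phi h y"
proof -
  have "ereal (log_vec y \<bullet> x) - ereal (h x) \<le> ereal (phi h y)"
    unfolding ereal_phi conjugate_def by (rule SUP_upper) simp
  then show ?thesis
    by simp
qed

text \<open>Testing on the orthant suffices: \<open>log_vec y\<close> has nonnegative coordinates,
  so replacing x by its coordinatewise absolute value does not decrease the inner product and leaves
  \<open>h\<close> unchanged.\<close>

lemma phi_le:
  assumes B: "\<And>x. x \<in> orthant \<Longrightarrow> log_vec y \<bullet> x - h x \<le> B"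
  shows "phi h y \<le> B"
proof -
  have "ereal (phi h y) \<le> ereal B"
    unfolding ereal_phi conjugate_def
  proof (rule SUP_least)
    fix x
    have "log_vec y \<bullet> x \<le> log_vec y \<bullet> (\<chi> i. \<bar>x $ i\<bar>)"
      using log_vec_orthant[of y] unfolding inner_vec_def
      by (intro sum_mono) (simp add: orthant_def mult_left_mono)
    moreover have "log_vec y \<bullet> (\<chi> i. \<bar>x $ i\<bar>) - h (\<chi> i. \<bar>x $ i\<bar>) \<le> B"
      by (intro B) (simp add: orthant_def)
    ultimately show "ereal (log_vec y \<bullet> x) - ereal (h x) \<le> ereal B"
      using even[of x] by simp
  qed
  then show ?thesis
    by simp
qed

lemma phi_mono:
  assumes "\<And>i. \<bar>y $ i\<bar> \<le> \<bar>y' $ i\<bar>"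
  shows "phi h y \<le> phi h y'"
proof (rule phi_le)
  fix x :: "real ^ 'n" assume "x \<in> orthant"
  then have "log_vec y \<bullet> x \<le> log_vec y' \<bullet> x"
    unfolding inner_vec_def log_vec_def using assms
    by (intro sum_mono) (auto simp: orthant_def intro!: mult_right_mono)
  then show "log_vec y \<bullet> x - h x \<le> phi h y'"
    using phi_ge[of y' x] by linarith
qed

text \<open>An approximate subgradient suffices below; it is found by separating \<open>(a, h a - 1)\<close> from the
  epigraph. Negative slopes can be dropped since \<open>h\<close> is nondecreasing on the orthant.\<close>

lemma approximate_subgradient:
  assumes a: "a \<in> orthant"
  obtains u where "u \<in> orthant" "\<And>x. x \<in> orthant \<Longrightarrow> h a + u \<bullet> (x - a) - 1 \<le> h x"
proof -
  have "continuous_on UNIV h"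
    by (rule convex_on_continuous[OF open_UNIV convex])
  then have "closed (epigraph UNIV h)"
    unfolding epigraph_def
    by (auto intro!: closed_Collect_le continuous_intros elim!: continuous_on_compose2)
  moreover have "convex (epigraph UNIV h)"
    by (simp add: convex_epigraph convex)
  moreover have "(a, h a - 1) \<notin> epigraph UNIV h"
    by (simp add: mem_epigraph)
  ultimately obtain c b where cb: "c \<bullet> (a, h a - 1) < b" "\<And>x. x \<in> epigraph UNIV h \<Longrightarrow> b < c \<bullet> x"
    using separating_hyperplane_closed_point by metis
  obtain c1 c2 where c: "c = (c1, c2)" by fastforce
  have sep: "c1 \<bullet> a + c2 * (h a - 1) < c1 \<bullet> x + c2 * h x" for x
    using cb(1) cb(2)[of "(x, h x)"] by (simp add: c mem_epigraph)
  \<comment> \<open>At x = a the separation inequality reduces to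
    \<open>c2 * (h a - 1) < c2 * h a\<close>: the hyperplane is not vertical and can be solved for
    the last coordinate.\<close>
  have c2: "0 < c2"
    using sep[of a] by (simp add: algebra_simps)
  define v where "v = - (1 / c2) *\<^sub>R c1"
  have v: "h a + v \<bullet> (x - a) - 1 \<le> h x" for x
    using sep[of x] c2 by (simp add: v_def inner_diff_right field_simps)
  define u where "u = (\<chi> i. max 0 (v $ i))"
  show ?thesis
  proof (rule that)
    show "u \<in> orthant"
      by (simp add: u_def orthant_def)
    fix x :: "real ^ 'n" assume x: "x \<in> orthant"
    define x' where "x' = (\<chi> i. if v $ i < 0 then 0 else x $ i)"
    \<comment> \<open>In a coordinate with negative slope the left side contributes 0 and the right
      side -v_i a_i, which is nonnegative; in the other coordinates the two sides agree.\<close>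
    have "u \<bullet> (x - a) \<le> v \<bullet> (x' - a)"
      unfolding inner_vec_def using a x
      by (intro sum_mono) (auto simp: u_def x'_def orthant_def max_def mult_nonpos_nonneg)
    moreover have "h x' \<le> h x"
      by (rule mono_orthant) (use x in \<open>auto simp: x'_def orthant_def\<close>)
    ultimately show "h a + u \<bullet> (x - a) - 1 \<le> h x"
      using v[of x'] by linarith
  qed
qed

text \<open>This is \<open>inner_minus_bounded\<close> at the vector with all coordinates
  \<open>- ln r\<close>, exponentiated. Since \<open>r\<close> may be arbitrarily small, power
  series with coefficients of size exp(-h(\<alpha>)) converge on every polydisc.\<close>

lemma exp_minus_decay:
  assumes r: "0 < r"
  shows "\<exists>C>0. \<forall>\<alpha>. exp (- h (mi_real \<alpha>)) \<le> C * (\<Prod>i\<in>UNIV. r ^ (\<alpha> $ i))"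
proof -
  define u :: "real ^ 'n" where "u = (\<chi> i. - ln r)"
  obtain C where C: "\<And>x. u \<bullet> x - h x \<le> C"
    using inner_minus_bounded[of u] by blast
  have "exp (- h (mi_real \<alpha>)) \<le> exp C * (\<Prod>i\<in>UNIV. r ^ (\<alpha> $ i))" for \<alpha>
  proof -
    have "(\<Prod>i\<in>UNIV. r ^ (\<alpha> $ i)) = (\<Prod>i\<in>UNIV. exp (real (\<alpha> $ i) * ln r))"
      using r by (simp add: exp_of_nat_mult)
    also have "\<dots> = exp (- (u \<bullet> mi_real \<alpha>))"
      by (simp add: exp_sum[symmetric] u_def mi_real_def inner_vec_def sum_negf[symmetric] mult.commute)
    finally show ?thesis
      using C[of "mi_real \<alpha>"] by (simp add: exp_add[symmetric])
  qed
  then show ?thesis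
    by (intro exI[of _ "exp C"]) simp
qed

end

lemma sum_ln_eq_inner: "(\<Sum>i\<in>UNIV. ln (1 + \<bar>y $ i\<bar>)) * c = log_vec y \<bullet> (\<chi> i. c)"
  by (simp add: log_vec_def inner_vec_def sum_distrib_right)

text \<open>Test the supremum in \<open>phi h' y\<close> at x shifted by the vector with all
  coordinates \<open>c\<close>: the linear term gains c times the sum of logarithms, and
  \<open>subadd\<close> pays for the shift with a constant. With c = m this absorbs powers of 1 +
  norm y; with c = 0 it compares \<open>phi h\<close> and \<open>phi h'\<close>.\<close>

lemma phi_absorbs_logs:
  assumes "weight h" "weight h'"
    and subadd: "\<And>x y. x \<in> orthant \<Longrightarrow> y \<in> orthant \<Longrightarrow> h' (x + y) \<le> h x + h y + l"
    and c: "0 \<le> c"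
  shows "phi h y + (\<Sum>i\<in>UNIV. ln (1 + \<bar>y $ i\<bar>)) * c \<le> phi h' y + (h (\<chi> i. c) + l)"
proof -
  interpret h: weight h by fact
  interpret h': weight h' by fact
  have "phi h y \<le> phi h' y + (h (\<chi> i. c) + l) - log_vec y \<bullet> (\<chi> i. c)"
  proof (rule h.phi_le)
    fix x :: "real ^ 'a" assume x: "x \<in> orthant"
    have "h' (x + (\<chi> i. c)) \<le> h x + h (\<chi> i. c) + l"
      using x c by (intro subadd) (simp_all add: orthant_def)
    then show "log_vec y \<bullet> x - h x \<le> phi h' y + (h (\<chi> i. c) + l) - log_vec y \<bullet> (\<chi> i. c)"
      using h'.phi_ge[of y "x + (\<chi> i. c)"] by (simp add: inner_add_right)
  qed
  then show ?thesis
    unfolding sum_ln_eq_inner by simp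
qed

lemma exp_inner_log_vec:
  "exp (log_vec y \<bullet> mi_real \<alpha>) = (\<Prod>i\<in>UNIV. (1 + \<bar>y $ i\<bar>) ^ (\<alpha> $ i))"
proof -
  have "0 < 1 + \<bar>y $ i\<bar>" for i
    by (simp add: add_pos_nonneg)
  then show ?thesis
    by (simp add: log_vec_def mi_real_def inner_vec_def exp_sum mult.commute[of "ln _"] exp_of_nat_mult)
qed

text \<open>Bounding |y_i| by 1 + |y_i| turns the monomial into the exponential of the linear term
  of \<open>phi h' y\<close> tested at \<alpha>. The weight there is \<open>h'\<close> instead of
  \<open>h\<close>, and the difference supplies the powers of 1/2 that make the series over \<alpha>
  converge.\<close>

lemma monomial_le_exp_phi:
  assumes "weight h'"
    and shift: "\<And>x. x \<in> orthant \<Longrightarrow> h x - h' x \<ge> ln 2 * (\<Sum>j\<in>UNIV. x $ j) - \<gamma>"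
  shows "exp (- h (mi_real \<alpha>)) * (\<Prod>i\<in>UNIV. \<bar>y $ i\<bar> ^ (\<alpha> $ i)) \<le>
    exp \<gamma> * exp (phi h' y) * (\<Prod>i\<in>UNIV. (1 / 2) ^ (\<alpha> $ i))"
proof -
  interpret h': weight h' by fact
  have half: "(\<Prod>i\<in>UNIV. (1 / 2) ^ (\<alpha> $ i)) = exp (- (ln 2 * (\<Sum>j\<in>UNIV. mi_real \<alpha> $ j)))"
  proof -
    have "(1 / 2 :: real) ^ n = exp (real n * - ln 2)" for n
      unfolding exp_of_nat_mult by (simp add: exp_minus)
    then show ?thesis
      by (simp add: mi_real_def exp_sum sum_distrib_left mult.commute flip: sum_negf)
  qed
  have "exp (- h (mi_real \<alpha>)) * (\<Prod>i\<in>UNIV. \<bar>y $ i\<bar> ^ (\<alpha> $ i)) \<le>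
      exp (- h (mi_real \<alpha>)) * exp (log_vec y \<bullet> mi_real \<alpha>)"
    unfolding exp_inner_log_vec by (intro mult_left_mono prod_mono) (auto intro!: power_mono)
  also have "\<dots> \<le> exp (\<gamma> + phi h' y + - (ln 2 * (\<Sum>j\<in>UNIV. mi_real \<alpha> $ j)))"
    using shift[OF mi_real_orthant[of \<alpha>]] h'.phi_ge[of y "mi_real \<alpha>"]
    by (simp flip: exp_add)
  finally show ?thesis
    unfolding half exp_add by (simp add: mult.assoc)
qed

text \<open>For an exact subgradient u of \<open>h'\<close> at \<alpha>, the difference of the inner
  product with u and \<open>h'\<close> is largest at \<alpha>, which suggests radii of the size of
  exp u; the approximate subgradient costs the summand 1. The logarithms of 1 + R_i exceed u_i by ln
  2, and \<open>shift\<close> repays exactly this excess in passing from \<open>h\<close> to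
  \<open>h'\<close>.\<close>

lemma exists_cauchy_radius:
  assumes "weight h" "weight h'"
    and shift: "\<And>x. x \<in> orthant \<Longrightarrow> h x - h' x \<ge> ln 2 * (\<Sum>j\<in>UNIV. x $ j) - \<gamma>"
  obtains R where "\<And>i. 0 < R $ i"
    "exp (phi h R) \<le> exp (\<gamma> + 1) * exp (- h' (mi_real \<alpha>)) * (\<Prod>i\<in>UNIV. R $ i ^ (\<alpha> $ i))"
proof -
  interpret h: weight h by fact
  interpret h': weight h' by fact
  obtain u where u: "u \<in> orthant"
      "\<And>x. x \<in> orthant \<Longrightarrow> h' (mi_real \<alpha>) + u \<bullet> (x - mi_real \<alpha>) - 1 \<le> h' x"
    using h'.approximate_subgradient[OF mi_real_orthant] by blast
  \<comment> \<open>Chosen so that 1 + R_i = 2 exp(u_i). Since u_i is nonnegative, R_i is at least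
    exp(u_i), which gives the lower bound on the product of the powers of R.\<close>
  define R where "R = (\<chi> i. 2 * exp (u $ i) - 1)"
  have R: "exp (u $ i) \<le> R $ i" for i
    using u(1) by (simp add: R_def orthant_def)
  have R0: "0 < R $ i" for i
    by (rule less_le_trans[OF exp_gt_zero R])
  have "log_vec R = u + (\<chi> i. ln 2)"
  proof -
    have "1 + \<bar>R $ i\<bar> = 2 * exp (u $ i)" for i
      using R0[of i] by (simp add: R_def)
    then show ?thesis
      by (simp add: vec_eq_iff log_vec_def ln_mult)
  qed
  then have log: "log_vec R \<bullet> x = u \<bullet> x + ln 2 * (\<Sum>j\<in>UNIV. x $ j)" for x
    by (simp add: inner_vec_def sum_distrib_left distrib_right sum.distrib)
  have "phi h R \<le> u \<bullet> mi_real \<alpha> - h' (mi_real \<alpha>) + 1 + \<gamma>"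
  proof (rule h.phi_le)
    fix x :: "real ^ 'a" assume x: "x \<in> orthant"
    show "log_vec R \<bullet> x - h x \<le> u \<bullet> mi_real \<alpha> - h' (mi_real \<alpha>) + 1 + \<gamma>"
      using u(2)[OF x] shift[OF x] by (simp add: log inner_diff_right)
  qed
  then have "exp (phi h R) \<le> exp (\<gamma> + 1) * exp (- h' (mi_real \<alpha>)) * exp (u \<bullet> mi_real \<alpha>)"
    by (simp flip: exp_add)
  also have "exp (u \<bullet> mi_real \<alpha>) = (\<Prod>i\<in>UNIV. exp (u $ i) ^ (\<alpha> $ i))"
    by (simp add: inner_vec_def mi_real_def exp_sum mult.commute[of "u $ _"] exp_of_nat_mult)
  also have "\<dots> \<le> (\<Prod>i\<in>UNIV. R $ i ^ (\<alpha> $ i))"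
    using R by (intro prod_mono) (auto intro!: power_mono)
  finally show ?thesis
    using that[of R] R0 by (simp add: mult_left_mono)
qed


section \<open>Separately holomorphic functions\<close>

lemma axis_add: "axis i (s + t) = axis i s + (axis i t :: 'a::comm_monoid_add ^ 'n)"
  by (simp add: axis_def vec_eq_iff)

lemma norm_axis: "norm (axis i t :: 'a::real_normed_vector ^ 'n::finite) = norm t"
proof -
  have "(norm ((axis i t :: 'a ^ 'n) $ j))\<^sup>2 = (if j = i then (norm t)\<^sup>2 else 0)" for j
    by (simp add: axis_def)
  then show ?thesis
    by (simp add: norm_vec_def L2_set_def)
qed

lemma bounded_linear_axis: "bounded_linear (axis i :: 'a::real_normed_vector \<Rightarrow> 'a ^ 'n::finite)"
  by (rule bounded_linear_intro[where K = 1]) (simp_all add: axis_add norm_axis, simp add: axis_def vec_eq_iff)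

lemma axis_0: "axis i 0 = 0"
  by (simp add: axis_def vec_eq_iff)

lemma scaleR_axis_1: "t *\<^sub>R axis i (1 :: real) = axis i t"
  by (simp add: axis_def vec_eq_iff)

text \<open>Continuity is part of the definition because it bounds the functions on compact sets,
  which feeds the Cauchy estimates; holomorphy in each variable gives access to the one-variable
  theory. \<open>entire_eq_separately_holomorphic\<close> identifies this set with
  \<open>entire\<close>.\<close>

definition separately_holomorphic :: "(complex ^ 'n::finite \<Rightarrow> complex) set" where
  "separately_holomorphic =
     {F. continuous_on UNIV F \<and> (\<forall>z i. (\<lambda>t. F (z + axis i t)) holomorphic_on UNIV)}"

definition cpartial :: "'n \<Rightarrow> (complex ^ 'n::finite \<Rightarrow> complex) \<Rightarrow> complex ^ 'n \<Rightarrow> complex" where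
  "cpartial i F z = deriv (\<lambda>t. F (z + axis i t)) 0"

lemma separately_holomorphic_continuous: "F \<in> separately_holomorphic \<Longrightarrow> continuous_on S F"
  unfolding separately_holomorphic_def using continuous_on_subset by blast

lemma separately_holomorphic_axis:
  "F \<in> separately_holomorphic \<Longrightarrow> (\<lambda>t. F (z + axis i t)) holomorphic_on S"
  unfolding separately_holomorphic_def using holomorphic_on_subset by blast

lemma separately_holomorphicI:
  assumes "continuous_on UNIV F" "\<And>z i. (\<lambda>t. F (z + axis i t)) holomorphic_on UNIV"
  shows "F \<in> separately_holomorphic"
  using assms by (simp add: separately_holomorphic_def)

text \<open>The claim covers every point of the line and not only t = 0, since the induction
  differentiates once more in t; a translation moves the base point of \<open>cpartial\<close> to
  t.\<close>

lemma cpartial_funpow_axis: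
  "(cpartial i ^^ k) F (z + axis i t) = (deriv ^^ k) (\<lambda>s. F (z + axis i s)) t"
proof (induction k arbitrary: t)
  case (Suc k)
  have "(cpartial i ^^ Suc k) F (z + axis i t) = deriv (\<lambda>s. (cpartial i ^^ k) F (z + axis i (t + s))) 0"
    by (simp add: cpartial_def axis_add add.assoc)
  also have "\<dots> = deriv ((deriv ^^ k) (\<lambda>s. F (z + axis i s)) \<circ> (\<lambda>s. t + s)) 0"
    unfolding Suc by (simp add: o_def)
  finally show ?case
    by (simp add: deriv_shift_0[of _ t])
qed simp

lemma has_field_derivative_cpartial:
  assumes "F \<in> separately_holomorphic"
  shows "((\<lambda>t. F (z + axis i t)) has_field_derivative cpartial i F (z + axis i t)) (at t)"
  using separately_holomorphic_axis[OF assms, of z i UNIV] cpartial_funpow_axis[where i = i and k = 1 and F = F and z = z and t = t]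
  by (simp add: holomorphic_derivI)

text \<open>Taylor expansion of order 1 on the unit disc. The unit circle about any point of this
  disc stays within distance 2 of 0, so the Cauchy inequality bounds the second derivative by 2 *
  B.\<close>

lemma second_order_remainder:
  assumes g: "g holomorphic_on UNIV" and B: "\<And>t. cmod t \<le> 2 \<Longrightarrow> cmod (g t) \<le> B" and t: "cmod t \<le> 1"
  shows "cmod (g t - g 0 - t * deriv g 0) \<le> 2 * B * (cmod t)\<^sup>2"
proof -
  have "cmod ((deriv ^^ 0) g t - (\<Sum>k\<le>1. (deriv ^^ k) g 0 * (t - 0) ^ k / fact k)) \<le>
      2 * B * cmod (t - 0) ^ Suc 1 / fact 1"
  proof (rule complex_Taylor[where S = "cball 0 1" and f = "\<lambda>k. (deriv ^^ k) g"])
    show "((deriv ^^ k) g has_field_derivative (deriv ^^ Suc k) g x) (at x within cball 0 1)" for k x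
      by (simp add: has_field_derivative_at_within holomorphic_derivI[OF holomorphic_higher_deriv[OF g]])
    show "cmod ((deriv ^^ Suc 1) g x) \<le> 2 * B" if "x \<in> cball 0 1" for x
    proof -
      have "cmod ((deriv ^^ 2) g x) \<le> fact 2 * B / 1 ^ 2"
      proof (rule Cauchy_inequality)
        show "cmod (g y) \<le> B" if "cmod (x - y) = 1" for y
          using that \<open>x \<in> cball 0 1\<close> norm_triangle_ineq4[of x "x - y"] by (intro B) simp
      qed (use holomorphic_on_subset[OF g] in \<open>auto intro: holomorphic_on_imp_continuous_on\<close>)
      then show ?thesis
        by (simp add: numeral_2_eq_2)
    qed
  qed (use t in auto)
  then show ?thesis
    by (simp add: power2_eq_square mult_ac diff_diff_eq)
qed

text \<open>One bound of F on the ball of radius r + 2 serves all coordinate lines through the ball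
  of radius r, so the constant is uniform in the base point and the direction. This uniformity
  yields both the continuity of the partial derivatives and total differentiability.\<close>

lemma separately_holomorphic_remainder:
  assumes F: "F \<in> separately_holomorphic"
  shows "\<exists>C\<ge>0. \<forall>z\<in>cball a r. \<forall>i t. cmod t \<le> 1 \<longrightarrow>
    cmod (F (z + axis i t) - F z - t * cpartial i F z) \<le> C * (cmod t)\<^sup>2"
proof -
  have "bounded (F ` cball a (r + 2))"
    using F by (intro compact_imp_bounded compact_continuous_image separately_holomorphic_continuous) auto
  then obtain B where B: "\<And>z. z \<in> cball a (r + 2) \<Longrightarrow> cmod (F z) \<le> B"
    unfolding bounded_iff by blast
  have "cmod (F (z + axis i t) - F z - t * cpartial i F z) \<le> 2 * max B 0 * (cmod t)\<^sup>2"
    if z: "z \<in> cball a r" and t: "cmod t \<le> 1" for z i t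
  proof -
    have "cmod (F (z + axis i s)) \<le> max B 0" if "cmod s \<le> 2" for s
    proof -
      have "dist a (z + axis i s) \<le> dist a z + dist z (z + axis i s)"
        by (rule dist_triangle)
      also have "\<dots> \<le> r + 2"
        using z that by (intro add_mono) (auto simp: dist_norm norm_axis)
      finally show ?thesis
        using B[of "z + axis i s"] by simp
    qed
    from second_order_remainder[OF separately_holomorphic_axis[OF F] this t] show ?thesis
      by (simp add: cpartial_def axis_0)
  qed
  then show ?thesis
    by (intro exI[of _ "2 * max B 0"]) auto
qed

text \<open>On compact sets the difference quotients converge uniformly, so continuity and holomorphy in
  each variable pass to the derivative.\<close>

lemma uniform_limit_cpartial:
  assumes F: "F \<in> separately_holomorphic"
  shows "uniform_limit (cball a r) (\<lambda>\<epsilon> z. (F (z + axis i \<epsilon>) - F z) / \<epsilon>) (cpartial i F) (at 0)"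
proof (rule uniform_limitI)
  fix e :: real assume e: "0 < e"
  obtain C where C: "0 \<le> C" "\<And>z i t. z \<in> cball a r \<Longrightarrow> cmod t \<le> 1 \<Longrightarrow>
      cmod (F (z + axis i t) - F z - t * cpartial i F z) \<le> C * (cmod t)\<^sup>2"
    using separately_holomorphic_remainder[OF F, of a r] by blast
  \<comment> \<open>The radius is formed with C + 1 because C may be 0.\<close>
  have "dist ((F (z + axis i \<epsilon>) - F z) / \<epsilon>) (cpartial i F z) < e"
    if z: "z \<in> cball a r" and \<epsilon>: "\<epsilon> \<noteq> 0" "dist \<epsilon> 0 < min 1 (e / (C + 1))" for \<epsilon> z
  proof -
    have "(F (z + axis i \<epsilon>) - F z) / \<epsilon> - cpartial i F z = (F (z + axis i \<epsilon>) - F z - \<epsilon> * cpartial i F z) / \<epsilon>"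
      using \<epsilon>(1) by (simp add: field_simps)
    then have "dist ((F (z + axis i \<epsilon>) - F z) / \<epsilon>) (cpartial i F z) =
        cmod (F (z + axis i \<epsilon>) - F z - \<epsilon> * cpartial i F z) / cmod \<epsilon>"
      by (simp add: dist_norm norm_divide)
    also have "\<dots> \<le> C * (cmod \<epsilon>)\<^sup>2 / cmod \<epsilon>"
      using \<epsilon>(2) by (intro divide_right_mono C z) auto
    also have "\<dots> = C * cmod \<epsilon>"
      by (simp add: power2_eq_square)
    also have "\<dots> \<le> (C + 1) * cmod \<epsilon>"
      by (simp add: distrib_right)
    also have "\<dots> < e"
      using \<epsilon>(2) C(1) by (simp add: field_simps)
    finally show ?thesis .
  qed
  then show "\<forall>\<^sub>F \<epsilon> in at 0. \<forall>z\<in>cball a r. dist ((F (z + axis i \<epsilon>) - F z) / \<epsilon>) (cpartial i F z) < e"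
    unfolding eventually_at using e C(1)
    by (intro exI[of _ "min 1 (e / (C + 1))"]) auto
qed

lemma holomorphic_on_UNIV_ball:
  assumes "\<And>a. f holomorphic_on ball a 1"
  shows "f holomorphic_on UNIV"
  using assms by (metis UNIV_I centre_in_ball holomorphic_on_def holomorphic_on_imp_differentiable_at
      open_ball zero_less_one field_differentiable_at_within)

lemma continuous_on_UNIV_cball:
  fixes f :: "'a::{real_normed_vector, perfect_space} \<Rightarrow> 'b::topological_space"
  assumes "\<And>a. continuous_on (cball a 1) f"
  shows "continuous_on UNIV f"
proof -
  have "continuous (at a) f" for a
    using continuous_on_interior[OF assms[of a], of a] centre_in_ball[of a 1]
    unfolding interior_cball by simp
  then show ?thesis
    by (simp add: continuous_on_eq_continuous_at)
qed

text \<open>Serves two filters: \<open>at 0\<close> for difference quotients, and the finite sets of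
  multi-indices for power series. Holomorphy passes to the limit along each coordinate line, since a
  unit disc on the line lies in a unit ball of the space.\<close>

lemma uniform_limit_separately_holomorphic:
  assumes f: "\<forall>\<^sub>F n in L. f n \<in> separately_holomorphic"
    and lim: "\<And>a. uniform_limit (cball a 1) f F L" and L: "L \<noteq> bot"
  shows "F \<in> separately_holomorphic"
proof (rule separately_holomorphicI)
  show "continuous_on UNIV F"
    by (rule continuous_on_UNIV_cball,
        rule uniform_limit_theorem[OF eventually_mono[OF f separately_holomorphic_continuous] lim L])
  fix z i
  show "(\<lambda>t. F (z + axis i t)) holomorphic_on UNIV"
  proof (rule holomorphic_on_UNIV_ball)
    fix b
    have 1: "uniform_limit (cball b 1) (\<lambda>n t. f n (z + axis i t)) (\<lambda>t. F (z + axis i t)) L"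
    proof (rule uniform_limit_compose'[OF lim[of "z + axis i b"]], rule funcsetI)
      fix t assume "t \<in> cball b 1"
      then show "z + axis i t \<in> cball (z + axis i b) 1"
        using norm_axis[of i "b - t"] axis_add[of i "b - t" t] by (simp add: dist_norm)
    qed
    have 2: "\<forall>\<^sub>F n in L. continuous_on (cball b 1) (\<lambda>t. f n (z + axis i t)) \<and>
        (\<lambda>t. f n (z + axis i t)) holomorphic_on ball b 1"
      using f by eventually_elim
        (simp add: separately_holomorphic_axis holomorphic_on_imp_continuous_on)
    show "(\<lambda>t. F (z + axis i t)) holomorphic_on ball b 1"
      by (rule holomorphic_uniform_limit[OF 2 1 L])
  qed
qed

lemma separately_holomorphic_cpartial:
  assumes F: "F \<in> separately_holomorphic"
  shows "cpartial i F \<in> separately_holomorphic"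
proof (rule uniform_limit_separately_holomorphic[OF _ uniform_limit_cpartial[OF F]])
  have "(\<lambda>z. (F (z + axis i \<epsilon>) - F z) / \<epsilon>) \<in> separately_holomorphic" if "\<epsilon> \<noteq> 0" for \<epsilon>
  proof (rule separately_holomorphicI)
    show "continuous_on UNIV (\<lambda>z. (F (z + axis i \<epsilon>) - F z) / \<epsilon>)"
      by (intro continuous_intros continuous_on_compose2[OF separately_holomorphic_continuous[OF F, of UNIV]])
        (use that in auto)
    fix z j
    have "(\<lambda>t. F ((z + axis i \<epsilon>) + axis j t)) holomorphic_on UNIV"
      by (rule separately_holomorphic_axis[OF F])
    then have "(\<lambda>t. F (z + axis j t + axis i \<epsilon>)) holomorphic_on UNIV"
      by (simp add: add_ac)
    then show "(\<lambda>t. (F (z + axis j t + axis i \<epsilon>) - F (z + axis j t)) / \<epsilon>) holomorphic_on UNIV"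
      by (intro holomorphic_intros separately_holomorphic_axis[OF F] that)
  qed
  then show "\<forall>\<^sub>F \<epsilon> in at 0. (\<lambda>z. (F (z + axis i \<epsilon>) - F z) / \<epsilon>) \<in> separately_holomorphic"
    by (simp add: eventually_at_filter)
qed simp

section \<open>Equivalence of separate holomorphy with total complex differentiability\<close>

lemma entire_imp_separately_holomorphic:
  assumes F: "F \<in> entire"
  shows "F \<in> separately_holomorphic"
proof (rule separately_holomorphicI)
  have D: "\<exists>D. (F has_derivative D) (at z) \<and> (\<forall>c v. D (c *s v) = c * D v)" for z
    using F by (simp add: entire_def)
  show "continuous_on UNIV F"
    using D has_derivative_continuous by (fastforce simp: continuous_on_eq_continuous_at)
  fix z i
  have "(\<lambda>t. F (z + axis i t)) field_differentiable at t" for t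
  proof -
    obtain D where D: "(F has_derivative D) (at (z + axis i t))" "\<And>c v. D (c *s v) = c * D v"
      using D by blast
    have "((\<lambda>t. z + axis i t) has_derivative (\<lambda>t. axis i t)) (at t)"
      using has_derivative_add[OF has_derivative_const bounded_linear_imp_has_derivative[OF bounded_linear_axis]]
      by simp
    from diff_chain_at[OF this D(1)]
    have "((\<lambda>t. F (z + axis i t)) has_derivative (\<lambda>s. D (axis i s))) (at t)"
      by (simp add: o_def)
    moreover have axis: "axis i s = s *s axis i (1 :: complex)" for s
      by (simp add: axis_def vec_eq_iff)
    have "(\<lambda>s. D (axis i s)) = (*) (D (axis i 1))"
      by (rule ext, subst axis) (simp add: D(2) mult.commute)
    ultimately show ?thesis
      unfolding field_differentiable_def has_field_derivative_def by auto
  qed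
  then show "(\<lambda>t. F (z + axis i t)) holomorphic_on UNIV"
    by (simp add: holomorphic_on_def field_differentiable_at_within)
qed

text \<open>The coordinates of the displacement are switched on one at a time. The increment in
  coordinate i is measured from the point already displaced in \<open>S\<close>; it is linear up to
  a quadratic error with uniform constant, and continuity of \<open>cpartial i F\<close> moves its
  coefficient back to z.\<close>

lemma has_derivative_separately_holomorphic:
  assumes F: "F \<in> separately_holomorphic"
  shows "((\<lambda>w. F (z + (\<Sum>i\<in>S. axis i (w $ i)))) has_derivative (\<lambda>w. \<Sum>i\<in>S. w $ i * cpartial i F z)) (at 0)"
  using finite[of S]
proof (induction S rule: finite_induct)
  case (insert i S)
  define \<sigma> where "\<sigma> w = (\<Sum>i\<in>S. axis i (w $ i))" for w :: "complex ^ 'a"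
  have \<sigma>0: "\<sigma> 0 = 0"
    by (simp add: \<sigma>_def axis_0)
  define G where "G w = F (z + \<sigma> w + axis i (w $ i)) - F (z + \<sigma> w)" for w
  have "(G has_derivative (\<lambda>w. w $ i * cpartial i F z)) (at 0)"
    unfolding has_derivative_at_alt
  proof (intro conjI allI impI)
    show "bounded_linear (\<lambda>w. w $ i * cpartial i F z)"
      by (intro bounded_linear_mult_const bounded_linear_vec_nth)
    fix e :: real assume e: "0 < e"
    obtain C where C: "0 \<le> C" "\<And>z' i t. z' \<in> cball z 1 \<Longrightarrow> cmod t \<le> 1 \<Longrightarrow>
        cmod (F (z' + axis i t) - F z' - t * cpartial i F z') \<le> C * (cmod t)\<^sup>2"
      using separately_holomorphic_remainder[OF F, of z 1] by blast
    have cont: "isCont \<sigma> 0"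
      unfolding \<sigma>_def
      by (intro linear_continuous_at bounded_linear_sum
          bounded_linear_compose[OF bounded_linear_axis bounded_linear_vec_nth])
    have cont': "isCont (cpartial i F) y" for y
      using separately_holomorphic_continuous[OF separately_holomorphic_cpartial[OF F, of i], of UNIV]
      by (simp add: continuous_on_eq_continuous_at)
    have "isCont (\<lambda>w. cpartial i F (z + \<sigma> w)) 0"
      by (rule isCont_o2[OF continuous_add[OF continuous_const cont] cont'])
    from continuous_at_eps_delta[THEN iffD1, rule_format, OF this, of "e / 2"]
    obtain d1 where d1: "0 < d1" "\<And>w. dist w 0 < d1 \<Longrightarrow> dist (cpartial i F (z + \<sigma> w)) (cpartial i F z) < e / 2"
      using e by (auto simp: \<sigma>0)
    from continuous_at_eps_delta[THEN iffD1, rule_format, OF cont, of 1]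
    obtain d2 where d2: "0 < d2" "\<And>w. dist w 0 < d2 \<Longrightarrow> dist (\<sigma> w) 0 < 1"
      by (auto simp: \<sigma>0)
    \<comment> \<open>\<open>d1\<close> controls the variation of the partial derivative,
      \<open>d2\<close> keeps the displaced point in the unit ball where \<open>C\<close> is valid,
      1 is the range of the remainder estimate, and the last bound makes the quadratic error at most
      half of \<open>e * norm w\<close>.\<close>
    define d where "d = min (min d1 d2) (min 1 (e / (2 * (C + 1))))"
    have d: "0 < d" "d \<le> d1" "d \<le> d2" "d \<le> 1" "d \<le> e / (2 * (C + 1))"
      using d1(1) d2(1) e C(1) by (auto simp: d_def)
    show "\<exists>d>0. \<forall>y. norm (y - 0) < d \<longrightarrow>
        cmod (G y - G 0 - (y - 0) $ i * cpartial i F z) \<le> e * norm (y - 0)"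
    proof (intro exI[of _ d] conjI allI impI d(1))
      fix w :: "complex ^ 'a" assume "norm (w - 0) < d"
      then have w: "norm w < d" by simp
      have wi: "cmod (w $ i) \<le> norm w"
        by (rule Finite_Cartesian_Product.norm_nth_le)
      have "dist (\<sigma> w) 0 < 1"
        using w d by (intro d2) simp
      then have "z + \<sigma> w \<in> cball z 1"
        by (simp add: dist_norm)
      then have "cmod (F (z + \<sigma> w + axis i (w $ i)) - F (z + \<sigma> w) - w $ i * cpartial i F (z + \<sigma> w)) \<le> C * (cmod (w $ i))\<^sup>2"
        using w d wi by (intro C(2)) auto
      also have "\<dots> \<le> C * norm w * norm w"
        using mult_left_mono[OF power_mono[OF wi norm_ge_zero, of 2] C(1)]
        by (simp add: power2_eq_square mult.assoc)
      also have "\<dots> \<le> (C + 1) * (e / (2 * (C + 1))) * norm w"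
        using w d C(1) by (intro mult_right_mono mult_mono) auto
      also have "(C + 1) * (e / (2 * (C + 1))) = e / 2"
        using C(1) by (simp add: field_simps)
      finally have 1: "cmod (G w - w $ i * cpartial i F (z + \<sigma> w)) \<le> e / 2 * norm w"
        by (simp add: G_def)
      have "cmod (cpartial i F (z + \<sigma> w) - cpartial i F z) \<le> e / 2"
        using d1(2)[of w] w d by (simp add: dist_norm)
      then have 2: "cmod (w $ i * (cpartial i F (z + \<sigma> w) - cpartial i F z)) \<le> norm w * (e / 2)"
        unfolding norm_mult using wi by (intro mult_mono) auto
      have "G w - w $ i * cpartial i F z =
          (G w - w $ i * cpartial i F (z + \<sigma> w)) + w $ i * (cpartial i F (z + \<sigma> w) - cpartial i F z)"
        by (simp add: algebra_simps)
      also have "cmod \<dots> \<le> e * norm w"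
        using norm_triangle_le[OF add_mono[OF 1 2]] by (simp add: mult.commute)
      finally show "cmod (G w - G 0 - (w - 0) $ i * cpartial i F z) \<le> e * norm (w - 0)"
        by (simp add: G_def[of 0] axis_0)
    qed
  qed
  note step = has_derivative_add[OF insert.IH[folded \<sigma>_def] this]
  have "F (z + \<sigma> w) + G w = F (z + (\<Sum>i\<in>insert i S. axis i (w $ i)))" for w
    using insert.hyps unfolding G_def \<sigma>_def
    by (simp add: add.assoc add.commute[of "axis i (w $ i)"])
  moreover have "(\<Sum>i\<in>S. w $ i * cpartial i F z) + w $ i * cpartial i F z =
      (\<Sum>i\<in>insert i S. w $ i * cpartial i F z)" for w :: "complex ^ 'a"
    using insert.hyps by (simp add: add.commute)
  ultimately show ?case
    using step by (simp only:)
next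
  case empty
  show ?case
    unfolding sum.empty by (rule has_derivative_const)
qed

lemma sum_axis: "(\<Sum>i\<in>UNIV. axis i (w $ i)) = (w :: 'a::comm_monoid_add ^ 'n::finite)"
  by (simp add: vec_eq_iff axis_def)

text \<open>Osgood's lemma in one direction, the chain rule on coordinate lines in the other. It
  lets all later arguments on entire functions run coordinate by coordinate.\<close>

lemma entire_eq_separately_holomorphic: "entire = separately_holomorphic"
proof (intro equalityI subsetI entire_imp_separately_holomorphic)
  fix F :: "complex ^ 'n \<Rightarrow> complex" assume F: "F \<in> separately_holomorphic"
  have "(F has_derivative (\<lambda>w. \<Sum>i\<in>UNIV. w $ i * cpartial i F z)) (at z)" for z
  proof -
    have "((\<lambda>w. F (z + w)) has_derivative (\<lambda>w. \<Sum>i\<in>UNIV. w $ i * cpartial i F z)) (at 0)"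
      using has_derivative_separately_holomorphic[OF F, of z UNIV] by (simp add: sum_axis)
    moreover have "((\<lambda>w. w - z) has_derivative (\<lambda>w. w)) (at z)"
      by (auto intro!: derivative_eq_intros)
    ultimately have "((\<lambda>w. F (z + w)) \<circ> (\<lambda>w. w - z) has_derivative
        (\<lambda>w. \<Sum>i\<in>UNIV. w $ i * cpartial i F z) \<circ> (\<lambda>w. w)) (at z)"
      by (intro diff_chain_at) simp_all
    then show ?thesis
      by (simp add: o_def)
  qed
  moreover have "(\<Sum>i\<in>UNIV. (c *s v) $ i * cpartial i F z) = c * (\<Sum>i\<in>UNIV. v $ i * cpartial i F z)" for c v z
    by (simp add: sum_distrib_left mult.assoc)
  ultimately show "F \<in> entire"
    unfolding entire_def by blast
qed


section \<open>Taylor expansion in several variables\<close>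

text \<open>A finite set of multi-indices lies in a box, over which the sum factors into
  one-variable geometric sums; this bounds all finite partial sums at once.\<close>

lemma summable_multi_geometric:
  fixes q :: real
  assumes q: "0 \<le> q" "q < 1"
  shows "(\<lambda>\<alpha>::nat ^ 'n::finite. \<Prod>i\<in>UNIV. q ^ (\<alpha> $ i)) summable_on UNIV"
proof (rule nonneg_bdd_above_summable_on)
  show "0 \<le> (\<Prod>i\<in>UNIV. q ^ (\<alpha> $ i))" for \<alpha> :: "nat ^ 'n"
    using q by (intro prod_nonneg) auto
  show "bdd_above (sum (\<lambda>\<alpha>::nat ^ 'n. \<Prod>i\<in>UNIV. q ^ (\<alpha> $ i)) ` {F. F \<subseteq> UNIV \<and> finite F})"
  proof (rule bdd_aboveI2)
    fix F :: "(nat ^ 'n) set" assume "F \<in> {F. F \<subseteq> UNIV \<and> finite F}"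
    then have F: "finite F" by simp
    \<comment> \<open>Inserting 0 keeps the maximum defined when \<open>F\<close> is empty.\<close>
    define N where "N = Max (insert 0 ((\<lambda>(\<alpha>, i). \<alpha> $ i) ` (F \<times> UNIV)))"
    have N: "\<alpha> $ i \<le> N" if "\<alpha> \<in> F" for \<alpha> i
      unfolding N_def using F that by (intro Max_ge) auto
    have "(\<Sum>\<alpha>\<in>F. \<Prod>i\<in>UNIV. q ^ (\<alpha> $ i)) = (\<Sum>g\<in>vec_nth ` F. \<Prod>i\<in>UNIV. q ^ (g i))"
      by (subst sum.reindex) (auto simp: inj_on_def vec_nth_inject)
    also have "\<dots> \<le> (\<Sum>g\<in>(\<Pi>\<^sub>E i\<in>(UNIV :: 'n set). {..N}). \<Prod>i\<in>UNIV. q ^ (g i))"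
    proof (rule sum_mono2)
      show "finite (\<Pi>\<^sub>E i\<in>(UNIV :: 'n set). {..N})"
        by (intro finite_PiE) auto
      show "vec_nth ` F \<subseteq> (\<Pi>\<^sub>E i\<in>UNIV. {..N})"
        using N by auto
    qed (use q in \<open>auto intro!: prod_nonneg\<close>)
    also have "\<dots> = (\<Prod>i\<in>(UNIV :: 'n set). \<Sum>k\<le>N. q ^ k)"
      by (subst prod_sum_PiE) auto
    also have "\<dots> \<le> (\<Prod>i\<in>(UNIV :: 'n set). 1 / (1 - q))"
    proof (intro prod_mono conjI sum_nonneg)
      have "(\<Sum>k\<le>N. q ^ k) \<le> (\<Sum>k. q ^ k)"
        using q by (intro sum_le_suminf summable_geometric) auto
      then show "(\<Sum>k\<le>N. q ^ k) \<le> 1 / (1 - q)"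
        using q by (simp add: suminf_geometric)
    qed (use q in auto)
    finally show "(\<Sum>\<alpha>\<in>F. \<Prod>i\<in>UNIV. q ^ (\<alpha> $ i)) \<le> (\<Prod>i\<in>(UNIV :: 'n set). 1 / (1 - q))" .
  qed
qed

text \<open>Meant for \<alpha> of order 0 in direction i, to which it adjoins the order k. For fixed
  i every multi-index arises in this way exactly once, so that a sum over multi-indices becomes an
  iterated sum.\<close>

definition mi_upd :: "nat ^ 'n \<Rightarrow> 'n \<Rightarrow> nat \<Rightarrow> nat ^ 'n" where
  "mi_upd \<alpha> i k = (\<chi> j. if j = i then k else \<alpha> $ j)"

lemma mi_fact_pos: "0 < mi_fact \<alpha>"
  by (simp add: mi_fact_def prod_pos)

lemma prod_mi_upd:
  fixes f :: "'n::finite \<Rightarrow> nat \<Rightarrow> 'b::comm_monoid_mult"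
  assumes "f i (\<alpha> $ i) = 1"
  shows "(\<Prod>j\<in>UNIV. f j (mi_upd \<alpha> i k $ j)) = (\<Prod>j\<in>UNIV. f j (\<alpha> $ j)) * f i k"
proof -
  have "(\<Prod>j\<in>UNIV. f j (mi_upd \<alpha> i k $ j)) = f i k * (\<Prod>j\<in>UNIV - {i}. f j (\<alpha> $ j))"
    by (subst prod.remove[of _ i]) (auto simp: mi_upd_def intro!: prod.cong)
  moreover have "(\<Prod>j\<in>UNIV. f j (\<alpha> $ j)) = (\<Prod>j\<in>UNIV - {i}. f j (\<alpha> $ j))"
    using assms by (subst prod.remove[of _ i]) auto
  ultimately show ?thesis
    by (simp add: mult.commute)
qed

lemma mi_fact_upd: "\<alpha> $ i = 0 \<Longrightarrow> mi_fact (mi_upd \<alpha> i k) = mi_fact \<alpha> * fact k"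
  unfolding mi_fact_def by (rule prod_mi_upd) simp

text \<open>\<open>foldr\<close> applies the head of the list last. As \<alpha> has order 0 in every
  direction up to and including i, derivatives in direction i are the outermost ones, and raising
  their order to k means applying \<open>D i\<close> k times to the result, with no interchange of
  derivatives.\<close>

lemma foldr_mi_upd:
  assumes cs: "cs = js @ i # is" "distinct cs" and \<alpha>: "\<And>j. j \<notin> set is \<Longrightarrow> \<alpha> $ j = 0"
  shows "foldr (\<lambda>j. D j ^^ (mi_upd \<alpha> i k $ j)) cs f = (D i ^^ k) (foldr (\<lambda>j. D j ^^ (\<alpha> $ j)) cs f)"
proof -
  have 1: "foldr (\<lambda>j. D j ^^ (\<beta> $ j)) xs g = g" if "\<And>j. j \<in> set xs \<Longrightarrow> \<beta> $ j = 0" for \<beta> xs g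
    using that by (induction xs) auto
  have 2: "foldr (\<lambda>j. D j ^^ (mi_upd \<alpha> i k $ j)) is f = foldr (\<lambda>j. D j ^^ (\<alpha> $ j)) is f"
    by (rule foldr_cong) (use cs in \<open>auto simp: mi_upd_def\<close>)
  show ?thesis
  proof -
    have "foldr (\<lambda>j. D j ^^ (\<alpha> $ j)) js g = g" "foldr (\<lambda>j. D j ^^ (mi_upd \<alpha> i k $ j)) js g = g" for g
      by (rule 1, use cs \<alpha> in \<open>force simp: mi_upd_def\<close>)+
    moreover have "\<alpha> $ i = 0" "mi_upd \<alpha> i k $ i = k"
      using cs \<alpha> by (simp_all add: mi_upd_def)
    ultimately show ?thesis
      by (simp add: cs(1) 2)
  qed
qed

text \<open>Expansion in several variables from expansions in one variable, one coordinate at a time: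
  \<open>c \<alpha> x\<close> stands for the derivative of order \<open>\<alpha>\<close> at \<open>x\<close>, and \<open>e\<close> embeds the scalars into the
  complex numbers, so that the real and the complex case are covered.\<close>

lemma has_sum_taylor_coordinatewise:
  fixes c :: "nat ^ 'n::finite \<Rightarrow> 'a::real_normed_vector ^ 'n \<Rightarrow> complex" and e :: "'a \<Rightarrow> complex"
  assumes one: "\<And>js i is \<alpha> x t. coords = js @ i # is \<Longrightarrow> (\<And>j. j \<notin> set is \<Longrightarrow> \<alpha> $ j = 0) \<Longrightarrow>
      (\<lambda>k. c (mi_upd \<alpha> i k) x / fact k * e t ^ k) sums c \<alpha> (x + axis i t)"
    and abs: "\<And>x w. (\<lambda>\<alpha>. c \<alpha> x / of_real (mi_fact \<alpha>) * (\<Prod>i\<in>UNIV. e (w $ i) ^ (\<alpha> $ i))) summable_on UNIV"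
  shows "((\<lambda>\<alpha>. c \<alpha> x / of_real (mi_fact \<alpha>) * (\<Prod>i\<in>UNIV. e (w $ i) ^ (\<alpha> $ i))) has_sum c 0 (x + w)) UNIV"
proof -
  define T where "T x w \<alpha> = c \<alpha> x / of_real (mi_fact \<alpha>) * (\<Prod>i\<in>UNIV. e (w $ i) ^ (\<alpha> $ i))" for x w \<alpha>
  define M where "M is = {\<alpha> :: nat ^ 'n. \<forall>j. j \<notin> set is \<longrightarrow> \<alpha> $ j = 0}" for "is" :: "'n list"
  \<comment> \<open>Induction on the tail \<open>is\<close> of \<open>coords\<close>: only
    coordinates in \<open>is\<close> are displaced, and only multi-indices supported there are
    summed.\<close>
  have "(T x w has_sum c 0 (x + w)) (M is)"
    if "coords = js @ is" "\<forall>j. j \<notin> set is \<longrightarrow> w $ j = 0" for "is" js x w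
    using that
  proof (induction "is" arbitrary: js x w)
    case Nil
    then have "w = 0"
      by (simp add: vec_eq_iff)
    moreover have "M [] = {0}"
      by (auto simp: M_def vec_eq_iff)
    moreover have "(T x 0 has_sum sum (T x 0) {0}) {0}"
      by (rule has_sum_finite) simp
    moreover have "T x 0 0 = c 0 x"
      by (simp add: T_def mi_fact_def)
    ultimately show ?case
      by simp
  next
    case (Cons i "is")
    have i: "i \<notin> set is"
    proof -
      have "distinct (coords :: 'n list)"
        by (rule distinct_coords)
      then show ?thesis
        by (simp add: Cons.prems(1))
    qed
    define t where "t = w $ i"
    define w' where "w' = (\<chi> j. if j = i then 0 else w $ j)"
    have w': "x + axis i t + w' = x + w"
      by (simp add: w'_def t_def vec_eq_iff axis_def)
    \<comment> \<open>The inner sum over k moves the base point by t in direction i. The remaining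
      displacement w' has coordinates in \<open>is\<close> only, so the induction hypothesis applies
      at the new base point.\<close>
    have IH: "(T (x + axis i t) w' has_sum c 0 (x + w)) (M is)"
      unfolding w'[symmetric]
      by (rule Cons.IH[of "js @ [i]"]) (use Cons.prems in \<open>auto simp: w'_def\<close>)
    have summable: "T x w summable_on S" for S
      unfolding T_def by (rule summable_on_subset[OF abs]) simp
    have bij: "bij_betw (\<lambda>(\<alpha>, k). mi_upd \<alpha> i k) (M is \<times> UNIV) (M (i # is))"
      by (rule bij_betw_byWitness[where f' = "\<lambda>\<beta>. (mi_upd \<beta> i 0, \<beta> $ i)"])
        (use i in \<open>auto simp: M_def mi_upd_def vec_eq_iff\<close>)
    have "(T x w has_sum infsum (T x w) (M (i # is))) (M (i # is))"
      by (intro has_sum_infsum summable)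
    then have "((\<lambda>(\<alpha>, k). T x w (mi_upd \<alpha> i k)) has_sum infsum (T x w) (M (i # is))) (M is \<times> UNIV)"
      using has_sum_reindex_bij_betw[OF bij, of "T x w"] by (simp add: case_prod_unfold)
    moreover have "((\<lambda>k. T x w (mi_upd \<alpha> i k)) has_sum T (x + axis i t) w' \<alpha>) UNIV"
      if "\<alpha> \<in> M is" for \<alpha>
    proof -
      have \<alpha>: "\<And>j. j \<notin> set is \<Longrightarrow> \<alpha> $ j = 0" and \<alpha>i: "\<alpha> $ i = 0"
        using that i by (auto simp: M_def)
      define P where "P = (\<Prod>j\<in>UNIV. e (w' $ j) ^ (\<alpha> $ j))"
      have "(\<Prod>j\<in>UNIV. e (w $ j) ^ (\<alpha> $ j)) = P"
        unfolding P_def using \<alpha>i by (intro prod.cong) (auto simp: w'_def)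
      then have "(\<Prod>j\<in>UNIV. e (w $ j) ^ (mi_upd \<alpha> i k $ j)) = P * e t ^ k" for k
        using prod_mi_upd[of "\<lambda>j n. e (w $ j) ^ n" i \<alpha> k] \<alpha>i by (simp add: t_def)
      then have T: "T x w (mi_upd \<alpha> i k) =
          c (mi_upd \<alpha> i k) x / fact k * e t ^ k * (P / of_real (mi_fact \<alpha>))" for k
        using \<alpha>i by (simp add: T_def mi_fact_upd mult_ac)
      have "(\<lambda>k. T x w (mi_upd \<alpha> i k)) sums (c \<alpha> (x + axis i t) * (P / of_real (mi_fact \<alpha>)))"
        unfolding T by (rule sums_mult2, rule one[OF Cons.prems(1) \<alpha>])
      moreover have "c \<alpha> (x + axis i t) * (P / of_real (mi_fact \<alpha>)) = T (x + axis i t) w' \<alpha>"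
        by (simp add: T_def P_def)
      moreover have "inj (mi_upd \<alpha> i)"
        by (auto simp: inj_def mi_upd_def vec_eq_iff split: if_splits)
      then have "(\<lambda>k. T x w (mi_upd \<alpha> i k)) summable_on UNIV"
        using summable[of "range (mi_upd \<alpha> i)"] summable_on_reindex[of "mi_upd \<alpha> i" UNIV "T x w"]
        by (simp add: o_def)
      ultimately show ?thesis
        using has_sum_imp_sums has_sum_infsum sums_unique2 by metis
    qed
    ultimately have "(T (x + axis i t) w' has_sum infsum (T x w) (M (i # is))) (M is)"
      by (intro has_sum_SigmaD[where f = "\<lambda>(\<alpha>, k). T x w (mi_upd \<alpha> i k)" and B = "\<lambda>_. UNIV"]) simp_all
    then have "infsum (T x w) (M (i # is)) = c 0 (x + w)"
      using IH has_sum_unique by blast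
    then show ?case
      using has_sum_infsum[OF summable[of "M (i # is)"]] by simp
  qed
  from this[of "[]" coords w x] have "(T x w has_sum c 0 (x + w)) (M coords)"
    by (simp add: set_coords)
  moreover have "M coords = UNIV"
    by (auto simp: M_def set_coords)
  ultimately show ?thesis
    by (simp add: T_def[abs_def])
qed


section \<open>Cauchy estimates and Taylor expansion of entire functions\<close>

text \<open>Takes the coordinates in the same order as \<open>mderiv\<close>, so that the two match
  on restrictions by a plain induction along \<open>coords\<close>.\<close>

definition cmderiv :: "nat ^ 'n::finite \<Rightarrow> (complex ^ 'n \<Rightarrow> complex) \<Rightarrow> complex ^ 'n \<Rightarrow> complex" where
  "cmderiv \<alpha> F = foldr (\<lambda>i. cpartial i ^^ (\<alpha> $ i)) coords F"

lemma separately_holomorphic_cpartial_funpow: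
  "F \<in> separately_holomorphic \<Longrightarrow> (cpartial i ^^ k) F \<in> separately_holomorphic"
  by (induction k) (simp_all add: separately_holomorphic_cpartial)

lemma separately_holomorphic_foldr:
  "F \<in> separately_holomorphic \<Longrightarrow> foldr (\<lambda>i. cpartial i ^^ (\<alpha> $ i)) is F \<in> separately_holomorphic"
  by (induction "is") (simp_all add: separately_holomorphic_cpartial_funpow)

lemma cauchy_estimate_cpartial_funpow:
  assumes F: "F \<in> separately_holomorphic" and r: "0 < r"
    and B: "\<And>t. cmod t = r \<Longrightarrow> cmod (F (z + axis i t)) \<le> B"
  shows "cmod ((cpartial i ^^ k) F z) \<le> B * (fact k / r ^ k)"
proof -
  have "cmod ((deriv ^^ k) (\<lambda>s. F (z + axis i s)) 0) \<le> fact k * B / r ^ k"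
    by (rule Cauchy_inequality)
      (use B r in \<open>auto intro!: separately_holomorphic_axis[OF F] holomorphic_on_imp_continuous_on\<close>)
  then show ?thesis
    using cpartial_funpow_axis[where i = i and k = k and F = F and z = z and t = 0]
    by (simp add: axis_0 mult_ac)
qed

text \<open>Cauchy's inequality in one variable for each list entry. When the outermost variable
  runs over its circle, the centre of the remaining estimate moves to \<open>z + axis i t\<close>;
  hence z is general in the induction, and the polydisc has radius 0 in the coordinates outside the
  list.\<close>

lemma cauchy_estimate_foldr:
  assumes F: "F \<in> separately_holomorphic" and R: "\<And>i. 0 < R i" and "distinct is"
    and B: "\<And>\<zeta>. (\<And>i. cmod (\<zeta> $ i - z $ i) \<le> (if i \<in> set is then R i else 0)) \<Longrightarrow> cmod (F \<zeta>) \<le> B"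
  shows "cmod (foldr (\<lambda>i. cpartial i ^^ (\<alpha> $ i)) is F z) \<le> B * (\<Prod>i\<in>set is. fact (\<alpha> $ i) / R i ^ (\<alpha> $ i))"
  using assms(3) B
proof (induction "is" arbitrary: z)
  case Nil
  then show ?case by simp
next
  case (Cons i "is")
  have "cmod ((cpartial i ^^ (\<alpha> $ i)) (foldr (\<lambda>i. cpartial i ^^ (\<alpha> $ i)) is F) z) \<le>
      (B * (\<Prod>i\<in>set is. fact (\<alpha> $ i) / R i ^ (\<alpha> $ i))) * (fact (\<alpha> $ i) / R i ^ (\<alpha> $ i))"
  proof (rule cauchy_estimate_cpartial_funpow[OF separately_holomorphic_foldr[OF F] R])
    fix t assume t: "cmod t = R i"
    show "cmod (foldr (\<lambda>i. cpartial i ^^ (\<alpha> $ i)) is F (z + axis i t)) \<le>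
        B * (\<Prod>i\<in>set is. fact (\<alpha> $ i) / R i ^ (\<alpha> $ i))"
    proof (rule Cons.IH)
      fix \<zeta> :: "complex ^ 'a"
      assume \<zeta>: "\<And>j. cmod (\<zeta> $ j - (z + axis i t) $ j) \<le> (if j \<in> set is then R j else 0)"
      have "cmod (\<zeta> $ j - z $ j) \<le> (if j \<in> set (i # is) then R j else 0)" for j
      proof (cases "j = i")
        case True
        \<comment> \<open>\<open>i\<close> does not occur in the tail, so this coordinate is not
          displaced there and the whole displacement is t.\<close>
        then have "\<zeta> $ i - z $ i = t"
          using \<zeta>[of i] Cons.prems(1) by (simp add: axis_def algebra_simps)
        then show ?thesis
          using True t by simp
      next
        case False
        then show ?thesis
          using \<zeta>[of j] by (simp add: axis_def)
      qed
      then show "cmod (F \<zeta>) \<le> B"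
        by (rule Cons.prems(2))
    qed (use Cons.prems(1) in simp)
  qed
  then show ?case
    using Cons.prems(1) by (simp add: mult_ac)
qed

lemma cauchy_estimate_cmderiv:
  assumes F: "F \<in> separately_holomorphic" and R: "\<And>i. 0 < R i"
    and B: "\<And>\<zeta>. (\<And>i. cmod (\<zeta> $ i - z $ i) \<le> R i) \<Longrightarrow> cmod (F \<zeta>) \<le> B"
  shows "cmod (cmderiv \<alpha> F z) \<le> B * mi_fact \<alpha> / (\<Prod>i\<in>UNIV. R i ^ (\<alpha> $ i))"
  using cauchy_estimate_foldr[OF F R distinct_coords, where z = z and B = B and \<alpha> = \<alpha>] B
  by (simp add: cmderiv_def mi_fact_def prod_dividef set_coords)

lemma norm_le_componentwise:
  fixes x :: "'a::real_normed_vector ^ 'n::finite" and y :: "'b::real_normed_vector ^ 'n"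
  assumes "\<And>i. norm (x $ i) \<le> norm (y $ i)"
  shows "norm x \<le> norm y"
  unfolding norm_vec_def by (rule L2_set_mono) (auto simp: assms)

lemma norm_mi_power: "cmod (mi_power w \<alpha>) = (\<Prod>i\<in>UNIV. cmod (w $ i) ^ (\<alpha> $ i))"
  by (simp add: mi_power_def prod_norm[symmetric] norm_power)

lemma summable_taylor:
  assumes F: "F \<in> separately_holomorphic"
  shows "(\<lambda>\<alpha>. cmderiv \<alpha> F z / of_real (mi_fact \<alpha>) * mi_power w \<alpha>) summable_on UNIV"
proof -
  \<comment> \<open>Twice the modulus makes each ratio cmod (w_i) / R_i at most 1/2; adding 1 keeps
    the radius positive when w_i = 0.\<close>
  define R where "R = (\<chi> i. 2 * cmod (w $ i) + 1)"
  have R: "0 < R $ i" for i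
    by (simp add: R_def add_nonneg_pos)
  have "bounded (F ` cball z (norm R))"
    using F by (intro compact_imp_bounded compact_continuous_image separately_holomorphic_continuous) auto
  then obtain B where B: "\<And>z'. z' \<in> cball z (norm R) \<Longrightarrow> cmod (F z') \<le> B"
    unfolding bounded_iff by blast
  then have "0 \<le> B"
    using norm_ge_zero[of "F z"] order_trans by (metis centre_in_cball norm_ge_zero)
  have cauchy: "cmod (cmderiv \<alpha> F z) \<le> B * mi_fact \<alpha> / (\<Prod>i\<in>UNIV. R $ i ^ (\<alpha> $ i))" for \<alpha>
  proof (rule cauchy_estimate_cmderiv[OF F R])
    fix \<zeta> assume "\<And>i. cmod (\<zeta> $ i - z $ i) \<le> R $ i"
    then have "norm (\<zeta> - z) \<le> norm R"
      using R by (intro norm_le_componentwise) (simp add: less_imp_le)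
    then show "cmod (F \<zeta>) \<le> B"
      by (intro B) (simp add: dist_norm norm_minus_commute)
  qed
  show ?thesis
  proof (rule abs_summable_summable, rule Infinite_Sum.abs_summable_on_comparison_test')
    show "(\<lambda>\<alpha>::nat ^ 'a. B * (\<Prod>i\<in>UNIV. (1 / 2) ^ (\<alpha> $ i))) summable_on UNIV"
      by (intro summable_on_cmult_right summable_multi_geometric) auto
    fix \<alpha> :: "nat ^ 'a"
    have "cmod (cmderiv \<alpha> F z / of_real (mi_fact \<alpha>) * mi_power w \<alpha>) =
        cmod (cmderiv \<alpha> F z) / mi_fact \<alpha> * (\<Prod>i\<in>UNIV. cmod (w $ i) ^ (\<alpha> $ i))"
      using mi_fact_pos[of \<alpha>] by (simp add: norm_mult norm_divide norm_mi_power)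
    also have "\<dots> \<le> (B * mi_fact \<alpha> / (\<Prod>i\<in>UNIV. R $ i ^ (\<alpha> $ i))) / mi_fact \<alpha> * (\<Prod>i\<in>UNIV. cmod (w $ i) ^ (\<alpha> $ i))"
      using mi_fact_pos[of \<alpha>] by (intro mult_right_mono divide_right_mono cauchy prod_nonneg) auto
    also have "\<dots> = B * (\<Prod>i\<in>UNIV. (cmod (w $ i) / R $ i) ^ (\<alpha> $ i))"
      using mi_fact_pos[of \<alpha>] by (simp add: power_divide prod_dividef)
    also have "\<dots> \<le> B * (\<Prod>i\<in>UNIV. (1 / 2) ^ (\<alpha> $ i))"
    proof (intro mult_left_mono \<open>0 \<le> B\<close> prod_mono conjI power_mono)
      show "cmod (w $ i) / R $ i \<le> 1 / 2" "0 \<le> cmod (w $ i) / R $ i" "0 \<le> (cmod (w $ i) / R $ i) ^ (\<alpha> $ i)" for i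
        using R[of i] by (auto simp: R_def field_simps less_imp_le)
    qed
    finally show "cmod (cmderiv \<alpha> F z / of_real (mi_fact \<alpha>) * mi_power w \<alpha>) \<le> B * (\<Prod>i\<in>UNIV. (1 / 2) ^ (\<alpha> $ i))" .
  qed
qed

lemma has_sum_taylor:
  assumes F: "F \<in> separately_holomorphic"
  shows "((\<lambda>\<alpha>. cmderiv \<alpha> F z / of_real (mi_fact \<alpha>) * mi_power w \<alpha>) has_sum F (z + w)) UNIV"
proof -
  have "((\<lambda>\<alpha>. cmderiv \<alpha> F z / of_real (mi_fact \<alpha>) * (\<Prod>i\<in>UNIV. id (w $ i) ^ (\<alpha> $ i))) has_sum cmderiv 0 F (z + w)) UNIV"
  proof (rule has_sum_taylor_coordinatewise)
    fix js i "is" and \<alpha> :: "nat ^ 'a" and x :: "complex ^ 'a" and t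
    assume cs: "coords = js @ i # is" "\<And>j. j \<notin> set is \<Longrightarrow> \<alpha> $ j = 0"
    define G where "G = cmderiv \<alpha> F"
    have "cmderiv (mi_upd \<alpha> i k) F x = (deriv ^^ k) (\<lambda>s. G (x + axis i s)) 0" for k
      using foldr_mi_upd[OF cs(1) distinct_coords cs(2), where D = cpartial and k = k and f = F]
        cpartial_funpow_axis[where i = i and k = k and F = G and z = x and t = 0]
      by (simp add: cmderiv_def G_def axis_0)
    \<comment> \<open>Any radius larger than \<open>cmod t\<close> would do, since the function is
      holomorphic on the whole plane.\<close>
    moreover have "(\<lambda>s. G (x + axis i s)) holomorphic_on ball 0 (cmod t + 1)"
      unfolding G_def cmderiv_def by (rule separately_holomorphic_axis[OF separately_holomorphic_foldr[OF F]])
    ultimately show "(\<lambda>k. cmderiv (mi_upd \<alpha> i k) F x / fact k * id t ^ k) sums cmderiv \<alpha> F (x + axis i t)"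
      using holomorphic_power_series[of "\<lambda>s. G (x + axis i s)" 0 "cmod t + 1" t] by (simp add: G_def)
  qed (use summable_taylor[OF F] in \<open>simp add: mi_power_def\<close>)
  moreover have "cmderiv 0 F = F"
  proof -
    have "foldr (\<lambda>i. cpartial i ^^ (0 :: nat ^ 'a) $ i) is F = F" for "is" :: "'a list"
      by (induction "is") auto
    then show ?thesis
      by (simp add: cmderiv_def)
  qed
  ultimately show ?thesis
    by (simp add: mi_power_def)
qed

text \<open>Partial sums are polynomials. On the unit ball about a, arguments have norm at most K =
  norm a + 1, and the coefficient bound with r = 1 / (2 * K) makes the terms at most C times powers
  of 1/2, so the Weierstrass test gives uniform convergence.\<close>

lemma separately_holomorphic_power_series:
  fixes c :: "nat ^ 'n::finite \<Rightarrow> complex"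
  assumes c: "\<And>r. 0 < r \<Longrightarrow> \<exists>C. \<forall>\<alpha>. cmod (c \<alpha>) \<le> C * (\<Prod>i\<in>UNIV. r ^ (\<alpha> $ i))"
  shows "(\<lambda>z. \<Sum>\<^sub>\<infinity>\<alpha>\<in>UNIV. c \<alpha> * mi_power z \<alpha>) \<in> separately_holomorphic"
proof (rule uniform_limit_separately_holomorphic)
  have monomial: "mi_power z \<alpha> = (\<Prod>i\<in>UNIV. (z $ i) ^ (\<alpha> $ i))" for z :: "complex ^ 'n" and \<alpha>
    by (simp add: mi_power_def)
  have "(\<lambda>z. \<Sum>\<alpha>\<in>X. c \<alpha> * mi_power z \<alpha>) \<in> separately_holomorphic" for X
  proof (rule separately_holomorphicI)
    show "continuous_on UNIV (\<lambda>z. \<Sum>\<alpha>\<in>X. c \<alpha> * mi_power z \<alpha>)"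
      unfolding monomial by (intro continuous_intros)
    fix z :: "complex ^ 'n" and i
    have "(\<lambda>t. (z + axis i t) $ j) holomorphic_on UNIV" for j
      by (cases "j = i") (auto simp: axis_def intro!: holomorphic_intros)
    then show "(\<lambda>t. \<Sum>\<alpha>\<in>X. c \<alpha> * mi_power (z + axis i t) \<alpha>) holomorphic_on UNIV"
      unfolding monomial by (intro holomorphic_intros)
  qed
  then show "\<forall>\<^sub>F X in finite_subsets_at_top UNIV. (\<lambda>z. \<Sum>\<alpha>\<in>X. c \<alpha> * mi_power z \<alpha>) \<in> separately_holomorphic"
    by simp
  fix a :: "complex ^ 'n"
  define K where "K = norm a + 1"
  have K: "0 < K"
    by (simp add: K_def add_nonneg_pos)
  obtain C where C: "\<And>\<alpha>. cmod (c \<alpha>) \<le> C * (\<Prod>i\<in>UNIV. (1 / (2 * K)) ^ (\<alpha> $ i))"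
    using c[of "1 / (2 * K)"] K by auto
  show "uniform_limit (cball a 1) (\<lambda>X z. \<Sum>\<alpha>\<in>X. c \<alpha> * mi_power z \<alpha>)
      (\<lambda>z. \<Sum>\<^sub>\<infinity>\<alpha>\<in>UNIV. c \<alpha> * mi_power z \<alpha>) (finite_subsets_at_top UNIV)"
  proof (rule Weierstrass_m_test_general)
    show "(\<lambda>\<alpha>::nat ^ 'n. C * (\<Prod>i\<in>UNIV. (1 / 2) ^ (\<alpha> $ i))) summable_on UNIV"
      by (intro summable_on_cmult_right summable_multi_geometric) auto
    fix \<alpha> :: "nat ^ 'n" and z assume z: "z \<in> cball a 1"
    have "norm z \<le> K"
      using z norm_triangle_ineq4[of a "a - z"] by (simp add: K_def dist_norm)
    then have zi: "cmod (z $ i) \<le> K" for i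
      using Finite_Cartesian_Product.norm_nth_le[of z i] by linarith
    have "0 \<le> C * (\<Prod>i\<in>UNIV. (1 / (2 * K)) ^ (\<alpha> $ i))"
      using C[of \<alpha>] norm_ge_zero order_trans by blast
    then have "cmod (c \<alpha> * mi_power z \<alpha>) \<le>
        (C * (\<Prod>i\<in>UNIV. (1 / (2 * K)) ^ (\<alpha> $ i))) * (\<Prod>i\<in>UNIV. K ^ (\<alpha> $ i))"
      unfolding norm_mult norm_mi_power using zi C[of \<alpha>]
      by (intro mult_mono prod_mono prod_nonneg) (auto intro!: power_mono)
    also have "\<dots> = C * (\<Prod>i\<in>UNIV. (1 / 2) ^ (\<alpha> $ i))"
      using K by (simp add: mult.assoc flip: prod.distrib power_mult_distrib)
    finally show "cmod (c \<alpha> * mi_power z \<alpha>) \<le> C * (\<Prod>i\<in>UNIV. (1 / 2) ^ (\<alpha> $ i))" .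
  qed
qed simp


section \<open>Restriction to the real space\<close>

definition cvec :: "real ^ 'n \<Rightarrow> complex ^ 'n" where
  "cvec x = (\<chi> i. complex_of_real (x $ i))"

text \<open>Turns out to be the inverse of \<open>extension_map\<close>. It also represents the
  elements of \<open>cE_space h\<close> through entire functions, whose derivatives are easier to
  handle.\<close>

definition restr :: "(complex ^ 'n \<Rightarrow> complex) \<Rightarrow> real ^ 'n \<Rightarrow> complex" where
  "restr F x = F (cvec x)"

lemma cvec_0: "cvec 0 = 0"
  by (simp add: cvec_def vec_eq_iff)

lemma cvec_add_axis: "cvec (x + axis i t) = cvec x + axis i (complex_of_real t)"
  by (simp add: cvec_def vec_eq_iff axis_def)

lemma norm_cvec: "norm (cvec x) = norm x"
  by (simp add: cvec_def norm_vec_def)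

lemma continuous_on_cvec: "continuous_on S (cvec :: real ^ 'n::finite \<Rightarrow> _)"
  unfolding cvec_def by (intro continuous_intros)

lemma has_vector_derivative_restr:
  assumes F: "F \<in> separately_holomorphic"
  shows "((\<lambda>t. restr F (x + t *\<^sub>R axis i 1)) has_vector_derivative restr (cpartial i F) x) (at 0)"
  using has_vector_derivative_real_field[where a = 0 and s = UNIV and f = "\<lambda>t. F (cvec x + axis i t)"]
    has_field_derivative_cpartial[OF F, where z = "cvec x" and i = i and t = 0]
  by (simp add: restr_def scaleR_axis_1 cvec_add_axis axis_0)

lemma partial_deriv_restr:
  "F \<in> separately_holomorphic \<Longrightarrow> partial_deriv i (restr F) = restr (cpartial i F)"
  unfolding partial_deriv_def by (rule ext) (rule vector_derivative_at[OF has_vector_derivative_restr])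

lemma restr_Cinfinity:
  assumes "F \<in> separately_holomorphic"
  shows "restr F \<in> Cinfinity"
proof -
  have "Ck k (restr F)" for k
    using assms
  proof (induction k arbitrary: F)
    case 0
    then have "continuous_on UNIV (\<lambda>x. F (cvec x))"
      by (intro continuous_on_compose2[OF separately_holomorphic_continuous[where S = UNIV] continuous_on_cvec]) auto
    then show ?case
      by (simp add: restr_def[abs_def])
  next
    case (Suc k)
    then have "continuous_on UNIV (\<lambda>x. F (cvec x))"
      by (intro continuous_on_compose2[OF separately_holomorphic_continuous[where S = UNIV] continuous_on_cvec]) auto
    moreover have "(\<lambda>t. restr F (x + t *\<^sub>R axis i 1)) differentiable at 0" for x i
      by (rule differentiableI_vector[OF has_vector_derivative_restr[OF Suc.prems]])
    ultimately show ?case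
      using Suc.IH[OF separately_holomorphic_cpartial[OF Suc.prems]]
      by (simp add: partial_deriv_restr[OF Suc.prems]) (simp add: restr_def[abs_def])
  qed
  then show ?thesis
    by (simp add: Cinfinity_def)
qed

lemma mderiv_restr:
  assumes F: "F \<in> separately_holomorphic"
  shows "mderiv \<alpha> (restr F) = restr (cmderiv \<alpha> F)"
proof -
  have pow: "(partial_deriv i ^^ k) (restr G) = restr ((cpartial i ^^ k) G)"
    if "G \<in> separately_holomorphic" for i k and G :: "complex ^ 'a \<Rightarrow> complex"
    using that by (induction k) (simp_all add: partial_deriv_restr separately_holomorphic_cpartial_funpow)
  have "foldr (\<lambda>i. partial_deriv i ^^ (\<alpha> $ i)) is (restr F) = restr (foldr (\<lambda>i. cpartial i ^^ (\<alpha> $ i)) is F)" for "is"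
    by (induction "is") (simp_all add: pow separately_holomorphic_foldr[OF F])
  then show ?thesis
    by (simp add: mderiv_def cmderiv_def)
qed

text \<open>The coefficients in \<open>extension_map\<close> are real partial derivatives at 0; for
  a restriction they equal the complex ones, so the series is the Taylor series of F.\<close>

lemma extension_map_restr:
  assumes F: "F \<in> separately_holomorphic"
  shows "extension_map (restr F) = F"
proof
  fix z
  have "((\<lambda>\<alpha>. cmderiv \<alpha> F 0 / of_real (mi_fact \<alpha>) * mi_power z \<alpha>) has_sum F z) UNIV"
    using has_sum_taylor[OF F, of 0 z] by simp
  then show "extension_map (restr F) z = F z"
    unfolding extension_map_def mderiv_restr[OF F] by (simp add: restr_def cvec_0 infsumI)
qed


section \<open>Taylor expansion of smooth functions with bounded derivatives\<close>

text \<open>Lagrange's remainder involves an unknown intermediate point, which is why the bound on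
  \<open>g k\<close> is asked at all t. Choosing the rate r so that r |s| is at most 1/2 makes the
  remainder of order n at most C times the n-th power of 1/2.\<close>

lemma taylor_sums_real:
  fixes g :: "nat \<Rightarrow> real \<Rightarrow> real"
  assumes g: "\<And>k t. (g k has_real_derivative g (Suc k) t) (at t)"
    and bound: "\<And>r. 0 < r \<Longrightarrow> \<exists>C. \<forall>k t. \<bar>g k t\<bar> \<le> C * fact k * r ^ k"
  shows "(\<lambda>k. g k 0 / fact k * s ^ k) sums g 0 s"
proof -
  define r where "r = 1 / (2 * (\<bar>s\<bar> + 1))"
  have r: "0 < r" "r * \<bar>s\<bar> \<le> 1 / 2"
    by (auto simp: r_def field_simps add_pos_nonneg)
  obtain C where C: "\<And>k t. \<bar>g k t\<bar> \<le> C * fact k * r ^ k"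
    using bound[OF r(1)] by blast
  have "0 \<le> C"
    using C[of 0 0] by simp
  have le: "norm ((\<Sum>k<n. g k 0 / fact k * s ^ k) - g 0 s) \<le> C * (1 / 2) ^ n" for n
  proof -
    obtain t where t: "g 0 s = (\<Sum>k<n. g k 0 / fact k * s ^ k) + g n t / fact n * s ^ n"
      using Maclaurin_all_le[of g "g 0" s n] g by auto
    have "norm ((\<Sum>k<n. g k 0 / fact k * s ^ k) - g 0 s) = \<bar>g n t\<bar> / fact n * \<bar>s\<bar> ^ n"
      by (subst t) (simp add: abs_mult power_abs)
    also have "\<dots> \<le> (C * fact n * r ^ n) / fact n * \<bar>s\<bar> ^ n"
      by (intro mult_right_mono divide_right_mono C) auto
    also have "\<dots> = C * (r * \<bar>s\<bar>) ^ n"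
      by (simp add: power_mult_distrib)
    also have "\<dots> \<le> C * (1 / 2) ^ n"
      using r \<open>0 \<le> C\<close> by (intro mult_left_mono power_mono) auto
    finally show ?thesis .
  qed
  have "(\<lambda>n. C * (1 / 2) ^ n) \<longlonglongrightarrow> C * 0"
    by (intro tendsto_mult_left LIMSEQ_power_zero) simp
  then have "(\<lambda>n. (\<Sum>k<n. g k 0 / fact k * s ^ k) - g 0 s) \<longlonglongrightarrow> 0"
    by (intro Lim_null_comparison[OF always_eventually[OF allI[OF le]]]) simp
  then show ?thesis
    unfolding sums_def by (rule LIM_zero_cancel)
qed

text \<open>For complex values there need not be a common intermediate point in Lagrange's
  remainder, so real and imaginary parts are expanded separately.\<close>

lemma taylor_sums_vector:
  fixes g :: "nat \<Rightarrow> real \<Rightarrow> complex"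
  assumes g: "\<And>k t. (g k has_vector_derivative g (Suc k) t) (at t)"
    and bound: "\<And>r. 0 < r \<Longrightarrow> \<exists>C. \<forall>k t. cmod (g k t) \<le> C * fact k * r ^ k"
  shows "(\<lambda>k. g k 0 / fact k * of_real s ^ k) sums g 0 s"
proof -
  have g': "((\<lambda>t. Re (g k t)) has_real_derivative Re (g (Suc k) t)) (at t)"
    "((\<lambda>t. Im (g k t)) has_real_derivative Im (g (Suc k) t)) (at t)" for k t
    using bounded_linear.has_vector_derivative[OF bounded_linear_Re g]
      bounded_linear.has_vector_derivative[OF bounded_linear_Im g]
    by (simp_all add: has_real_derivative_iff_has_vector_derivative)
  have "\<exists>C. \<forall>k t. \<bar>Re (g k t)\<bar> \<le> C * fact k * r ^ k \<and> \<bar>Im (g k t)\<bar> \<le> C * fact k * r ^ k"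
    if r: "0 < r" for r
  proof -
    obtain C where "\<And>k t. cmod (g k t) \<le> C * fact k * r ^ k"
      using bound[OF r] by blast
    then have "\<bar>Re (g k t)\<bar> \<le> C * fact k * r ^ k \<and> \<bar>Im (g k t)\<bar> \<le> C * fact k * r ^ k" for k t
      using abs_Re_le_cmod[of "g k t"] abs_Im_le_cmod[of "g k t"] order_trans by blast
    then show ?thesis by blast
  qed
  then have "\<exists>C. \<forall>k t. \<bar>Re (g k t)\<bar> \<le> C * fact k * r ^ k" "\<exists>C. \<forall>k t. \<bar>Im (g k t)\<bar> \<le> C * fact k * r ^ k"
    if "0 < r" for r
    using that by blast+
  from taylor_sums_real[OF g'(1) this(1), of s] taylor_sums_real[OF g'(2) this(2), of s]
  have "(\<lambda>k. Re (g k 0) / fact k * s ^ k) sums Re (g 0 s)" "(\<lambda>k. Im (g k 0) / fact k * s ^ k) sums Im (g 0 s)"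
    by simp_all
  moreover have "g k 0 / fact k * of_real s ^ k = of_real (s ^ k / fact k) * g k 0" for k
    by simp
  then have "Re (g k 0 / fact k * of_real s ^ k) = Re (g k 0) / fact k * s ^ k"
    "Im (g k 0 / fact k * of_real s ^ k) = Im (g k 0) / fact k * s ^ k" for k
    by (simp_all only: times_complex.sel Re_complex_of_real Im_complex_of_real) simp_all
  ultimately show ?thesis
    unfolding sums_complex_iff by simp
qed

lemma Cinfinity_partial_deriv:
  assumes "f \<in> Cinfinity"
  shows "partial_deriv i f \<in> Cinfinity"
proof -
  have "Ck (Suc k) f" for k
    using assms by (simp add: Cinfinity_def)
  then show ?thesis
    by (simp add: Cinfinity_def)
qed

lemma Cinfinity_foldr:
  "f \<in> Cinfinity \<Longrightarrow> foldr (\<lambda>i. partial_deriv i ^^ (\<alpha> $ i)) is f \<in> Cinfinity"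
proof (induction "is")
  case (Cons i "is")
  have "(partial_deriv i ^^ k) g \<in> Cinfinity" if "g \<in> Cinfinity" for k and g :: "real ^ 'a \<Rightarrow> complex"
    using that by (induction k) (simp_all add: Cinfinity_partial_deriv)
  then show ?case
    using Cons by simp
qed simp

lemma Cinfinity_funpow: "f \<in> Cinfinity \<Longrightarrow> (partial_deriv i ^^ k) f \<in> Cinfinity"
  by (induction k) (simp_all add: Cinfinity_partial_deriv)

lemma has_vector_derivative_partial_deriv:
  assumes "f \<in> Cinfinity"
  shows "((\<lambda>t. f (x + axis i t)) has_vector_derivative partial_deriv i f (x + axis i t)) (at t)"
proof -
  define y where "y = x + axis i t"
  have "Ck (Suc 0) f"
    using assms by (simp add: Cinfinity_def)
  then have "(\<lambda>t. f (y + t *\<^sub>R axis i 1)) differentiable (at 0)"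
    by simp
  \<comment> \<open>Writing \<open>t - t\<close> for 0 gives the form needed for the chain rule with
    the translation \<open>s - t\<close>.\<close>
  then have 1: "((\<lambda>t. f (y + t *\<^sub>R axis i 1)) has_vector_derivative partial_deriv i f y) (at (t - t))"
    by (simp add: partial_deriv_def vector_derivative_works)
  have 2: "((\<lambda>s. s - t) has_vector_derivative 1) (at t)"
    by (auto intro!: derivative_eq_intros)
  have "f (y + (s - t) *\<^sub>R axis i 1) = f (x + axis i s)" for s
    using axis_add[of i t "s - t"] by (simp add: y_def scaleR_axis_1 add.assoc)
  then show ?thesis
    using vector_diff_chain_at[OF 2 1] by (simp add: o_def y_def)
qed

text \<open>The part of membership in \<open>cE_space h\<close> that concerns analyticity: the
  Taylor series at every real point converges on the whole space, with bounds uniform in the point.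
  The uniformity serves the Lagrange remainder.\<close>

definition tame :: "(real ^ 'n::finite \<Rightarrow> complex) \<Rightarrow> bool" where
  "tame f \<longleftrightarrow> f \<in> Cinfinity \<and>
     (\<forall>r>0. \<exists>C. \<forall>\<alpha> x. cmod (mderiv \<alpha> f x) \<le> C * (mi_fact \<alpha> * (\<Prod>i\<in>UNIV. r ^ (\<alpha> $ i))))"

lemma tame_summable:
  assumes f: "tame f"
  shows "(\<lambda>\<alpha>. mderiv \<alpha> f x / of_real (mi_fact \<alpha>) * (\<Prod>i\<in>UNIV. complex_of_real (w $ i) ^ (\<alpha> $ i)))
    summable_on UNIV"
proof -
  \<comment> \<open>Makes every \<open>r * \<bar>w $ i\<bar>\<close> at most 1/2, so that powers of
    1/2 dominate the terms; the summand 1 allows w = 0.\<close>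
  define r where "r = 1 / (2 * (norm w + 1))"
  have r: "0 < r" "r * norm w \<le> 1 / 2"
    by (auto simp: r_def field_simps add_pos_nonneg add_nonneg_pos)
  obtain C where C: "\<And>\<alpha>. cmod (mderiv \<alpha> f x) \<le> C * (mi_fact \<alpha> * (\<Prod>i\<in>UNIV. r ^ (\<alpha> $ i)))"
    using f r(1) unfolding tame_def by blast
  have "0 \<le> C"
    using order_trans[OF norm_ge_zero C[of 0]] by (simp add: mi_fact_def)
  show ?thesis
  proof (rule abs_summable_summable, rule Infinite_Sum.abs_summable_on_comparison_test')
    show "(\<lambda>\<alpha>::nat ^ 'a. C * (\<Prod>i\<in>UNIV. (1 / 2) ^ (\<alpha> $ i))) summable_on UNIV"
      by (intro summable_on_cmult_right summable_multi_geometric) auto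
    fix \<alpha> :: "nat ^ 'a"
    have "cmod (mderiv \<alpha> f x / of_real (mi_fact \<alpha>) * (\<Prod>i\<in>UNIV. complex_of_real (w $ i) ^ (\<alpha> $ i))) =
        cmod (mderiv \<alpha> f x) / mi_fact \<alpha> * (\<Prod>i\<in>UNIV. \<bar>w $ i\<bar> ^ (\<alpha> $ i))"
      using mi_fact_pos[of \<alpha>] by (simp add: norm_mult norm_divide prod_norm[symmetric] norm_power)
    also have "\<dots> \<le> C * (mi_fact \<alpha> * (\<Prod>i\<in>UNIV. r ^ (\<alpha> $ i))) / mi_fact \<alpha> * (\<Prod>i\<in>UNIV. \<bar>w $ i\<bar> ^ (\<alpha> $ i))"
      using mi_fact_pos[of \<alpha>] by (intro mult_right_mono divide_right_mono C prod_nonneg) auto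
    also have "\<dots> = C * (\<Prod>i\<in>UNIV. (r * \<bar>w $ i\<bar>) ^ (\<alpha> $ i))"
      using mi_fact_pos[of \<alpha>] by (simp add: power_mult_distrib prod.distrib)
    also have "\<dots> \<le> C * (\<Prod>i\<in>UNIV. (1 / 2) ^ (\<alpha> $ i))"
    proof (intro mult_left_mono \<open>0 \<le> C\<close> prod_mono conjI power_mono)
      show "r * \<bar>w $ i\<bar> \<le> 1 / 2" for i
        using mult_left_mono[OF component_le_norm_cart[of w i], of r] r by linarith
    qed (use r in auto)
    finally show "cmod (mderiv \<alpha> f x / of_real (mi_fact \<alpha>) * (\<Prod>i\<in>UNIV. complex_of_real (w $ i) ^ (\<alpha> $ i))) \<le>
        C * (\<Prod>i\<in>UNIV. (1 / 2) ^ (\<alpha> $ i))" .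
  qed
qed

lemma mderiv_0: "mderiv 0 f = f"
proof -
  have "foldr (\<lambda>i. partial_deriv i ^^ (0 :: nat ^ 'a) $ i) is f = f" for "is" :: "'a list"
    by (induction "is") auto
  then show ?thesis
    by (simp add: mderiv_def)
qed

lemma tame_has_sum:
  assumes f: "tame f"
  shows "((\<lambda>\<alpha>. mderiv \<alpha> f x / of_real (mi_fact \<alpha>) * (\<Prod>i\<in>UNIV. complex_of_real (w $ i) ^ (\<alpha> $ i)))
    has_sum f (x + w)) UNIV"
proof -
  have "((\<lambda>\<alpha>. mderiv \<alpha> f x / of_real (mi_fact \<alpha>) * (\<Prod>i\<in>UNIV. complex_of_real (w $ i) ^ (\<alpha> $ i)))
    has_sum mderiv 0 f (x + w)) UNIV"
  proof (rule has_sum_taylor_coordinatewise)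
    fix js i "is" and \<alpha> :: "nat ^ 'a" and x :: "real ^ 'a" and t :: real
    assume cs: "coords = js @ i # is" "\<And>j. j \<notin> set is \<Longrightarrow> \<alpha> $ j = 0"
    have "i \<notin> set is"
    proof -
      have "distinct (coords :: 'a list)"
        by (rule distinct_coords)
      then show ?thesis
        by (simp add: cs(1))
    qed
    then have \<alpha>i: "\<alpha> $ i = 0"
      by (rule cs(2))
    define G where "G k = (partial_deriv i ^^ k) (mderiv \<alpha> f)" for k
    have G: "mderiv (mi_upd \<alpha> i k) f = G k" for k
      unfolding mderiv_def G_def by (rule foldr_mi_upd[OF cs(1) distinct_coords cs(2)])
    have smooth: "G k \<in> Cinfinity" for k
      unfolding G_def mderiv_def using f by (intro Cinfinity_funpow Cinfinity_foldr) (simp add: tame_def)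
    have "(\<lambda>k. G k (x + axis i 0) / fact k * of_real t ^ k) sums G 0 (x + axis i t)"
    proof (rule taylor_sums_vector)
      show "((\<lambda>t. G k (x + axis i t)) has_vector_derivative G (Suc k) (x + axis i t)) (at t)" for k t
        using has_vector_derivative_partial_deriv[OF smooth[of k], of x i t] by (simp add: G_def)
      fix r :: real assume r: "0 < r"
      then obtain C where C: "\<And>\<alpha> x. cmod (mderiv \<alpha> f x) \<le> C * (mi_fact \<alpha> * (\<Prod>i\<in>UNIV. r ^ (\<alpha> $ i)))"
        using f unfolding tame_def by blast
      have "cmod (G k (x + axis i t)) \<le> C * mi_fact \<alpha> * (\<Prod>i\<in>UNIV. r ^ (\<alpha> $ i)) * fact k * r ^ k" for k t
      proof -
        have "(\<Prod>j\<in>UNIV. r ^ (mi_upd \<alpha> i k $ j)) = (\<Prod>j\<in>UNIV. r ^ (\<alpha> $ j)) * r ^ k"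
          using prod_mi_upd[of "\<lambda>j n. r ^ n" i \<alpha> k] \<alpha>i by simp
        then show ?thesis
          using C[of "mi_upd \<alpha> i k" "x + axis i t"] \<alpha>i by (simp add: G mi_fact_upd mult_ac)
      qed
      then show "\<exists>C. \<forall>k t. cmod (G k (x + axis i t)) \<le> C * fact k * r ^ k"
        by blast
    qed
    then show "(\<lambda>k. mderiv (mi_upd \<alpha> i k) f x / fact k * complex_of_real t ^ k) sums mderiv \<alpha> f (x + axis i t)"
      by (simp add: G axis_0) (simp add: G_def)
  qed (rule tame_summable[OF f])
  then show ?thesis
    by (simp add: mderiv_0)
qed

text \<open>At 0 the bounds in \<open>tame\<close> are the coefficient bounds of
  \<open>separately_holomorphic_power_series\<close>; on real arguments the series is the Taylor
  expansion of f about 0, which converges to f.\<close>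

lemma tame_extension:
  assumes f: "tame f"
  shows "extension_map f \<in> separately_holomorphic" and "restr (extension_map f) = f"
proof -
  show "extension_map f \<in> separately_holomorphic"
    unfolding extension_map_def[abs_def]
  proof (rule separately_holomorphic_power_series)
    fix r :: real assume "0 < r"
    then obtain C where C: "\<And>\<alpha> x. cmod (mderiv \<alpha> f x) \<le> C * (mi_fact \<alpha> * (\<Prod>i\<in>UNIV. r ^ (\<alpha> $ i)))"
      using f unfolding tame_def by blast
    have "cmod (mderiv \<alpha> f 0 / of_real (mi_fact \<alpha>)) \<le> C * (\<Prod>i\<in>UNIV. r ^ (\<alpha> $ i))" for \<alpha>
      using C[of \<alpha> 0] mi_fact_pos[of \<alpha>] by (simp add: norm_divide field_simps)
    then show "\<exists>C. \<forall>\<alpha>. cmod (mderiv \<alpha> f 0 / of_real (mi_fact \<alpha>)) \<le> C * (\<Prod>i\<in>UNIV. r ^ (\<alpha> $ i))"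
      by blast
  qed
  show "restr (extension_map f) = f"
  proof
    fix x
    show "restr (extension_map f) x = f x"
      using infsumI[OF tame_has_sum[OF f, of 0 x]]
      by (simp add: restr_def extension_map_def mi_power_def cvec_def)
  qed
qed


section \<open>Linearity\<close>

lemma separately_holomorphic_add:
  assumes "F \<in> separately_holomorphic" "G \<in> separately_holomorphic"
  shows "(\<lambda>z. F z + G z) \<in> separately_holomorphic"
  by (rule separately_holomorphicI)
    (simp_all add: assms continuous_on_add holomorphic_on_add separately_holomorphic_continuous separately_holomorphic_axis)

lemma separately_holomorphic_scale:
  assumes "F \<in> separately_holomorphic"
  shows "(\<lambda>z. c * F z) \<in> separately_holomorphic"
  by (rule separately_holomorphicI)
    (simp_all add: assms continuous_on_mult_left holomorphic_on_mult separately_holomorphic_continuous separately_holomorphic_axis)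

lemma separately_holomorphic_0: "(\<lambda>z. 0) \<in> separately_holomorphic"
  by (rule separately_holomorphicI) simp_all

lemma cpartial_add:
  assumes F: "F \<in> separately_holomorphic" and G: "G \<in> separately_holomorphic"
  shows "cpartial i (\<lambda>z. F z + G z) = (\<lambda>z. cpartial i F z + cpartial i G z)"
proof
  fix z
  have "((\<lambda>t. F (z + axis i t) + G (z + axis i t)) has_field_derivative cpartial i F z + cpartial i G z) (at 0)"
    using DERIV_add[OF has_field_derivative_cpartial[OF F, of z i 0] has_field_derivative_cpartial[OF G, of z i 0]]
    by (simp add: axis_0)
  then show "cpartial i (\<lambda>z. F z + G z) z = cpartial i F z + cpartial i G z"
    by (simp add: cpartial_def DERIV_imp_deriv)
qed

lemma cpartial_scale:
  assumes F: "F \<in> separately_holomorphic"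
  shows "cpartial i (\<lambda>z. c * F z) = (\<lambda>z. c * cpartial i F z)"
proof
  fix z
  have "((\<lambda>t. c * F (z + axis i t)) has_field_derivative c * cpartial i F z) (at 0)"
    using DERIV_cmult[OF has_field_derivative_cpartial[OF F, of z i 0], of c] by (simp add: axis_0)
  then show "cpartial i (\<lambda>z. c * F z) z = c * cpartial i F z"
    by (simp add: cpartial_def DERIV_imp_deriv)
qed

lemma cmderiv_add:
  assumes F: "F \<in> separately_holomorphic" and G: "G \<in> separately_holomorphic"
  shows "cmderiv \<alpha> (\<lambda>z. F z + G z) = (\<lambda>z. cmderiv \<alpha> F z + cmderiv \<alpha> G z)"
proof -
  have pow: "(cpartial i ^^ k) (\<lambda>z. A z + B z) = (\<lambda>z. (cpartial i ^^ k) A z + (cpartial i ^^ k) B z)"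
    if "A \<in> separately_holomorphic" "B \<in> separately_holomorphic" for i k and A B :: "complex ^ 'a \<Rightarrow> complex"
    using that by (induction k) (simp_all add: cpartial_add separately_holomorphic_cpartial_funpow)
  have "foldr (\<lambda>i. cpartial i ^^ (\<alpha> $ i)) is (\<lambda>z. F z + G z) =
      (\<lambda>z. foldr (\<lambda>i. cpartial i ^^ (\<alpha> $ i)) is F z + foldr (\<lambda>i. cpartial i ^^ (\<alpha> $ i)) is G z)" for "is"
    by (induction "is") (simp_all add: pow separately_holomorphic_foldr F G)
  then show ?thesis
    by (simp add: cmderiv_def)
qed

lemma cmderiv_scale:
  assumes F: "F \<in> separately_holomorphic"
  shows "cmderiv \<alpha> (\<lambda>z. c * F z) = (\<lambda>z. c * cmderiv \<alpha> F z)"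
proof -
  have pow: "(cpartial i ^^ k) (\<lambda>z. c * A z) = (\<lambda>z. c * (cpartial i ^^ k) A z)"
    if "A \<in> separately_holomorphic" for i k and A :: "complex ^ 'a \<Rightarrow> complex"
    using that by (induction k) (simp_all add: cpartial_scale separately_holomorphic_cpartial_funpow)
  have "foldr (\<lambda>i. cpartial i ^^ (\<alpha> $ i)) is (\<lambda>z. c * F z) =
      (\<lambda>z. c * foldr (\<lambda>i. cpartial i ^^ (\<alpha> $ i)) is F z)" for "is"
    by (induction "is") (simp_all add: pow separately_holomorphic_foldr F)
  then show ?thesis
    by (simp add: cmderiv_def)
qed

lemma restr_add: "restr (\<lambda>z. F z + G z) = (\<lambda>x. restr F x + restr G x)"
  and restr_scale: "restr (\<lambda>z. c * F z) = (\<lambda>x. c * restr F x)"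
  by (simp_all add: restr_def[abs_def])

text \<open>Additivity of \<open>partial_deriv\<close> requires differentiability at every stage.
  Since the elements of the spaces are restrictions, additivity is obtained on the complex side and
  carried over by \<open>mderiv_restr\<close>.\<close>

lemma mderiv_restr_add:
  assumes "F \<in> separately_holomorphic" "G \<in> separately_holomorphic"
  shows "mderiv \<alpha> (\<lambda>x. restr F x + restr G x) = (\<lambda>x. mderiv \<alpha> (restr F) x + mderiv \<alpha> (restr G) x)"
  using mderiv_restr[OF separately_holomorphic_add[OF assms], of \<alpha>]
  by (simp add: restr_add mderiv_restr assms cmderiv_add)

lemma mderiv_restr_scale:
  assumes "F \<in> separately_holomorphic"
  shows "mderiv \<alpha> (\<lambda>x. c * restr F x) = (\<lambda>x. c * mderiv \<alpha> (restr F) x)"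
  using mderiv_restr[OF separately_holomorphic_scale[OF assms], of \<alpha> c]
  by (simp add: restr_scale mderiv_restr assms cmderiv_scale)

lemma mderiv_zero: "mderiv \<alpha> (\<lambda>x. 0) = (\<lambda>x. 0)"
  using mderiv_restr_scale[OF separately_holomorphic_0, of \<alpha> 0] by simp


section \<open>The norms\<close>

text \<open>Clears the positive denominators, so that later estimates take place in the reals and
  without suprema.\<close>

lemma rho_le_iff:
  "rho h m f \<le> ereal C \<longleftrightarrow>
    (\<forall>x \<alpha>. (1 + norm x) ^ m * cmod (mderiv \<alpha> f x) \<le> C * (mi_fact \<alpha> * exp (- h (mi_real \<alpha>))))"
proof -
  have "0 < mi_fact \<alpha> * exp (- h (mi_real \<alpha>))" for \<alpha>
    using mi_fact_pos[of \<alpha>] by simp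
  note pos_divide_le_eq[OF this]
  then show ?thesis
    unfolding rho_def SUP_le_iff by simp
qed

lemma pnorm_le_iff:
  "pnorm \<phi> m f \<le> ereal C \<longleftrightarrow> (\<forall>z. cmod (f z) * (1 + norm z) ^ m \<le> C * exp (\<phi> (im_vec z)))"
  unfolding pnorm_def SUP_le_iff by (simp add: pos_divide_le_eq)

lemma rho_nonneg: "0 \<le> rho h m f"
proof -
  have "0 \<le> ereal ((1 + norm x) ^ m * cmod (mderiv \<alpha> f x) / (mi_fact \<alpha> * exp (- h (mi_real \<alpha>))))" for x \<alpha>
    using mi_fact_pos[of \<alpha>] by (simp add: zero_le_divide_iff zero_le_mult_iff)
  then show ?thesis
    unfolding rho_def by (intro SUP_upper2[of "(0, 0)"]) (simp_all only: UNIV_I case_prod_conv)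
qed

lemma pnorm_nonneg: "0 \<le> pnorm \<phi> m f"
  unfolding pnorm_def by (rule SUP_upper2[of 0]) simp_all

lemma cE_spaceD:
  assumes "f \<in> cE_space h"
  obtains c where "rho h m f = ereal c" "0 \<le> c"
    "\<And>x \<alpha>. (1 + norm x) ^ m * cmod (mderiv \<alpha> f x) \<le> c * (mi_fact \<alpha> * exp (- h (mi_real \<alpha>)))"
proof -
  have "rho h m f < \<infinity>"
    using assms by (auto simp: cE_space_def cE_space_m_def)
  then obtain c where c: "rho h m f = ereal c"
    using rho_nonneg[of h m f] by (cases "rho h m f") auto
  then show ?thesis
    using that[of c] rho_nonneg[of h m f] rho_le_iff[of h m f c] by simp
qed

lemma E_spaceD:
  assumes "F \<in> E_space \<phi>"
  obtains c where "pnorm \<phi> m F = ereal c" "0 \<le> c"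
    "\<And>z. cmod (F z) * (1 + norm z) ^ m \<le> c * exp (\<phi> (im_vec z))"
proof -
  have "pnorm \<phi> m F < \<infinity>"
    using assms by (auto simp: E_space_def E_space_m_def)
  then obtain c where c: "pnorm \<phi> m F = ereal c"
    using pnorm_nonneg[of \<phi> m F] by (cases "pnorm \<phi> m F") auto
  then show ?thesis
    using that[of c] pnorm_nonneg[of \<phi> m F] pnorm_le_iff[of \<phi> m F c] by simp
qed

lemma cE_spaceI:
  assumes "f \<in> Cinfinity"
    "\<And>m. \<exists>C. \<forall>x \<alpha>. (1 + norm x) ^ m * cmod (mderiv \<alpha> f x) \<le> C * (mi_fact \<alpha> * exp (- h (mi_real \<alpha>)))"
  shows "f \<in> cE_space h"
proof -
  have "rho h m f < \<infinity>" for m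
    using assms(2)[of m] unfolding rho_le_iff[symmetric] by (auto intro: le_less_trans)
  then show ?thesis
    using assms(1) by (simp add: cE_space_def cE_space_m_def)
qed

lemma E_spaceI:
  assumes "F \<in> entire" "\<And>m. \<exists>C. \<forall>z. cmod (F z) * (1 + norm z) ^ m \<le> C * exp (\<phi> (im_vec z))"
  shows "F \<in> E_space \<phi>"
proof -
  have "pnorm \<phi> m F < \<infinity>" for m
    using assms(2)[of m] unfolding pnorm_le_iff[symmetric] by (auto intro: le_less_trans)
  then show ?thesis
    using assms(1) by (simp add: E_space_def E_space_m_def)
qed

lemma E_space_separately_holomorphic: "F \<in> E_space \<phi> \<Longrightarrow> F \<in> separately_holomorphic"
  by (auto simp: E_space_def E_space_m_def entire_eq_separately_holomorphic)

text \<open>The seminorm with m = 0 bounds the derivatives uniformly in x, and superlinear growth of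
  \<open>h\<close> turns its factor exp(-h(\<alpha>)) into a geometric bound for every rate
  r.\<close>

lemma cE_space_tame:
  assumes "weight h" and f: "f \<in> cE_space h"
  shows "tame f"
proof -
  interpret weight h by fact
  obtain c where c: "0 \<le> c"
      "\<And>x \<alpha>. (1 + norm x) ^ 0 * cmod (mderiv \<alpha> f x) \<le> c * (mi_fact \<alpha> * exp (- h (mi_real \<alpha>)))"
    using cE_spaceD[OF f, of 0] by metis
  have "\<exists>C. \<forall>\<alpha> x. cmod (mderiv \<alpha> f x) \<le> C * (mi_fact \<alpha> * (\<Prod>i\<in>UNIV. r ^ (\<alpha> $ i)))" if r: "0 < r" for r
  proof -
    obtain C where C: "\<And>\<alpha>. exp (- h (mi_real \<alpha>)) \<le> C * (\<Prod>i\<in>UNIV. r ^ (\<alpha> $ i))"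
      using exp_minus_decay[OF r] by blast
    have "cmod (mderiv \<alpha> f x) \<le> (c * C) * (mi_fact \<alpha> * (\<Prod>i\<in>UNIV. r ^ (\<alpha> $ i)))" for \<alpha> x
    proof -
      have "cmod (mderiv \<alpha> f x) \<le> c * (mi_fact \<alpha> * exp (- h (mi_real \<alpha>)))"
        using c(2)[of x \<alpha>] by simp
      also have "\<dots> \<le> c * (mi_fact \<alpha> * (C * (\<Prod>i\<in>UNIV. r ^ (\<alpha> $ i))))"
        using mi_fact_pos[of \<alpha>] by (intro mult_left_mono C c(1)) auto
      finally show ?thesis
        by (simp add: mult_ac)
    qed
    then show ?thesis by blast
  qed
  moreover have "f \<in> Cinfinity"
    using f by (auto simp: cE_space_def cE_space_m_def)
  ultimately show ?thesis
    by (simp add: tame_def)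
qed

lemma cE_space_restr:
  assumes "weight h" "f \<in> cE_space h"
  obtains F where "F \<in> separately_holomorphic" "f = restr F"
  by (rule that[OF tame_extension(1)[OF cE_space_tame[OF assms]]
        tame_extension(2)[OF cE_space_tame[OF assms], symmetric]])

text \<open>Closure under sums and the triangle inequality rest on additivity of the derivatives, so
  members are first written as restrictions by \<open>cE_space_restr\<close>; this is where
  \<open>weight h\<close> enters.\<close>

lemma seminorms_on_cE_space:
  assumes h: "weight h"
  shows "seminorms_on (cE_space h) (rho h)"
proof -
  have add_bound: "(1 + norm x) ^ m * cmod (mderiv \<alpha> (\<lambda>x. f x + g x) x) \<le> (a + b) * (mi_fact \<alpha> * exp (- h (mi_real \<alpha>)))"
    if f: "f \<in> cE_space h" and g: "g \<in> cE_space h"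
      and a: "(1 + norm x) ^ m * cmod (mderiv \<alpha> f x) \<le> a * (mi_fact \<alpha> * exp (- h (mi_real \<alpha>)))"
      and b: "(1 + norm x) ^ m * cmod (mderiv \<alpha> g x) \<le> b * (mi_fact \<alpha> * exp (- h (mi_real \<alpha>)))"
    for f g m a b x \<alpha>
  proof -
    obtain F where F: "F \<in> separately_holomorphic" "f = restr F"
      using cE_space_restr[OF h f] .
    obtain G where G: "G \<in> separately_holomorphic" "g = restr G"
      using cE_space_restr[OF h g] .
    have "cmod (mderiv \<alpha> (\<lambda>x. f x + g x) x) \<le> cmod (mderiv \<alpha> f x) + cmod (mderiv \<alpha> g x)"
      unfolding F(2) G(2) mderiv_restr_add[OF F(1) G(1)] by (rule norm_triangle_ineq)
    then have "(1 + norm x) ^ m * cmod (mderiv \<alpha> (\<lambda>x. f x + g x) x) \<le>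
        (1 + norm x) ^ m * (cmod (mderiv \<alpha> f x) + cmod (mderiv \<alpha> g x))"
      by (intro mult_left_mono) auto
    then show ?thesis
      using a b by (simp add: distrib_left distrib_right)
  qed
  have "(\<lambda>x. 0) \<in> cE_space h"
  proof (rule cE_spaceI)
    show "(\<lambda>x. 0) \<in> Cinfinity"
      using restr_Cinfinity[OF separately_holomorphic_0] by (simp add: restr_def[abs_def])
    show "\<exists>C. \<forall>x \<alpha>. (1 + norm x) ^ m * cmod (mderiv \<alpha> (\<lambda>x. 0) x) \<le> C * (mi_fact \<alpha> * exp (- h (mi_real \<alpha>)))" for m
      by (rule exI[of _ 0]) (simp add: mderiv_zero)
  qed
  moreover have "(\<lambda>x. f x + g x) \<in> cE_space h" if f: "f \<in> cE_space h" and g: "g \<in> cE_space h" for f g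
  proof (rule cE_spaceI)
    obtain F where F: "F \<in> separately_holomorphic" "f = restr F"
      using cE_space_restr[OF h f] .
    obtain G where G: "G \<in> separately_holomorphic" "g = restr G"
      using cE_space_restr[OF h g] .
    show "(\<lambda>x. f x + g x) \<in> Cinfinity"
      using restr_Cinfinity[OF separately_holomorphic_add[OF F(1) G(1)]] by (simp add: F(2) G(2) restr_add)
    fix m
    obtain a where a: "\<And>x \<alpha>. (1 + norm x) ^ m * cmod (mderiv \<alpha> f x) \<le> a * (mi_fact \<alpha> * exp (- h (mi_real \<alpha>)))"
      by (rule cE_spaceD[OF f, of m]) (rule that)
    obtain b where b: "\<And>x \<alpha>. (1 + norm x) ^ m * cmod (mderiv \<alpha> g x) \<le> b * (mi_fact \<alpha> * exp (- h (mi_real \<alpha>)))"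
      by (rule cE_spaceD[OF g, of m]) (rule that)
    show "\<exists>C. \<forall>x \<alpha>. (1 + norm x) ^ m * cmod (mderiv \<alpha> (\<lambda>x. f x + g x) x) \<le> C * (mi_fact \<alpha> * exp (- h (mi_real \<alpha>)))"
      by (intro exI allI) (rule add_bound[OF f g a b])
  qed
  moreover have "(\<lambda>x. c * f x) \<in> cE_space h" if f: "f \<in> cE_space h" for f c
  proof (rule cE_spaceI)
    obtain F where F: "F \<in> separately_holomorphic" "f = restr F"
      using cE_space_restr[OF h f] .
    show "(\<lambda>x. c * f x) \<in> Cinfinity"
      using restr_Cinfinity[OF separately_holomorphic_scale[OF F(1)], of c] by (simp add: F(2) restr_scale)
    fix m
    obtain a where a: "\<And>x \<alpha>. (1 + norm x) ^ m * cmod (mderiv \<alpha> f x) \<le> a * (mi_fact \<alpha> * exp (- h (mi_real \<alpha>)))"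
      by (rule cE_spaceD[OF f, of m]) (rule that)
    have "(1 + norm x) ^ m * cmod (mderiv \<alpha> (\<lambda>x. c * f x) x) \<le> (cmod c * a) * (mi_fact \<alpha> * exp (- h (mi_real \<alpha>)))" for x \<alpha>
      using mult_left_mono[OF a[of x \<alpha>], of "cmod c"]
      unfolding F(2) mderiv_restr_scale[OF F(1)] by (simp add: norm_mult mult_ac)
    then show "\<exists>C. \<forall>x \<alpha>. (1 + norm x) ^ m * cmod (mderiv \<alpha> (\<lambda>x. c * f x) x) \<le> C * (mi_fact \<alpha> * exp (- h (mi_real \<alpha>)))"
      by blast
  qed
  ultimately have "fun_subspace (cE_space h)"
    unfolding fun_subspace_def by blast
  moreover have "rho h m (\<lambda>x. 0) = 0" for m
  proof (rule antisym[OF _ rho_nonneg])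
    show "rho h m (\<lambda>x. 0) \<le> 0"
      using rho_le_iff[of h m "\<lambda>x. 0" 0] by (simp add: mderiv_zero zero_ereal_def)
  qed
  moreover have "rho h m f < \<infinity>" if "f \<in> cE_space h" for f m
    using that by (auto simp: cE_space_def cE_space_m_def)
  moreover have "rho h m (\<lambda>x. f x + g x) \<le> rho h m f + rho h m g"
    if f: "f \<in> cE_space h" and g: "g \<in> cE_space h" for f g m
  proof -
    obtain a where a: "rho h m f = ereal a"
        "\<And>x \<alpha>. (1 + norm x) ^ m * cmod (mderiv \<alpha> f x) \<le> a * (mi_fact \<alpha> * exp (- h (mi_real \<alpha>)))"
      by (rule cE_spaceD[OF f, of m]) (rule that)
    obtain b where b: "rho h m g = ereal b"
        "\<And>x \<alpha>. (1 + norm x) ^ m * cmod (mderiv \<alpha> g x) \<le> b * (mi_fact \<alpha> * exp (- h (mi_real \<alpha>)))"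
      by (rule cE_spaceD[OF g, of m]) (rule that)
    show ?thesis
      using add_bound[OF f g a(2) b(2)] rho_le_iff[of h m "\<lambda>x. f x + g x" "a + b"]
      by (simp add: a(1) b(1))
  qed
  ultimately show ?thesis
    unfolding seminorms_on_def by (simp add: rho_nonneg)
qed

lemma seminorms_on_E_space: "seminorms_on (E_space \<phi>) (pnorm \<phi>)"
proof -
  have add_bound: "cmod (f z + g z) * (1 + norm z) ^ m \<le> (a + b) * exp (\<phi> (im_vec z))"
    if "cmod (f z) * (1 + norm z) ^ m \<le> a * exp (\<phi> (im_vec z))" "cmod (g z) * (1 + norm z) ^ m \<le> b * exp (\<phi> (im_vec z))"
    for f g :: "complex ^ 'a \<Rightarrow> complex" and m a b z
  proof -
    have "cmod (f z + g z) * (1 + norm z) ^ m \<le> (cmod (f z) + cmod (g z)) * (1 + norm z) ^ m"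
      by (intro mult_right_mono norm_triangle_ineq) auto
    then show ?thesis
      using that by (simp add: distrib_right)
  qed
  have "(\<lambda>z. 0) \<in> E_space \<phi>"
  proof (rule E_spaceI)
    show "\<exists>C. \<forall>z. cmod 0 * (1 + norm z) ^ m \<le> C * exp (\<phi> (im_vec z))" for m
      by (rule exI[of _ 0]) simp
  qed (simp add: entire_eq_separately_holomorphic separately_holomorphic_0)
  moreover have "(\<lambda>z. f z + g z) \<in> E_space \<phi>" if f: "f \<in> E_space \<phi>" and g: "g \<in> E_space \<phi>" for f g
  proof (rule E_spaceI)
    show "(\<lambda>z. f z + g z) \<in> entire"
      using f g by (simp add: entire_eq_separately_holomorphic separately_holomorphic_add E_space_separately_holomorphic)
    fix m
    obtain a where a: "\<And>z. cmod (f z) * (1 + norm z) ^ m \<le> a * exp (\<phi> (im_vec z))"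
      by (rule E_spaceD[OF f, of m]) (rule that)
    obtain b where b: "\<And>z. cmod (g z) * (1 + norm z) ^ m \<le> b * exp (\<phi> (im_vec z))"
      by (rule E_spaceD[OF g, of m]) (rule that)
    show "\<exists>C. \<forall>z. cmod (f z + g z) * (1 + norm z) ^ m \<le> C * exp (\<phi> (im_vec z))"
      by (intro exI allI) (rule add_bound[where f = f and g = g, OF a b])
  qed
  moreover have "(\<lambda>z. c * f z) \<in> E_space \<phi>" if f: "f \<in> E_space \<phi>" for f c
  proof (rule E_spaceI)
    show "(\<lambda>z. c * f z) \<in> entire"
      using f by (simp add: entire_eq_separately_holomorphic separately_holomorphic_scale E_space_separately_holomorphic)
    fix m
    obtain a where a: "\<And>z. cmod (f z) * (1 + norm z) ^ m \<le> a * exp (\<phi> (im_vec z))"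
      by (rule E_spaceD[OF f, of m]) (rule that)
    have "cmod (c * f z) * (1 + norm z) ^ m \<le> (cmod c * a) * exp (\<phi> (im_vec z))" for z
      using mult_left_mono[OF a[of z], of "cmod c"] by (simp add: norm_mult mult_ac)
    then show "\<exists>C. \<forall>z. cmod (c * f z) * (1 + norm z) ^ m \<le> C * exp (\<phi> (im_vec z))"
      by blast
  qed
  ultimately have "fun_subspace (E_space \<phi>)"
    unfolding fun_subspace_def by blast
  moreover have "pnorm \<phi> m (\<lambda>x. 0) = 0" for m
  proof (rule antisym[OF _ pnorm_nonneg])
    show "pnorm \<phi> m (\<lambda>x. 0) \<le> 0"
      using pnorm_le_iff[of \<phi> m "\<lambda>x. 0" 0] by (simp add: zero_ereal_def)
  qed
  moreover have "pnorm \<phi> m f < \<infinity>" if "f \<in> E_space \<phi>" for f m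
    using that by (auto simp: E_space_def E_space_m_def)
  moreover have "pnorm \<phi> m (\<lambda>x. f x + g x) \<le> pnorm \<phi> m f + pnorm \<phi> m g"
    if f: "f \<in> E_space \<phi>" and g: "g \<in> E_space \<phi>" for f g m
  proof -
    obtain a where a: "pnorm \<phi> m f = ereal a" "\<And>z. cmod (f z) * (1 + norm z) ^ m \<le> a * exp (\<phi> (im_vec z))"
      by (rule E_spaceD[OF f, of m]) (rule that)
    obtain b where b: "pnorm \<phi> m g = ereal b" "\<And>z. cmod (g z) * (1 + norm z) ^ m \<le> b * exp (\<phi> (im_vec z))"
      by (rule E_spaceD[OF g, of m]) (rule that)
    show ?thesis
      using add_bound[where f = f and g = g, OF a(2) b(2)] pnorm_le_iff[of \<phi> m "\<lambda>x. f x + g x" "a + b"]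
      by (simp add: a(1) b(1))
  qed
  ultimately show ?thesis
    unfolding seminorms_on_def by (simp add: pnorm_nonneg)
qed


section \<open>Estimates between the norms\<close>

text \<open>The Euclidean norm is at most the sum of the moduli, and 1 plus this sum is part of the
  expanded product, whose other terms are nonnegative.\<close>

lemma one_plus_norm_le_prod: "1 + norm y \<le> (\<Prod>i\<in>UNIV. 1 + \<bar>y $ i\<bar>)" for y :: "real ^ 'n::finite"
proof -
  have "1 + (\<Sum>i\<in>S. \<bar>y $ i\<bar>) \<le> (\<Prod>i\<in>S. 1 + \<bar>y $ i\<bar>)" for S
    using finite[of S]
  proof (induction S rule: finite_induct)
    case (insert i S)
    have "1 + (\<Sum>i\<in>insert i S. \<bar>y $ i\<bar>) \<le> (1 + \<bar>y $ i\<bar>) * (1 + (\<Sum>i\<in>S. \<bar>y $ i\<bar>))"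
      using insert.hyps by (simp add: algebra_simps sum_nonneg)
    also have "\<dots> \<le> (1 + \<bar>y $ i\<bar>) * (\<Prod>i\<in>S. 1 + \<bar>y $ i\<bar>)"
      by (intro mult_left_mono insert.IH) simp
    finally show ?case
      using insert.hyps by simp
  qed simp
  from this[of UNIV] show ?thesis
    using norm_le_l1_cart[of y] by linarith
qed

lemma norm_power_le_exp: "(1 + norm y) ^ m \<le> exp ((\<Sum>i\<in>UNIV. ln (1 + \<bar>y $ i\<bar>)) * real m)"
  for y :: "real ^ 'n::finite"
proof -
  have "0 < 1 + \<bar>y $ i\<bar>" for i
    by (simp add: add_pos_nonneg)
  then have "exp (\<Sum>i\<in>UNIV. ln (1 + \<bar>y $ i\<bar>)) = (\<Prod>i\<in>UNIV. 1 + \<bar>y $ i\<bar>)"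
    by (simp add: exp_sum)
  then have "exp ((\<Sum>i\<in>UNIV. ln (1 + \<bar>y $ i\<bar>)) * real m) = (\<Prod>i\<in>UNIV. 1 + \<bar>y $ i\<bar>) ^ m"
    by (metis exp_of_nat_mult mult.commute)
  then show ?thesis
    using power_mono[OF one_plus_norm_le_prod[of y], of m] by simp
qed

lemma exp_phi_absorbs_norm_power:
  assumes "weight h" "weight h'"
    and "\<And>x y. x \<in> orthant \<Longrightarrow> y \<in> orthant \<Longrightarrow> h' (x + y) \<le> h x + h y + l"
  shows "exp (phi h y) * (1 + norm y) ^ m \<le> exp (h (\<chi> i. real m) + l) * exp (phi h' y)"
proof -
  have "exp (phi h y) * (1 + norm y) ^ m \<le> exp (phi h y) * exp ((\<Sum>i\<in>UNIV. ln (1 + \<bar>y $ i\<bar>)) * real m)"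
    by (intro mult_left_mono norm_power_le_exp) simp
  also have "\<dots> \<le> exp (h (\<chi> i. real m) + l) * exp (phi h' y)"
    using phi_absorbs_logs[of h h' l "real m" y, OF assms] by (simp flip: exp_add)
  finally show ?thesis .
qed

lemma one_plus_norm_mult:
  assumes "norm u \<le> norm v + norm w"
  shows "1 + norm u \<le> (1 + norm v) * (1 + norm w)"
proof -
  have "(1 + norm v) * (1 + norm w) = 1 + norm v + norm w + norm v * norm w"
    by (simp add: algebra_simps)
  then show ?thesis
    using assms mult_nonneg_nonneg[OF norm_ge_zero norm_ge_zero, of v w] by linarith
qed

text \<open>Expanding about the real part x of the argument, and not about 0, gives every term the
  decay in x. As 1 + norm z is at most (1 + norm x) * (1 + norm y), the power in x is matched by
  this decay, and the power in y is absorbed in passing from \<open>h'\<close> to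
  \<open>h''\<close>.\<close>

lemma extension_map_bound:
  assumes h: "weight h" "weight h'" "weight h''"
    and shift: "\<And>x. x \<in> orthant \<Longrightarrow> h x - h' x \<ge> ln 2 * (\<Sum>j\<in>UNIV. x $ j) - \<gamma>"
    and subadd: "\<And>x y. x \<in> orthant \<Longrightarrow> y \<in> orthant \<Longrightarrow> h'' (x + y) \<le> h' x + h' y + l"
  shows "\<exists>C>0. \<forall>f\<in>cE_space h. pnorm (phi h'') m (extension_map f) \<le> ereal C * rho h m f"
proof -
  define K where "K = (\<Sum>\<^sub>\<infinity>\<alpha>::nat ^ 'a\<in>UNIV. \<Prod>i\<in>UNIV. (1 / 2 :: real) ^ (\<alpha> $ i))"
  have K: "((\<lambda>\<alpha>::nat ^ 'a. \<Prod>i\<in>UNIV. (1 / 2 :: real) ^ (\<alpha> $ i)) has_sum K) UNIV"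
    unfolding K_def by (intro has_sum_infsum summable_multi_geometric) auto
  have "0 \<le> K"
    unfolding K_def by (intro infsum_nonneg prod_nonneg) auto
  define E where "E = exp (h' (\<chi> i. real m) + l)"
  \<comment> \<open>K + 1 makes \<open>C\<close> positive on the strength of
    \<open>0 \<le> K\<close> alone.\<close>
  define C where "C = exp \<gamma> * (K + 1) * E"
  have "0 < C"
    using \<open>0 \<le> K\<close> by (simp add: C_def E_def)
  moreover have "pnorm (phi h'') m (extension_map f) \<le> ereal C * rho h m f" if f: "f \<in> cE_space h" for f
  proof -
    obtain c where c: "rho h m f = ereal c" "0 \<le> c"
        "\<And>x \<alpha>. (1 + norm x) ^ m * cmod (mderiv \<alpha> f x) \<le> c * (mi_fact \<alpha> * exp (- h (mi_real \<alpha>)))"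
      by (rule cE_spaceD[OF f, of m]) (rule that)
    define F where "F = extension_map f"
    have F: "F \<in> separately_holomorphic" "restr F = f"
      unfolding F_def using tame_extension[OF cE_space_tame[OF h(1) f]] by auto
    have "cmod (F z) * (1 + norm z) ^ m \<le> (C * c) * exp (phi h'' (im_vec z))" for z
    proof -
      define x where "x = (\<chi> i. Re (z $ i))"
      define y where "y = im_vec z"
      define w where "w = (\<chi> i. \<i> * complex_of_real (y $ i))"
      have z: "z = cvec x + w"
        by (simp add: vec_eq_iff cvec_def x_def w_def y_def im_vec_def complex_eq)
      have "norm w = norm y"
        by (simp add: norm_vec_def w_def norm_mult)
      then have nz: "1 + norm z \<le> (1 + norm x) * (1 + norm y)"
        using norm_triangle_ineq[of "cvec x" w] by (intro one_plus_norm_mult) (simp add: z norm_cvec)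
      define D where "D = c * exp \<gamma> * exp (phi h' y)"
      have "cmod (of_real ((1 + norm x) ^ m) * F z) \<le> D * K"
      proof (rule norm_infsum_le)
        show "((\<lambda>\<alpha>. of_real ((1 + norm x) ^ m) * (cmderiv \<alpha> F (cvec x) / of_real (mi_fact \<alpha>) * mi_power w \<alpha>))
            has_sum of_real ((1 + norm x) ^ m) * F z) UNIV"
          unfolding z by (intro has_sum_cmult_right has_sum_taylor F(1))
        show "((\<lambda>\<alpha>::nat ^ 'a. D * (\<Prod>i\<in>UNIV. (1 / 2) ^ (\<alpha> $ i))) has_sum D * K) UNIV"
          by (intro has_sum_cmult_right K)
        fix \<alpha> :: "nat ^ 'a"
        have "cmod (mi_power w \<alpha>) = (\<Prod>i\<in>UNIV. \<bar>y $ i\<bar> ^ (\<alpha> $ i))"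
          by (simp add: norm_mi_power w_def norm_mult)
        moreover have "cmderiv \<alpha> F (cvec x) = mderiv \<alpha> f x"
          using mderiv_restr[OF F(1), of \<alpha>] by (simp add: F(2) restr_def)
        ultimately have "cmod (of_real ((1 + norm x) ^ m) * (cmderiv \<alpha> F (cvec x) / of_real (mi_fact \<alpha>) * mi_power w \<alpha>)) =
            ((1 + norm x) ^ m * cmod (mderiv \<alpha> f x)) / mi_fact \<alpha> * (\<Prod>i\<in>UNIV. \<bar>y $ i\<bar> ^ (\<alpha> $ i))"
          using mi_fact_pos[of \<alpha>] by (simp add: norm_mult norm_divide norm_power flip: of_real_power)
        also have "\<dots> \<le> c * (mi_fact \<alpha> * exp (- h (mi_real \<alpha>))) / mi_fact \<alpha> * (\<Prod>i\<in>UNIV. \<bar>y $ i\<bar> ^ (\<alpha> $ i))"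
          using mi_fact_pos[of \<alpha>] by (intro mult_right_mono divide_right_mono c(3) prod_nonneg) auto
        also have "\<dots> = c * (exp (- h (mi_real \<alpha>)) * (\<Prod>i\<in>UNIV. \<bar>y $ i\<bar> ^ (\<alpha> $ i)))"
          using mi_fact_pos[of \<alpha>] by simp
        also have "\<dots> \<le> c * (exp \<gamma> * exp (phi h' y) * (\<Prod>i\<in>UNIV. (1 / 2) ^ (\<alpha> $ i)))"
          by (intro mult_left_mono c(2) monomial_le_exp_phi h(2) shift)
        finally show "cmod (of_real ((1 + norm x) ^ m) * (cmderiv \<alpha> F (cvec x) / of_real (mi_fact \<alpha>) * mi_power w \<alpha>)) \<le>
            D * (\<Prod>i\<in>UNIV. (1 / 2) ^ (\<alpha> $ i))"
          by (simp add: D_def mult_ac)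
      qed
      then have Fz: "(1 + norm x) ^ m * cmod (F z) \<le> D * K"
        by (simp add: norm_mult norm_power flip: of_real_power)
      have "cmod (F z) * (1 + norm z) ^ m \<le> cmod (F z) * ((1 + norm x) * (1 + norm y)) ^ m"
        by (intro mult_left_mono power_mono nz) auto
      also have "\<dots> = ((1 + norm x) ^ m * cmod (F z)) * (1 + norm y) ^ m"
        by (simp add: power_mult_distrib)
      also have "\<dots> \<le> D * K * (1 + norm y) ^ m"
        by (intro mult_right_mono Fz) simp
      also have "\<dots> = (c * exp \<gamma> * K) * (exp (phi h' y) * (1 + norm y) ^ m)"
        by (simp add: D_def)
      also have "\<dots> \<le> (c * exp \<gamma> * (K + 1)) * (E * exp (phi h'' y))"
        unfolding E_def using c(2) \<open>0 \<le> K\<close>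
        by (intro mult_mono exp_phi_absorbs_norm_power h subadd mult_left_mono) auto
      finally show ?thesis
        by (simp add: C_def y_def mult_ac)
    qed
    then have "pnorm (phi h'') m F \<le> ereal (C * c)"
      by (simp add: pnorm_le_iff)
    then show ?thesis
      by (simp add: F_def c(1))
  qed
  ultimately show ?thesis by blast
qed

text \<open>The Cauchy radii depend on \<alpha>, so the m-th power of 1 + norm R, lost between the
  centre x and the points of the polydisc, has to be absorbed uniformly in R. This is the passage
  from \<open>h\<close> to \<open>h'\<close>; accordingly R is chosen for the pair
  \<open>h'\<close>, \<open>h''\<close>.\<close>

lemma restr_bound:
  assumes h: "weight h" "weight h'" "weight h''"
    and subadd: "\<And>x y. x \<in> orthant \<Longrightarrow> y \<in> orthant \<Longrightarrow> h' (x + y) \<le> h x + h y + l"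
    and shift: "\<And>x. x \<in> orthant \<Longrightarrow> h' x - h'' x \<ge> ln 2 * (\<Sum>j\<in>UNIV. x $ j) - \<gamma>"
  shows "\<exists>C>0. \<forall>F\<in>E_space (phi h). rho h'' m (restr F) \<le> ereal C * pnorm (phi h) m F"
proof -
  interpret weight h by (rule h)
  define E where "E = exp (h (\<chi> i. real m) + l)"
  define C where "C = E * exp (\<gamma> + 1)"
  have "0 < C"
    by (simp add: C_def E_def)
  moreover have "rho h'' m (restr F) \<le> ereal C * pnorm (phi h) m F" if F: "F \<in> E_space (phi h)" for F
  proof -
    obtain c where c: "pnorm (phi h) m F = ereal c" "0 \<le> c"
        "\<And>z. cmod (F z) * (1 + norm z) ^ m \<le> c * exp (phi h (im_vec z))"
      by (rule E_spaceD[OF F, of m]) (rule that)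
    note F' = E_space_separately_holomorphic[OF F]
    have "(1 + norm x) ^ m * cmod (mderiv \<alpha> (restr F) x) \<le> (C * c) * (mi_fact \<alpha> * exp (- h'' (mi_real \<alpha>)))" for x \<alpha>
    proof -
      obtain R where R: "\<And>i. 0 < R $ i"
          "exp (phi h' R) \<le> exp (\<gamma> + 1) * exp (- h'' (mi_real \<alpha>)) * (\<Prod>i\<in>UNIV. R $ i ^ (\<alpha> $ i))"
        using exists_cauchy_radius[OF h(2,3) shift, where \<alpha> = \<alpha>] by blast
      define P where "P = (\<Prod>i\<in>UNIV. R $ i ^ (\<alpha> $ i))"
      have P: "0 < P"
        unfolding P_def using R(1) by (intro prod_pos) simp
      have pos: "0 < (1 + norm x) ^ m"
        by (simp add: add_pos_nonneg)
      \<comment> \<open>The bound of F on the polydisc about x: decay at the points of the polydisc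
        becomes decay in x at the cost of a power of 1 + norm R, which
        \<open>E * exp (phi h' R)\<close> already contains.\<close>
      define B where "B = c * (E * exp (phi h' R)) / (1 + norm x) ^ m"
      have "cmod (cmderiv \<alpha> F (cvec x)) \<le> B * mi_fact \<alpha> / P"
        unfolding P_def
      proof (rule cauchy_estimate_cmderiv[OF F' R(1)])
        fix \<zeta> assume \<zeta>: "\<And>i. cmod (\<zeta> $ i - cvec x $ i) \<le> R $ i"
        \<comment> \<open>The centre is real, so the imaginary parts on the polydisc are bounded by
          R and \<open>phi_mono\<close> applies.\<close>
        have "\<bar>im_vec \<zeta> $ i\<bar> \<le> \<bar>R $ i\<bar>" for i
          using order_trans[OF abs_Im_le_cmod \<zeta>[of i]] R(1)[of i] by (simp add: cvec_def im_vec_def)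
        then have phi: "phi h (im_vec \<zeta>) \<le> phi h R"
          by (rule phi_mono)
        have "norm (\<zeta> - cvec x) \<le> norm R"
          using \<zeta> R(1) by (intro norm_le_componentwise) (simp add: less_imp_le)
        then have "norm x \<le> norm \<zeta> + norm R"
          using norm_triangle_ineq4[of \<zeta> "\<zeta> - cvec x"] by (simp add: norm_cvec)
        then have nx: "1 + norm x \<le> (1 + norm \<zeta>) * (1 + norm R)"
          by (rule one_plus_norm_mult)
        have "cmod (F \<zeta>) * (1 + norm x) ^ m \<le> cmod (F \<zeta>) * ((1 + norm \<zeta>) * (1 + norm R)) ^ m"
          by (intro mult_left_mono power_mono nx) auto
        also have "\<dots> = (cmod (F \<zeta>) * (1 + norm \<zeta>) ^ m) * (1 + norm R) ^ m"
          by (simp add: power_mult_distrib)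
        also have "\<dots> \<le> (c * exp (phi h (im_vec \<zeta>))) * (1 + norm R) ^ m"
          by (intro mult_right_mono c(3)) simp
        also have "\<dots> \<le> c * (exp (phi h R) * (1 + norm R) ^ m)"
          using phi c(2) by (simp add: mult.assoc mult_left_mono mult_right_mono)
        also have "\<dots> \<le> c * (E * exp (phi h' R))"
          unfolding E_def by (intro mult_left_mono c(2) exp_phi_absorbs_norm_power h subadd)
        finally show "cmod (F \<zeta>) \<le> B"
          using pos by (simp add: B_def pos_le_divide_eq)
      qed
      then have "cmod (mderiv \<alpha> (restr F) x) \<le> B * mi_fact \<alpha> / P"
        by (simp add: mderiv_restr[OF F'] restr_def)
      then have "(1 + norm x) ^ m * cmod (mderiv \<alpha> (restr F) x) \<le> (1 + norm x) ^ m * (B * mi_fact \<alpha> / P)"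
        using pos by (intro mult_left_mono) auto
      also have "\<dots> = c * E * mi_fact \<alpha> * (exp (phi h' R) / P)"
      proof -
        have "1 + norm x \<noteq> 0"
          using norm_ge_zero[of x] by linarith
        then show ?thesis
          by (simp add: B_def)
      qed
      also have "\<dots> \<le> c * E * mi_fact \<alpha> * (exp (\<gamma> + 1) * exp (- h'' (mi_real \<alpha>)))"
        using R(2) P c(2) mi_fact_pos[of \<alpha>] by (intro mult_left_mono) (auto simp: E_def pos_divide_le_eq P_def)
      finally show ?thesis
        by (simp add: C_def mult_ac)
    qed
    then have "rho h'' m (restr F) \<le> ereal (C * c)"
      by (simp add: rho_le_iff)
    then show ?thesis
      by (simp add: c(1))
  qed
  ultimately show ?thesis by blast
qed

text \<open>On restrictions \<open>extension_map\<close> undoes the linear map \<open>restr\<close>,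
  and restrictions of entire functions are closed under the vector operations; an inverse of a
  linear map is linear.\<close>

lemma extension_map_linear:
  assumes "\<And>f. f \<in> V \<Longrightarrow> \<exists>F\<in>separately_holomorphic. f = restr F"
  shows "fun_linear_on V extension_map"
  unfolding fun_linear_on_def
proof (intro conjI ballI allI)
  fix f assume "f \<in> V"
  then obtain F where F: "F \<in> separately_holomorphic" "f = restr F"
    using assms by blast
  show "extension_map (\<lambda>x. c * f x) = (\<lambda>x. c * extension_map f x)" for c
    unfolding F(2) restr_scale[symmetric]
    by (simp add: extension_map_restr separately_holomorphic_scale F(1))
  fix g assume "g \<in> V"
  then obtain G where G: "G \<in> separately_holomorphic" "g = restr G"
    using assms by blast
  show "extension_map (\<lambda>x. f x + g x) = (\<lambda>x. extension_map f x + extension_map g x)"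
    unfolding F(2) G(2) restr_add[symmetric]
    by (simp add: extension_map_restr separately_holomorphic_add F(1) G(1))
qed

lemma restr_linear: "fun_linear_on W restr"
  by (simp add: fun_linear_on_def restr_def[abs_def])

section \<open>Inclusions between consecutive steps, and the isomorphism\<close>

lemma cE_space_mono:
  assumes "weight h" and f: "f \<in> cE_space h" and le: "\<And>x. x \<in> orthant \<Longrightarrow> h' x \<le> h x + \<gamma>"
  shows "f \<in> cE_space h'"
proof (rule cE_spaceI)
  show "f \<in> Cinfinity"
    using f by (auto simp: cE_space_def cE_space_m_def)
  fix m
  obtain c where c: "rho h m f = ereal c" "0 \<le> c"
      "\<And>x \<alpha>. (1 + norm x) ^ m * cmod (mderiv \<alpha> f x) \<le> c * (mi_fact \<alpha> * exp (- h (mi_real \<alpha>)))"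
    by (rule cE_spaceD[OF f, of m]) (rule that)
  have "(1 + norm x) ^ m * cmod (mderiv \<alpha> f x) \<le> (c * exp \<gamma>) * (mi_fact \<alpha> * exp (- h' (mi_real \<alpha>)))" for x \<alpha>
  proof -
    have "exp (- h (mi_real \<alpha>)) \<le> exp \<gamma> * exp (- h' (mi_real \<alpha>))"
      using le[OF mi_real_orthant[of \<alpha>]] by (simp flip: exp_add)
    then have "c * (mi_fact \<alpha> * exp (- h (mi_real \<alpha>))) \<le> c * (mi_fact \<alpha> * (exp \<gamma> * exp (- h' (mi_real \<alpha>))))"
      using mi_fact_pos[of \<alpha>] c(2) by (intro mult_left_mono) auto
    then show ?thesis
      using c(3)[of x \<alpha>] by (simp add: mult_ac)
  qed
  then show "\<exists>C. \<forall>x \<alpha>. (1 + norm x) ^ m * cmod (mderiv \<alpha> f x) \<le> C * (mi_fact \<alpha> * exp (- h' (mi_real \<alpha>)))"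
    by blast
qed

lemma E_space_mono:
  assumes F: "F \<in> E_space \<phi>" and le: "\<And>y. \<phi> y \<le> \<phi>' y + C"
  shows "F \<in> E_space \<phi>'"
proof (rule E_spaceI)
  show "F \<in> entire"
    using F by (auto simp: E_space_def E_space_m_def)
  fix m
  obtain c where c: "pnorm \<phi> m F = ereal c" "0 \<le> c"
      "\<And>z. cmod (F z) * (1 + norm z) ^ m \<le> c * exp (\<phi> (im_vec z))"
    by (rule E_spaceD[OF F, of m]) (rule that)
  have "cmod (F z) * (1 + norm z) ^ m \<le> (c * exp C) * exp (\<phi>' (im_vec z))" for z
  proof -
    have "c * exp (\<phi> (im_vec z)) \<le> c * (exp C * exp (\<phi>' (im_vec z)))"
      using le[of "im_vec z"] by (intro mult_left_mono c(2)) (simp flip: exp_add)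
    then show ?thesis
      using c(3)[of z] by (simp add: mult.assoc)
  qed
  then show "\<exists>C. \<forall>z. cmod (F z) * (1 + norm z) ^ m \<le> C * exp (\<phi>' (im_vec z))"
    by blast
qed

theorem theorem1:
  fixes h :: "nat \<Rightarrow> real ^ 'n::finite \<Rightarrow> real"
  assumes convex: "\<And>\<nu>. 1 \<le> \<nu> \<Longrightarrow> convex_on UNIV (h \<nu>)"
    and even: "\<And>\<nu> x. 1 \<le> \<nu> \<Longrightarrow> h \<nu> x = h \<nu> (\<chi> i. \<bar>x $ i\<bar>)"
    and mono: "\<And>\<nu> x i. 1 \<le> \<nu> \<Longrightarrow> x \<in> orthant \<Longrightarrow>
           mono_on {0..} (\<lambda>t. h \<nu> (\<chi> j. if j = i then t else x $ j))"
    and superlinear: "\<And>\<nu>. 1 \<le> \<nu> \<Longrightarrow> filterlim (\<lambda>x. h \<nu> x / norm x) at_top at_infinity"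
    and upper: "\<And>\<nu> M. 1 \<le> \<nu> \<Longrightarrow> 0 < M \<Longrightarrow>
           \<exists>A>0. \<forall>x\<in>orthant. h \<nu> x \<le> (\<Sum>j | x $ j \<noteq> 0. x $ j * ln (x $ j / M)) + A"
    and shift: "\<And>\<nu>. 1 \<le> \<nu> \<Longrightarrow>
           \<exists>\<gamma>. \<forall>x\<in>orthant. h \<nu> x - h (\<nu> + 1) x \<ge> ln 2 * (\<Sum>j\<in>UNIV. x $ j) - \<gamma>"
    and subadd: "\<And>\<nu>. 1 \<le> \<nu> \<Longrightarrow>
           \<exists>l. \<forall>x\<in>orthant. \<forall>y\<in>orthant. h (\<nu> + 1) (x + y) \<le> h \<nu> x + h \<nu> y + l"
  shows "tvs_isomorphism (cE_lim h) (cE_lim_top h)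
           (E_lim (\<lambda>\<nu>. phi (h \<nu>))) (E_lim_top (\<lambda>\<nu>. phi (h \<nu>))) extension_map"
proof -
  have weight: "weight (h \<nu>)" if "1 \<le> \<nu>" for \<nu>
    using that convex even mono superlinear by unfold_locales
  obtain \<gamma> where \<gamma>: "\<And>\<nu> x. 1 \<le> \<nu> \<Longrightarrow> x \<in> orthant \<Longrightarrow>
      h \<nu> x - h (\<nu> + 1) x \<ge> ln 2 * (\<Sum>j\<in>UNIV. x $ j) - \<gamma> \<nu>"
    using shift by metis
  obtain l where l: "\<And>\<nu> x y. 1 \<le> \<nu> \<Longrightarrow> x \<in> orthant \<Longrightarrow> y \<in> orthant \<Longrightarrow>
      h (\<nu> + 1) (x + y) \<le> h \<nu> x + h \<nu> y + l \<nu>"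
    using subadd by metis
  have restriction: "\<exists>F\<in>separately_holomorphic. f = restr F" if "f \<in> cE_space (h \<nu>)" "1 \<le> \<nu>" for f \<nu>
    using cE_space_restr[OF weight that(1)] that(2) by blast
  \<comment> \<open>The extension uses \<gamma> at \<nu> and then l at \<nu> + 1; for the
    restriction below, l at \<nu> comes first and \<gamma> at \<nu> + 1 second.\<close>
  have ext: "\<exists>C>0. \<forall>f\<in>cE_space (h \<nu>). pnorm (phi (h (\<nu> + 1 + 1))) m (extension_map f) \<le> ereal C * rho (h \<nu>) m f"
    if "1 \<le> \<nu>" for \<nu> m
    using that by (intro extension_map_bound[of "h \<nu>" "h (\<nu> + 1)" _ "\<gamma> \<nu>" "l (\<nu> + 1)"] weight \<gamma> l) auto
  have res: "\<exists>C>0. \<forall>F\<in>E_space (phi (h \<nu>)). rho (h (\<nu> + 1 + 1)) m (restr F) \<le> ereal C * pnorm (phi (h \<nu>)) m F"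
    if "1 \<le> \<nu>" for \<nu> m
    using that by (intro restr_bound[of "h \<nu>" "h (\<nu> + 1)" _ "l \<nu>" "\<gamma> (\<nu> + 1)"] weight \<gamma> l) auto
  have finite_bound: "a < \<infinity>" if "a \<le> ereal C * b" "0 \<le> b" "b < \<infinity>" for a b :: ereal and C
    using that by (cases b) (auto intro: le_less_trans)
  show ?thesis
    unfolding cE_lim_top_def E_lim_top_def cE_lim_def E_lim_def cE_top_def E_top_def
  proof (rule tvs_isomorphism_inductive_limits[where B = restr])
    fix \<nu> :: nat assume \<nu>: "1 \<le> \<nu>"
    show "seminorms_on (cE_space (h \<nu>)) (rho (h \<nu>))"
      by (rule seminorms_on_cE_space[OF weight[OF \<nu>]])
    show "seminorms_on (E_space (phi (h \<nu>))) (pnorm (phi (h \<nu>)))"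
      by (rule seminorms_on_E_space)
    show "cE_space (h \<nu>) \<subseteq> cE_space (h (\<nu> + 1))"
    proof
      fix f assume "f \<in> cE_space (h \<nu>)"
      moreover have "h (\<nu> + 1) x \<le> h \<nu> x + \<gamma> \<nu>" if x: "x \<in> orthant" for x
      proof -
        have "0 \<le> ln 2 * (\<Sum>j\<in>UNIV. x $ j)"
          using x by (intro mult_nonneg_nonneg sum_nonneg) (auto simp: orthant_def)
        then show ?thesis
          using \<gamma>[OF \<nu> x] by linarith
      qed
      ultimately show "f \<in> cE_space (h (\<nu> + 1))"
        by (rule cE_space_mono[OF weight[OF \<nu>]])
    qed
    show "E_space (phi (h \<nu>)) \<subseteq> E_space (phi (h (\<nu> + 1)))"
    proof
      fix F assume "F \<in> E_space (phi (h \<nu>))"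
      \<comment> \<open>The case c = 0 of \<open>phi_absorbs_logs\<close>: with one argument equal
        to 0, \<open>subadd\<close> bounds h (\<nu> + 1) by h \<nu> plus a constant, and conjugation
        reverses the order.\<close>
      moreover have "phi (h \<nu>) y \<le> phi (h (\<nu> + 1)) y + (h \<nu> (\<chi> i. 0) + l \<nu>)" for y
        using phi_absorbs_logs[OF weight[OF \<nu>] weight[of "\<nu> + 1"] l[OF \<nu>], of 0 y] by simp
      ultimately show "F \<in> E_space (phi (h (\<nu> + 1)))"
        by (rule E_space_mono)
    qed
    show "restr (extension_map f) = f" if "f \<in> cE_space (h \<nu>)" for f
      by (rule tame_extension(2)[OF cE_space_tame[OF weight[OF \<nu>] that]])
    show "extension_map (restr F) = F" if "F \<in> E_space (phi (h \<nu>))" for F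
      by (rule extension_map_restr[OF E_space_separately_holomorphic[OF that]])
    have "extension_map f \<in> E_space (phi (h (\<nu> + 1 + 1)))" if f: "f \<in> cE_space (h \<nu>)" for f
    proof -
      have "pnorm (phi (h (\<nu> + 1 + 1))) m (extension_map f) < \<infinity>" for m
      proof -
        obtain C where "pnorm (phi (h (\<nu> + 1 + 1))) m (extension_map f) \<le> ereal C * rho (h \<nu>) m f"
          using ext[OF \<nu>, of m] f by blast
        moreover have "rho (h \<nu>) m f < \<infinity>"
          using f by (auto simp: cE_space_def cE_space_m_def)
        ultimately show ?thesis
          by (rule finite_bound[OF _ rho_nonneg])
      qed
      moreover have "extension_map f \<in> entire"
        unfolding entire_eq_separately_holomorphic
        by (rule tame_extension(1)[OF cE_space_tame[OF weight[OF \<nu>] f]])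
      ultimately show ?thesis
        by (simp add: E_space_def E_space_m_def)
    qed
    \<comment> \<open>The target step is \<nu> + 2 for all seminorms at once, and k = m.\<close>
    then show "\<exists>\<mu>\<ge>1. extension_map ` cE_space (h \<nu>) \<subseteq> E_space (phi (h \<mu>)) \<and>
        (\<forall>m. \<exists>k C. 0 < C \<and> (\<forall>f\<in>cE_space (h \<nu>). pnorm (phi (h \<mu>)) m (extension_map f) \<le> ereal C * rho (h \<nu>) k f))"
      using ext[OF \<nu>] by (intro exI[of _ "\<nu> + 1 + 1"] conjI) (simp, blast, blast)
    have "restr F \<in> cE_space (h (\<nu> + 1 + 1))" if F: "F \<in> E_space (phi (h \<nu>))" for F
    proof -
      have "rho (h (\<nu> + 1 + 1)) m (restr F) < \<infinity>" for m
      proof -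
        obtain C where "rho (h (\<nu> + 1 + 1)) m (restr F) \<le> ereal C * pnorm (phi (h \<nu>)) m F"
          using res[OF \<nu>, of m] F by blast
        moreover have "pnorm (phi (h \<nu>)) m F < \<infinity>"
          using F by (auto simp: E_space_def E_space_m_def)
        ultimately show ?thesis
          by (rule finite_bound[OF _ pnorm_nonneg])
      qed
      moreover have "restr F \<in> Cinfinity"
        by (rule restr_Cinfinity[OF E_space_separately_holomorphic[OF F]])
      ultimately show ?thesis
        by (simp add: cE_space_def cE_space_m_def)
    qed
    then show "\<exists>\<mu>\<ge>1. restr ` E_space (phi (h \<nu>)) \<subseteq> cE_space (h \<mu>) \<and>
        (\<forall>m. \<exists>k C. 0 < C \<and> (\<forall>F\<in>E_space (phi (h \<nu>)). rho (h \<mu>) m (restr F) \<le> ereal C * pnorm (phi (h \<nu>)) k F))"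
      using res[OF \<nu>] by (intro exI[of _ "\<nu> + 1 + 1"] conjI) (simp, blast, blast)
  next
    show "fun_linear_on (\<Union>\<nu>\<in>{1..}. cE_space (h \<nu>)) extension_map"
      by (rule extension_map_linear) (use restriction in auto)
    show "fun_linear_on (\<Union>\<nu>\<in>{1..}. E_space (phi (h \<nu>))) restr"
      by (rule restr_linear)
  qed
qed

end
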